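(* Let $i\in I$, $k\in\mathbb{Z}$, and let $x\in\widehat{\mathcal{A}}_{>k+1}$, $y\in\widehat{\mathcal{A}}_{[k+1]}$, $z\in\widehat{\mathcal{A}}_{[k]}$, $w\in\widehat{\mathcal{A}}_{<k}$ be homogeneous elements. Then \begin{enumerate} \item[(i)] $f_{i,k}(xyzw)=q_i^{(-1)^k\langle h_i,\mathrm{wt}(xy)\rangle-1}\big((q_i^{-1}-q_i)x(e_i^\star(y))zw+q_ixy(f_{i,k}z)w\big)$, \item[(ii)] $E'_{i,k}(xyzw)=q_i^{(-1)^k\langle h_i,\mathrm{wt}(xy)\rangle}\big((q_i^{-1}-q_i)xy(e'_i(z))w+q_ix(yf_{i,k+1})zw\big)$, \item[(iii)] $(xyzw)f_{i,k+1}=q_i^{(-1)^{k+1}\langle h_i,\mathrm{wt}(zw)\rangle-1}\big((q_i^{-1}-q_i)xy(e'_i(z))w+q_ix(yf_{i,k+1})zw\big)$, \item[(iv)] $E^\star_{i,k+1}(xyzw)=q_i^{(-1)^{k+1}\langle h_i,\mathrm{wt}(zw)\rangle}\big((q_i^{-1}-q_i)x(e_i^\star(y))zw+q_ixy(f_{i,k}z)w\big)$. \end{enumerate}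
   Context: Let $\mathsf{C}=(c_{i,j})_{i,j\in I}$ be a finite-type Cartan matrix with simple roots $\alpha_i$, coroots $h_i$, $(\alpha_i,\alpha_j)=\mathsf{d}_ic_{i,j}$ ($\min\mathsf{d}_i=1$), $q_i=q^{\mathsf{d}_i}$, $\mathbf{k}=\mathbb{Q}(q^{1/2})$. $\widehat{\mathcal{A}}$ is the bosonic extension generated by $f_{i,p}$ ($i\in I,p\in\mathbb{Z}$) with quantum Serre relations among $\{f_{i,p}\}_{i\in I}$ for fixed $p$, $f_{i,m}f_{j,p}=q_i^{(-1)^{p-m+1}c_{i,j}}f_{j,p}f_{i,m}$ ($p>m+1$), $f_{i,p}f_{j,p+1}=q_i^{c_{i,j}}f_{j,p+1}f_{i,p}+\delta_{i,j}(1-q_i^2)$, weights $\mathrm{wt}(f_{i,p})=(-1)^{p+1}\alpha_i$. For an interval $J$, $\widehat{\mathcal{A}}_J$ is the subalgebra generated by $f_{i,p}$, $p\in J$ (e.g. $\widehat{\mathcal{A}}_{>k+1}$, $\widehat{\mathcal{A}}_{<k}$); $\widehat{\mathcal{A}}_{[k]}\cong\mathcal{U}_q^-(\mathfrak{g})$ via $f_{i,k}\mapsto f_i$. $e'_i,e^\star_i$ are the $q$-derivations of $\mathcal{U}_q^-(\mathfrak{g})$ with $e'_i(f_j)=e^\star_i(f_j)=\delta_{i,j}$, $e'_i(uv)=e'_i(u)v+q_i^{\langle h_i,\mathrm{wt}(u)\rangle}ue'_i(v)$, $e^\star_i(uv)=ue^\star_i(v)+q_i^{\langle h_i,\mathrm{wt}(v)\rangle}e^\star_i(u)v$,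 acting on each $\widehat{\mathcal{A}}_{[k]}$ via this identification. $(\!(\cdot,\cdot)\!)$ is the bilinear form on $\widehat{\mathcal{A}}$: for homogeneous $u=u_b\cdots u_a$, $v=v_b\cdots v_a$ with $u_k,v_k$ weight vectors of $\widehat{\mathcal{A}}_{[k]}$, $(\!(u,v)\!)=\prod_k\kappa^{|\mathrm{wt}(u_k)|+|\mathrm{wt}(v_k)|}(u_k,v_k)_L$, where $(\cdot,\cdot)_L$ is Lusztig's form ($(f_i,f_j)_L=\delta_{i,j}/(1-q_i^2)$), $\kappa_i=q_i^{1/2}(q_i^{-1}-q_i)$, $\kappa^{\sum n_i\alpha_i}=\prod\kappa_i^{n_i}$, $|\sum n_i\alpha_i|=\sum|n_i|\alpha_i$; it is symmetric and non-degenerate. $E'_{i,k}$ and $E^\star_{i,k}$ are the $\mathbf{k}$-linear maps on $\widehat{\mathcal{A}}$ defined by $(\!(E'_{i,k}(u),v)\!)=(\!(u,f_{i,k}v)\!)$ and $(\!(E^\star_{i,k}(u),v)\!)=(\!(u,vf_{i,k})\!)$ for all $u,v$. *)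

theory Defs
  imports Main "HOL-Computational_Algebra.Polynomial" "HOL-Computational_Algebra.Fraction_Field"
begin

type_synonym K = "rat poly fract"

text \<open>qh is the indeterminate q^(1/2); q = qh^2.\<close>
definition qh :: K where "qh = Fract [:0, 1:] 1"

definition qi :: "('i \<Rightarrow> nat) \<Rightarrow> 'i \<Rightarrow> int \<Rightarrow> K" where
  "qi d i m = qh powi (2 * int (d i) * m)"

definition kap :: "('i \<Rightarrow> nat) \<Rightarrow> 'i \<Rightarrow> K" where
  "kap d i = qh ^ d i * (qi d i (-1) - qi d i 1)"

definition sgnpow :: "int \<Rightarrow> int" where
  "sgnpow n = (if even n then 1 else -1)"

definition finite_cartan :: "('i::finite \<Rightarrow> 'i \<Rightarrow> int) \<Rightarrow> ('i \<Rightarrow> nat) \<Rightarrow> bool" where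
  "finite_cartan C d \<longleftrightarrow>
     (\<forall>i. C i i = 2) \<and> (\<forall>i j. i \<noteq> j \<longrightarrow> C i j \<le> 0) \<and>
     (\<forall>i. d i > 0) \<and> (\<exists>i. d i = 1) \<and>
     (\<forall>i j. int (d i) * C i j = int (d j) * C j i) \<and>
     (\<forall>v :: 'i \<Rightarrow> real. v \<noteq> (\<lambda>_. 0) \<longrightarrow>
        (\<Sum>i\<in>UNIV. \<Sum>j\<in>UNIV. v i * real (d i) * real_of_int (C i j) * v j) > 0)"

text \<open>pairing <h_i, beta> for beta = sum_j beta_j alpha_j\<close>
definition pair :: "('i::finite \<Rightarrow> 'i \<Rightarrow> int) \<Rightarrow> 'i \<Rightarrow> ('i \<Rightarrow> int) \<Rightarrow> int" where
  "pair C i \<beta> = (\<Sum>j\<in>UNIV. C i j * \<beta> j)"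

type_synonym 'a fsum = "(K \<times> 'a list) list"

definition coeffs :: "'a fsum \<Rightarrow> 'a list \<Rightarrow> K" where
  "coeffs s w = (\<Sum>(c, v)\<leftarrow>s. if v = w then c else 0)"

definition fmul :: "'a fsum \<Rightarrow> 'a fsum \<Rightarrow> 'a fsum" where
  "fmul a b = concat (map (\<lambda>(c, u). map (\<lambda>(c', v). (c * c', u @ v)) b) a)"

definition fadd :: "'a fsum \<Rightarrow> 'a fsum \<Rightarrow> 'a fsum" where
  "fadd a b = a @ b"

definition fsmul :: "K \<Rightarrow> 'a fsum \<Rightarrow> 'a fsum" where
  "fsmul c a = map (\<lambda>(c', u). (c * c', u)) a"

definition gen :: "'a \<Rightarrow> 'a fsum" where
  "gen x = [(1, [x])]"

definition flin :: "('a list \<Rightarrow> 'b fsum) \<Rightarrow> 'a fsum \<Rightarrow> 'b fsum" where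
  "flin F s = concat (map (\<lambda>(c, u). fsmul c (F u)) s)"

definition m4 :: "'a fsum \<Rightarrow> 'a fsum \<Rightarrow> 'a fsum \<Rightarrow> 'a fsum \<Rightarrow> 'a fsum" where
  "m4 a b c e = fmul (fmul (fmul a b) c) e"

definition qint :: "('i \<Rightarrow> nat) \<Rightarrow> 'i \<Rightarrow> nat \<Rightarrow> K" where
  "qint d i n = (qi d i (int n) - qi d i (- int n)) / (qi d i 1 - qi d i (-1))"

definition qfact :: "('i \<Rightarrow> nat) \<Rightarrow> 'i \<Rightarrow> nat \<Rightarrow> K" where
  "qfact d i n = (\<Prod>m=1..n. qint d i m)"

definition qbinom :: "('i \<Rightarrow> nat) \<Rightarrow> 'i \<Rightarrow> nat \<Rightarrow> nat \<Rightarrow> K" where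
  "qbinom d i n m = qfact d i n / (qfact d i m * qfact d i (n - m))"

definition serre_rel :: "('i \<Rightarrow> 'i \<Rightarrow> int) \<Rightarrow> ('i \<Rightarrow> nat) \<Rightarrow> 'i \<Rightarrow> 'i \<Rightarrow> int \<Rightarrow> ('i \<times> int) fsum" where
  "serre_rel C d i j p =
     (let N = nat (1 - C i j) in
      map (\<lambda>n. ((-1) ^ n * qbinom d i N n,
                 replicate (N - n) (i, p) @ [(j, p)] @ replicate n (i, p))) [0..<N + 1])"

definition rels :: "('i \<Rightarrow> 'i \<Rightarrow> int) \<Rightarrow> ('i \<Rightarrow> nat) \<Rightarrow> ('i \<times> int) fsum set" where
  "rels C d =
     {serre_rel C d i j p | i j p. i \<noteq> j}
   \<union> {[(1, [(i, m), (j, p)]), (- qi d i (sgnpow (p - m + 1) * C i j), [(j, p), (i, m)])]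
       | i j m p. p > m + 1}
   \<union> {[(1, [(i, p), (j, p + 1)]), (- qi d i (C i j), [(j, p + 1), (i, p)])]
       @ (if i = j then [(- (1 - qi d i 2), [])] else []) | i j p. True}"

text \<open>Equality in the bosonic extension: congruence modulo the two-sided ideal generated by the relations.\<close>
definition cong :: "('i \<Rightarrow> 'i \<Rightarrow> int) \<Rightarrow> ('i \<Rightarrow> nat) \<Rightarrow> ('i \<times> int) fsum \<Rightarrow> ('i \<times> int) fsum \<Rightarrow> bool" where
  "cong C d a b \<longleftrightarrow>
     (\<exists>L. (\<forall>(u, r, v)\<in>set L. r \<in> rels C d) \<and>
          coeffs a = (\<lambda>w. coeffs b w + coeffs (concat (map (\<lambda>(u, r, v). fmul (fmul u r) v) L)) w))"

definition in_sub :: "('i \<Rightarrow> 'i \<Rightarrow> int) \<Rightarrow> ('i \<Rightarrow> nat) \<Rightarrow> int set \<Rightarrow> ('i \<times> int) fsum \<Rightarrow> bool" where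
  "in_sub C d J x \<longleftrightarrow> (\<exists>r. cong C d x r \<and> (\<forall>(c, u)\<in>set r. \<forall>l\<in>set u. snd l \<in> J))"

text \<open>wt(f_{j,p}) = (-1)^(p+1) alpha_j, weights as coefficient vectors.\<close>
definition lwt :: "'i \<times> int \<Rightarrow> 'i \<Rightarrow> int" where
  "lwt x = (\<lambda>l. if l = fst x then sgnpow (snd x + 1) else 0)"

definition wwt :: "('i \<times> int) list \<Rightarrow> 'i \<Rightarrow> int" where
  "wwt u = (\<lambda>l. \<Sum>x\<leftarrow>u. lwt x l)"

definition homog :: "('i \<Rightarrow> 'i \<Rightarrow> int) \<Rightarrow> ('i \<Rightarrow> nat) \<Rightarrow> ('i \<Rightarrow> int) \<Rightarrow> ('i \<times> int) fsum \<Rightarrow> bool" where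
  "homog C d \<beta> x \<longleftrightarrow> (\<exists>r. cong C d x r \<and> (\<forall>(c, u)\<in>set r. wwt u = \<beta>))"

fun ep_w :: "('i \<Rightarrow> 'i \<Rightarrow> int) \<Rightarrow> ('i \<Rightarrow> nat) \<Rightarrow> 'i \<Rightarrow> 'i list \<Rightarrow> 'i fsum" where
  "ep_w C d i [] = []"
| "ep_w C d i (j # u) =
     (if j = i then [(1, u)] else []) @ fsmul (qi d i (- C i j)) (fmul (gen j) (ep_w C d i u))"

text \<open>e*_i(f_j u) = f_j e*_i(u) + q_i^(<h_i, wt u>) delta_ij u\<close>
fun es_w :: "('i \<Rightarrow> 'i \<Rightarrow> int) \<Rightarrow> ('i \<Rightarrow> nat) \<Rightarrow> 'i \<Rightarrow> 'i list \<Rightarrow> 'i fsum" where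
  "es_w C d i [] = []"
| "es_w C d i (j # u) =
     fmul (gen j) (es_w C d i u) @ (if j = i then [(qi d i (- (\<Sum>l\<leftarrow>u. C i l)), u)] else [])"

text \<open>Lusztig's form: (1,1) = 1, (f_i u, v) = (f_i,f_i) (u, e'_i v), (f_i,f_i) = 1/(1-q_i^2).\<close>
fun lus_w :: "('i \<Rightarrow> 'i \<Rightarrow> int) \<Rightarrow> ('i \<Rightarrow> nat) \<Rightarrow> 'i list \<Rightarrow> 'i fsum \<Rightarrow> K" where
  "lus_w C d [] v = coeffs v []"
| "lus_w C d (i # u) v = lus_w C d u (flin (ep_w C d i) v) / (1 - qi d i 2)"

definition lift :: "int \<Rightarrow> 'i fsum \<Rightarrow> ('i \<times> int) fsum" where
  "lift k s = map (\<lambda>(c, u). (c, map (\<lambda>j. (j, k)) u)) s"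

definition unlift :: "('i \<times> int) fsum \<Rightarrow> 'i fsum" where
  "unlift r = map (\<lambda>(c, u). (c, map fst u)) r"

definition at_level :: "int \<Rightarrow> ('i \<times> int) fsum \<Rightarrow> bool" where
  "at_level k r \<longleftrightarrow> (\<forall>(c, u)\<in>set r. \<forall>l\<in>set u. snd l = k)"

text \<open>e'_i and e*_i acting on A_[k] via the identification with U_q^-.\<close>
definition ep_hat :: "('i \<Rightarrow> 'i \<Rightarrow> int) \<Rightarrow> ('i \<Rightarrow> nat) \<Rightarrow> 'i \<Rightarrow> int \<Rightarrow> ('i \<times> int) fsum \<Rightarrow> ('i \<times> int) fsum" where
  "ep_hat C d i k z = (SOME s. \<exists>r. cong C d z r \<and> at_level k r \<and> s = lift k (flin (ep_w C d i) (unlift r)))"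

definition es_hat :: "('i \<Rightarrow> 'i \<Rightarrow> int) \<Rightarrow> ('i \<Rightarrow> nat) \<Rightarrow> 'i \<Rightarrow> int \<Rightarrow> ('i \<times> int) fsum \<Rightarrow> ('i \<times> int) fsum" where
  "es_hat C d i k z = (SOME s. \<exists>r. cong C d z r \<and> at_level k r \<and> s = lift k (flin (es_w C d i) (unlift r)))"

definition ordered :: "('i \<times> int) list \<Rightarrow> bool" where
  "ordered u \<longleftrightarrow> sorted_wrt (\<ge>) (map snd u)"

definition blk :: "int \<Rightarrow> ('i \<times> int) list \<Rightarrow> 'i list" where
  "blk k u = map fst (filter (\<lambda>l. snd l = k) u)"

text \<open>Product over k of kappa^(|wt u_k|+|wt v_k|) (u_k, v_k)_L for ordered words u, v.\<close>
definition bw :: "('i \<Rightarrow> 'i \<Rightarrow> int) \<Rightarrow> ('i \<Rightarrow> nat) \<Rightarrow> ('i \<times> int) list \<Rightarrow> ('i \<times> int) list \<Rightarrow> K" where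
  "bw C d u v = (\<Prod>l\<leftarrow>u @ v. kap d (fst l)) *
               (\<Prod>k\<in>snd ` set (u @ v). lus_w C d (blk k u) [(1, blk k v)])"

definition bform_rep :: "('i \<Rightarrow> 'i \<Rightarrow> int) \<Rightarrow> ('i \<Rightarrow> nat) \<Rightarrow> ('i \<times> int) fsum \<Rightarrow> ('i \<times> int) fsum \<Rightarrow> K" where
  "bform_rep C d a b = (\<Sum>(c, u)\<leftarrow>a. \<Sum>(c', v)\<leftarrow>b. c * c' * bw C d u v)"

definition bform :: "('i \<Rightarrow> 'i \<Rightarrow> int) \<Rightarrow> ('i \<Rightarrow> nat) \<Rightarrow> ('i \<times> int) fsum \<Rightarrow> ('i \<times> int) fsum \<Rightarrow> K" where
  "bform C d X Y = (THE c. \<forall>a b. cong C d X a \<longrightarrow> cong C d Y b \<longrightarrow>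
        (\<forall>(c0, u)\<in>set a. ordered u) \<longrightarrow> (\<forall>(c0, v)\<in>set b. ordered v) \<longrightarrow> bform_rep C d a b = c)"

definition Ep :: "('i \<Rightarrow> 'i \<Rightarrow> int) \<Rightarrow> ('i \<Rightarrow> nat) \<Rightarrow> 'i \<Rightarrow> int \<Rightarrow> ('i \<times> int) fsum \<Rightarrow> ('i \<times> int) fsum" where
  "Ep C d i k X = (SOME E. \<forall>Y. bform C d E Y = bform C d X (fmul (gen (i, k)) Y))"

definition Es :: "('i \<Rightarrow> 'i \<Rightarrow> int) \<Rightarrow> ('i \<Rightarrow> nat) \<Rightarrow> 'i \<Rightarrow> int \<Rightarrow> ('i \<times> int) fsum \<Rightarrow> ('i \<times> int) fsum" where
  "Es C d i k X = (SOME E. \<forall>Y. bform C d E Y = bform C d X (fmul Y (gen (i, k))))"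

end

(* Everything is lifted to free algebras and read modulo ideals.

   Modulo the non-Serre relations alone the ordered words form a basis: the insertion operators that
   bubble a letter in from the left satisfy these relations exactly.  Moving
   f_{i,k} from the left through x and y, and f_{i,k+1} from the right through w and z, then gives
   (i) and (iii); the q-commutator at the neighbouring level is a multiple of a q-derivation.  Since
   e'_i and e*_i are, up to a scalar, adjoint to left and right multiplication by f_i under Lusztig's
   form, the right-hand sides of (ii) and (iv) satisfy the defining property of E'_{i,k} and E*_{i,k+1}.

   That this property determines an element of the bosonic extension, and that the bilinear form is
   well defined at all, rests on the radical of Lusztig's form being generated by the quantum Serre
   elements.  Let x have weight -beta, with beta nonzero, and let e'_i x and e*_i x vanish modulo the
   Serre ideal for all i.  In finite type <h_i, beta> > 0 for some i.  The twisted commutator with f_i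
   is nilpotent on x, because e'_i x = 0, and forms together with e*_i an action of quantum sl_2 in
   which x is a highest weight vector of negative weight.  Hence x = 0, and induction on the height
   shows that the radical vanishes modulo the Serre ideal. *)

theory Submission
  imports Defs "HOL-Library.Poly_Mapping"
begin

subsection \<open>The free algebra on an alphabet\<close>

text \<open>No basis of the full quotient is constructed. Instead, an element lies in
  \<open>ideal RR\<close> exactly when its normal form modulo \<open>R12\<close> lies in
  \<open>RadB\<close>, the radical of the form on the span of ordered words. One direction,
  \<open>nf_RR\<close>, makes the form descend to the quotient and needs only that Serre elements
  lie in the radical of Lusztig's form; the other, \<open>RadB_RR\<close>, gives non-degeneracy and
  needs the converse. The obstacle for \<open>nf_RR\<close> is that the form is given blockwise on
  ordered words, while the ideal is two-sided: \<open>RadB\<close> has to survive left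
  multiplication followed by straightening. It does because that operation has an adjoint on ordered
  words, and this adjoint is a multiple of the bracket in (ii). Thus formula (i) and the adjunction
  behind (ii) already serve to show that the form entering (ii) exists. The constant q_i^{-1} - q_i
  is kappa_i^2 / (1 - q_i^2), the scalar in the adjunction between f_i and e'_i. The powers of q_i
  on the two sides of an adjunction refer to different weights; they agree only because the form
  vanishes between blocks of unequal weight.\<close>

text \<open>With concatenation as the (additive) monoid structure on words, finitely supported functions on
  words multiply as in the free algebra.\<close>

instantiation list :: (type) monoid_add
begin
definition zero_list :: "'a list" where "zero_list = []"
definition plus_list :: "'a list \<Rightarrow> 'a list \<Rightarrow> 'a list" where "plus_list u v = u @ v"
instance by standard (simp_all add: zero_list_def plus_list_def)
end

type_synonym 'a alg = "'a list \<Rightarrow>\<^sub>0 K"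

definition wd :: "'a list \<Rightarrow> 'a alg" where "wd w = Poly_Mapping.single w 1"

definition sc :: "K \<Rightarrow> 'a alg \<Rightarrow> 'a alg" (infixr "\<odot>" 75) where
  "c \<odot> x = Poly_Mapping.single 0 c * x"

lemma lookup_sc [simp]: "Poly_Mapping.lookup (c \<odot> x) w = c * Poly_Mapping.lookup x w"
  unfolding sc_def mult_map_scale_conv_mult[symmetric] by (simp add: Poly_Mapping.map.rep_eq when_def)

interpretation alg: vector_space "(\<odot>) :: K \<Rightarrow> 'a alg \<Rightarrow> 'a alg"
  by standard (auto intro!: poly_mapping_eqI simp: lookup_add algebra_simps)

lemma lookup_wd: "Poly_Mapping.lookup (wd u) w = (if u = w then 1 else 0)"
  by (simp add: wd_def lookup_single)

lemma wd_Nil [simp]: "wd [] = 1"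
  by (simp add: wd_def flip: zero_list_def)

lemma wd_mult [simp]: "wd u * wd v = wd (u @ v)"
  by (simp add: wd_def mult_single plus_list_def)

lemma wd_assoc [simp]: "wd u * (wd v * x) = wd (u @ v) * x"
  by (simp flip: mult.assoc)

lemma keys_wd [simp]: "Poly_Mapping.keys (wd w) = {w}"
  by (simp add: wd_def)

lemma sc_mult_left [simp]: "(c \<odot> x) * y = c \<odot> (x * y)"
  by (simp add: sc_def mult.assoc)

lemma alg_expand: "x = (\<Sum>w\<in>Poly_Mapping.keys x. Poly_Mapping.lookup x w \<odot> wd w)"
  by (rule poly_mapping_eqI)
     (auto simp: lookup_sum lookup_wd if_distrib not_in_keys_iff_lookup_eq_zero cong: if_cong)

definition Sp :: "('a list \<Rightarrow> bool) \<Rightarrow> 'a alg set" where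
  "Sp P = {x. \<forall>w\<in>Poly_Mapping.keys x. P w}"

lemma Sp_iff: "x \<in> Sp P \<longleftrightarrow> (\<forall>w. Poly_Mapping.lookup x w \<noteq> 0 \<longrightarrow> P w)"
  by (auto simp: Sp_def in_keys_iff)

lemma Sp_0 [simp]: "0 \<in> Sp P"
  by (simp add: Sp_def)

lemma Sp_wd [simp]: "wd w \<in> Sp P \<longleftrightarrow> P w"
  by (simp add: Sp_def)

lemma Sp_add: "x \<in> Sp P \<Longrightarrow> y \<in> Sp P \<Longrightarrow> x + y \<in> Sp P"
  unfolding Sp_iff lookup_add by (metis add.right_neutral)

lemma Sp_sc: "x \<in> Sp P \<Longrightarrow> c \<odot> x \<in> Sp P"
  unfolding Sp_iff by auto

lemma Sp_diff: "x \<in> Sp P \<Longrightarrow> y \<in> Sp P \<Longrightarrow> x - y \<in> Sp P"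
  unfolding Sp_iff lookup_minus by (metis diff_0_right)

lemma Sp_mono_pred: "x \<in> Sp P \<Longrightarrow> (\<And>w. P w \<Longrightarrow> Q w) \<Longrightarrow> x \<in> Sp Q"
  by (auto simp: Sp_def)

lemma Sp_induct [consumes 1, case_names zero mono add sc]:
  assumes "x \<in> Sp P" "Q 0" "\<And>w. P w \<Longrightarrow> Q (wd w)"
    and "\<And>x y. Q x \<Longrightarrow> Q y \<Longrightarrow> Q (x + y)" and "\<And>c x. Q x \<Longrightarrow> Q (c \<odot> x)"
  shows "Q x"
proof -
  have "Q (\<Sum>w\<in>A. Poly_Mapping.lookup x w \<odot> wd w)" if "finite A" "A \<subseteq> Poly_Mapping.keys x" for A
    using that assms by (induction A) (auto simp: Sp_def)
  from this[of "Poly_Mapping.keys x"] show ?thesis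
    using alg_expand[of x] by simp
qed

lemma alg_induct [case_names mono add sc]:
  assumes "\<And>w. Q (wd w)"
    and "\<And>x y. Q x \<Longrightarrow> Q y \<Longrightarrow> Q (x + y)" and "\<And>c x. Q x \<Longrightarrow> Q (c \<odot> x)"
  shows "Q x"
proof -
  \<comment> \<open>Zero is a multiple of a word, so no separate case is needed for it; in
    \<open>Sp_induct\<close> the predicate may hold of no word at all.\<close>
  have "Q (0 \<odot> wd [])" using assms by blast
  then have "Q 0" by simp
  have "x \<in> Sp (\<lambda>_. True)" by (simp add: Sp_def)
  then show ?thesis using \<open>Q 0\<close> assms by (induction rule: Sp_induct) auto
qed

lemma sc_mult_right [simp]: "x * (c \<odot> y) = c \<odot> (x * y)"
proof -
  have "wd w * (c \<odot> y) = c \<odot> (wd w * y)" for w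
    by (simp add: sc_def wd_def mult_single mult.assoc[symmetric])
  then show ?thesis
    by (induction x rule: alg_induct) (simp_all add: distrib_right alg.scale_right_distrib alg.scale_left_commute)
qed

lemma Sp_mult:
  assumes "x \<in> Sp P" "y \<in> Sp Q" "\<And>u v. P u \<Longrightarrow> Q v \<Longrightarrow> R (u @ v)"
  shows "x * y \<in> Sp R"
  using assms(1)
proof (induction rule: Sp_induct)
  case (mono u)
  from assms(2) show ?case
    by (induction rule: Sp_induct) (auto simp: distrib_left mono assms(3) intro: Sp_add Sp_sc)
qed (auto simp: distrib_right intro: Sp_add Sp_sc)

text \<open>The scalar action is a parameter, so that the same lemmas serve maps into a free algebra
  (\<open>lin\<close>) and linear functionals (\<open>linK\<close>).\<close>

definition ext :: "(K \<Rightarrow> 'b \<Rightarrow> 'b) \<Rightarrow> ('a list \<Rightarrow> 'b) \<Rightarrow> 'a alg \<Rightarrow> 'b::ab_group_add" where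
  "ext s g x = (\<Sum>w\<in>Poly_Mapping.keys x. s (Poly_Mapping.lookup x w) (g w))"

lemma ext_superset:
  assumes "module s" "finite A" "Poly_Mapping.keys x \<subseteq> A"
  shows "ext s g x = (\<Sum>w\<in>A. s (Poly_Mapping.lookup x w) (g w))"
proof -
  interpret module s by fact
  show ?thesis unfolding ext_def using assms(2,3)
    by (intro sum.mono_neutral_left) (auto simp: in_keys_iff)
qed

lemma ext_add:
  assumes "module s" shows "ext s g (x + y) = ext s g x + ext s g y"
proof -
  interpret module s by fact
  let ?A = "Poly_Mapping.keys x \<union> Poly_Mapping.keys y"
  have "Poly_Mapping.keys (x + y) \<subseteq> ?A" by (rule keys_add)
  then have "ext s g (x + y) = (\<Sum>w\<in>?A. s (Poly_Mapping.lookup (x + y) w) (g w))"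
    using assms by (intro ext_superset) auto
  then show ?thesis using assms
    by (simp add: ext_superset[of s ?A x] ext_superset[of s ?A y] lookup_add scale_left_distrib sum.distrib)
qed

lemma ext_sc:
  assumes "module s" shows "ext s g (c \<odot> x) = s c (ext s g x)"
proof -
  interpret module s by fact
  have "Poly_Mapping.keys (c \<odot> x) \<subseteq> Poly_Mapping.keys x" by (auto simp: in_keys_iff)
  then have "ext s g (c \<odot> x) = (\<Sum>w\<in>Poly_Mapping.keys x. s (Poly_Mapping.lookup (c \<odot> x) w) (g w))"
    using assms by (intro ext_superset) auto
  then show ?thesis by (simp add: ext_def scale_sum_right)
qed

lemma ext_wd: "module s \<Longrightarrow> ext s g (wd w) = g w"
  by (simp add: ext_def lookup_wd module.scale_one)

lemma module_K: "module ((*) :: K \<Rightarrow> K \<Rightarrow> K)"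
  by standard (auto simp: algebra_simps)

abbreviation "lin \<equiv> ext (\<odot>)"
abbreviation "linK \<equiv> ext ((*) :: K \<Rightarrow> K \<Rightarrow> K)"

lemmas lin_simps [simp] =
  ext_add[OF alg.module_axioms] ext_sc[OF alg.module_axioms] ext_wd[OF alg.module_axioms]
  ext_add[OF module_K] ext_sc[OF module_K] ext_wd[OF module_K]

lemma ext_0 [simp]: "ext s g 0 = 0"
  by (simp add: ext_def)

lemma lin_uminus [simp]: "lin g (- x) = - lin g x"
  by (rule add.inverse_unique[symmetric]) (metis ext_0 ext_add[OF alg.module_axioms] add.right_inverse)

lemma linK_uminus [simp]: "linK g (- x) = - linK g x"
  by (rule add.inverse_unique[symmetric]) (metis ext_0 ext_add[OF module_K] add.right_inverse)

lemma lin_diff [simp]: "lin g (x - y) = lin g x - lin g y"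
  by (metis add_uminus_conv_diff ext_add[OF alg.module_axioms] lin_uminus)

lemma linK_diff [simp]: "linK g (x - y) = linK g x - linK g y"
  by (metis add_uminus_conv_diff ext_add[OF module_K] linK_uminus)

lemma lin_sum: "lin g (sum f A) = (\<Sum>t\<in>A. lin g (f t))"
  by (induction A rule: infinite_finite_induct) auto

lemma lin_Sp:
  assumes "x \<in> Sp P" "\<And>w. P w \<Longrightarrow> g w \<in> Sp Q"
  shows "lin g x \<in> Sp Q"
  using assms(1) by (induction rule: Sp_induct) (auto intro: assms(2) Sp_add Sp_sc)

section \<open>Two-sided ideals of the free algebra and congruence modulo them\<close>

inductive_set ideal :: "'a alg set \<Rightarrow> 'a alg set" for R where
  zero [simp]: "0 \<in> ideal R"
| gen: "r \<in> R \<Longrightarrow> wd u * r * wd v \<in> ideal R"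
| add: "x \<in> ideal R \<Longrightarrow> y \<in> ideal R \<Longrightarrow> x + y \<in> ideal R"
| sc: "x \<in> ideal R \<Longrightarrow> c \<odot> x \<in> ideal R"

lemma ideal_minus: "x \<in> ideal R \<Longrightarrow> - x \<in> ideal R"
  using ideal.sc[of x R "-1"] by simp

lemma ideal_diff: "x \<in> ideal R \<Longrightarrow> y \<in> ideal R \<Longrightarrow> x - y \<in> ideal R"
  using ideal.add[OF _ ideal_minus] by fastforce

lemma ideal_sum: "(\<And>t. t \<in> A \<Longrightarrow> f t \<in> ideal R) \<Longrightarrow> sum f A \<in> ideal R"
  by (induction A rule: infinite_finite_induct) (auto intro: ideal.intros)

lemma ideal_base: "r \<in> R \<Longrightarrow> r \<in> ideal R"
  using ideal.gen[of r R "[]" "[]"] by simp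

lemma ideal_mult_left: "x \<in> ideal R \<Longrightarrow> y * x \<in> ideal R"
proof (induction y rule: alg_induct)
  case (mono w)
  from mono show ?case
  proof (induction rule: ideal.induct)
    case (gen r u v)
    then show ?case using ideal.gen[of r R "w @ u" v] by (simp only: wd_mult[symmetric] mult.assoc)
  qed (auto simp: distrib_left intro: ideal.intros)
qed (auto simp: distrib_right intro: ideal.intros)

lemma ideal_mult_right: "x \<in> ideal R \<Longrightarrow> x * y \<in> ideal R"
proof (induction y rule: alg_induct)
  case (mono w)
  from mono show ?case
  proof (induction rule: ideal.induct)
    case (gen r u v)
    then show ?case using ideal.gen[of r R u "v @ w"] by (simp only: wd_mult[symmetric] mult.assoc)
  qed (auto simp: distrib_right intro: ideal.intros)
qed (auto simp: distrib_left intro: ideal.intros)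

lemma ideal_mono: "R \<subseteq> R' \<Longrightarrow> x \<in> ideal R \<Longrightarrow> x \<in> ideal R'"
  by (erule ideal.induct) (auto intro: ideal.intros)

definition eqm :: "'a alg set \<Rightarrow> 'a alg \<Rightarrow> 'a alg \<Rightarrow> bool" where
  "eqm R x y \<longleftrightarrow> x - y \<in> ideal R"

lemma eqm_refl [simp]: "eqm R x x"
  by (simp add: eqm_def)

lemma eqm_sym: "eqm R x y \<Longrightarrow> eqm R y x"
  unfolding eqm_def using ideal_minus by fastforce

lemma eqm_trans [trans]: "eqm R x y \<Longrightarrow> eqm R y z \<Longrightarrow> eqm R x z"
  unfolding eqm_def using ideal.add by fastforce

lemma eqm_eq_trans [trans]: "eqm R x y \<Longrightarrow> y = z \<Longrightarrow> eqm R x z"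
  and eq_eqm_trans [trans]: "x = y \<Longrightarrow> eqm R y z \<Longrightarrow> eqm R x z"
  by simp_all

lemma eqm_add: "eqm R x y \<Longrightarrow> eqm R x' y' \<Longrightarrow> eqm R (x + x') (y + y')"
  unfolding eqm_def using ideal.add[of "x - y" R "x' - y'"] by (simp add: algebra_simps)

lemma eqm_sc: "eqm R x y \<Longrightarrow> eqm R (c \<odot> x) (c \<odot> y)"
  unfolding eqm_def using ideal.sc by (metis alg.scale_right_diff_distrib)

lemma eqm_mult: "eqm R x y \<Longrightarrow> eqm R x' y' \<Longrightarrow> eqm R (x * x') (y * y')"
  unfolding eqm_def
  using ideal.add[OF ideal_mult_right[of "x - y" R x'] ideal_mult_left[of "x' - y'" R y]]
  by (simp add: algebra_simps)

lemma eqm_multl: "eqm R x y \<Longrightarrow> eqm R (z * x) (z * y)"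
  and eqm_multr: "eqm R x y \<Longrightarrow> eqm R (x * z) (y * z)"
  by (simp_all add: eqm_mult)

subsection \<open>Formal sums as elements of the free algebra\<close>

definition ev :: "'a fsum \<Rightarrow> 'a alg" where
  "ev s = (\<Sum>(c, u)\<leftarrow>s. c \<odot> wd u)"

lemma ev_Nil [simp]: "ev [] = 0"
  and ev_Cons [simp]: "ev ((c, u) # s) = c \<odot> wd u + ev s"
  and ev_append [simp]: "ev (a @ b) = ev a + ev b"
  by (simp_all add: ev_def)

lemma lookup_ev: "Poly_Mapping.lookup (ev s) = coeffs s"
  by (rule ext, induction s) (auto simp: coeffs_def lookup_add lookup_wd)

lemma ev_fsmul [simp]: "ev (fsmul c a) = c \<odot> ev a"
  by (induction a) (auto simp: fsmul_def alg.scale_right_distrib)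

lemma ev_fmul [simp]: "ev (fmul a b) = ev a * ev b"
proof -
  have "ev (map (\<lambda>(c', v). (c * c', u @ v)) b) = c \<odot> wd u * ev b" for c u
    by (induction b) (auto simp: distrib_left alg.scale_right_distrib mult.commute)
  then show ?thesis
    by (induction a) (auto simp: fmul_def distrib_right)
qed

lemma ev_fadd [simp]: "ev (fadd a b) = ev a + ev b"
  by (simp add: fadd_def)

lemma ev_gen [simp]: "ev (gen a) = wd [a]"
  by (simp add: gen_def)

lemma ev_m4: "ev (m4 x y z w) = ev x * ev y * ev z * ev w"
  by (simp add: m4_def)

lemma ev_flin: "ev (flin F s) = lin (\<lambda>u. ev (F u)) (ev s)"
  by (induction s) (auto simp: flin_def)

lemma ev_surj: "\<exists>s. ev s = x \<and> snd ` set s = Poly_Mapping.keys x"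
proof -
  obtain l where l: "set l = Poly_Mapping.keys x" "distinct l"
    using finite_distinct_list[of "Poly_Mapping.keys x"] by auto
  let ?s = "map (\<lambda>w. (Poly_Mapping.lookup x w, w)) l"
  have "ev ?s = (\<Sum>w\<in>set l. Poly_Mapping.lookup x w \<odot> wd w)"
    using l(2) by (simp add: ev_def sum_list_distinct_conv_sum_set o_def)
  then have "ev ?s = x" using l alg_expand[of x] by simp
  moreover have "snd ` set ?s = Poly_Mapping.keys x" using l by force
  ultimately show ?thesis by blast
qed

lemma ev_Sp: "(\<And>c u. (c, u) \<in> set s \<Longrightarrow> P u) \<Longrightarrow> ev s \<in> Sp P"
proof (induction s)
  case (Cons t s)
  obtain c u where t: "t = (c, u)" by (cases t)
  with Cons.prems have "P u" "\<And>c u. (c, u) \<in> set s \<Longrightarrow> P u" by auto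
  with Cons.IH t show ?case by (auto intro!: Sp_add Sp_sc)
qed simp

lemma ev_Sp_surj:
  assumes "x \<in> Sp P" obtains s where "ev s = x" "\<And>c u. (c, u) \<in> set s \<Longrightarrow> P u"
proof -
  obtain s where s: "ev s = x" "snd ` set s = Poly_Mapping.keys x" using ev_surj by blast
  have "P u" if "(c, u) \<in> set s" for c u
    using s(2) assms that unfolding Sp_def by (metis (mono_tags, lifting) image_eqI mem_Collect_eq snd_conv)
  then show ?thesis using that s by blast
qed

text \<open>The witness list in \<open>cong\<close> allows arbitrary sums as flanking factors,
  \<open>ideal\<close> only words; closure of \<open>ideal\<close> under multiplication bridges one
  direction, singleton sums the other.\<close>

lemma cong_iff: "cong C d a b \<longleftrightarrow> eqm (ev ` rels C d) (ev a) (ev b)"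
proof
  assume "cong C d a b"
  then obtain L where L0: "\<forall>(u, r, v)\<in>set L. r \<in> rels C d"
    and eq: "coeffs a = (\<lambda>w. coeffs b w + coeffs (concat (map (\<lambda>(u, r, v). fmul (fmul u r) v) L)) w)"
    unfolding cong_def by blast
  from L0 have L: "\<And>u r v. (u, r, v) \<in> set L \<Longrightarrow> r \<in> rels C d" by auto
  have "ev a = ev b + ev (concat (map (\<lambda>(u, r, v). fmul (fmul u r) v) L))"
    by (rule poly_mapping_eqI) (simp add: lookup_add lookup_ev eq)
  moreover have "ev (concat (map (\<lambda>(u, r, v). fmul (fmul u r) v) L)) \<in> ideal (ev ` rels C d)"
    using L
  proof (induction L)
    case (Cons t L)
    obtain u r v where t: "t = (u, r, v)" by (cases t)
    have "ev u * ev r * ev v \<in> ideal (ev ` rels C d)"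
      by (intro ideal_mult_left ideal_mult_right ideal_base) (use Cons.prems t in auto)
    then show ?case using Cons t by (auto intro: ideal.add)
  qed simp
  ultimately show "eqm (ev ` rels C d) (ev a) (ev b)" by (simp add: eqm_def)
next
  have "\<exists>L. (\<forall>(u, r, v)\<in>set L. r \<in> rels C d) \<and> x = ev (concat (map (\<lambda>(u, r, v). fmul (fmul u r) v) L))"
    if "x \<in> ideal (ev ` rels C d)" for x
    using that
  proof (induction rule: ideal.induct)
    case zero
    show ?case by (rule exI[of _ "[]"]) simp
  next
    case (gen r u v)
    then obtain r' where "r' \<in> rels C d" "r = ev r'" by auto
    then show ?case by (intro exI[of _ "[([(1, u)], r', [(1, v)])]"]) simp
  next
    case (add x y)
    then obtain L1 L2 where "\<forall>(u, r, v)\<in>set L1. r \<in> rels C d" "\<forall>(u, r, v)\<in>set L2. r \<in> rels C d"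
      "x = ev (concat (map (\<lambda>(u, r, v). fmul (fmul u r) v) L1))"
      "y = ev (concat (map (\<lambda>(u, r, v). fmul (fmul u r) v) L2))" by blast
    then show ?case by (intro exI[of _ "L1 @ L2"]) auto
  next
    case (sc x c)
    then obtain L where L: "\<forall>(u, r, v)\<in>set L. r \<in> rels C d"
      "x = ev (concat (map (\<lambda>(u, r, v). fmul (fmul u r) v) L))" by blast
    \<comment> \<open>A witness list carries no outer scalar; the scalar is absorbed into the left
      flanking factors.\<close>
    have "c \<odot> ev (concat (map (\<lambda>(u, r, v). fmul (fmul u r) v) L)) =
      ev (concat (map (\<lambda>(u, r, v). fmul (fmul u r) v) (map (\<lambda>(u, r, v). (fsmul c u, r, v)) L)))"
      by (induction L) (auto simp: alg.scale_right_distrib)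
    with L show ?case
      by (intro exI[of _ "map (\<lambda>(u, r, v). (fsmul c u, r, v)) L"]) auto
  qed
  note ex = this
  assume "eqm (ev ` rels C d) (ev a) (ev b)"
  then obtain L where L: "\<forall>(u, r, v)\<in>set L. r \<in> rels C d"
    and "ev a - ev b = ev (concat (map (\<lambda>(u, r, v). fmul (fmul u r) v) L))"
    unfolding eqm_def using ex by blast
  then have "ev a = ev b + ev (concat (map (\<lambda>(u, r, v). fmul (fmul u r) v) L))" 
    by (simp add: algebra_simps)
  then have "coeffs a = (\<lambda>w. coeffs b w + coeffs (concat (map (\<lambda>(u, r, v). fmul (fmul u r) v) L)) w)"
    unfolding lookup_ev[symmetric] by (simp only: lookup_add fun_eq_iff) blast
  with L show "cong C d a b" unfolding cong_def by blast
qed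

subsection \<open>Powers of the quantum parameter\<close>

lemma qh_power: "qh ^ n = Fract (monom 1 n) 1"
proof (induction n)
  case 0 then show ?case by (simp add: One_fract_def)
next
  case (Suc n)
  then show ?case by (simp add: qh_def monom_Suc)
qed

lemma qh_nonzero [simp]: "qh \<noteq> 0"
  by (simp add: qh_def Zero_fract_def eq_fract)

text \<open>The parameter is not a root of unity, as degrees of monomials show. The non-vanishing of
  quantum integers and of the sl_2 coefficients rests on this.\<close>

lemma qh_powi_eq_1: "qh powi n = 1 \<longleftrightarrow> n = 0"
proof -
  have *: "qh ^ m = 1 \<longleftrightarrow> m = 0" for m
  proof
    assume "qh ^ m = 1"
    then have "monom (1 :: rat) m = 1" by (simp add: qh_power One_fract_def eq_fract)
    then show "m = 0" by (metis degree_1 degree_monom_eq one_neq_zero)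
  qed simp
  show ?thesis
  proof (cases "n \<ge> 0")
    case True then show ?thesis using *[of "nat n"] by (simp add: power_int_def)
  next
    case False then show ?thesis using *[of "nat (- n)"] by (simp add: power_int_def power_inverse)
  qed
qed

lemma qi_nonzero [simp]: "qi d i m \<noteq> 0"
  by (simp add: qi_def)

lemma qi_0 [simp]: "qi d i 0 = 1"
  by (simp add: qi_def)

lemma qi_add: "qi d i (m + n) = qi d i m * qi d i n"
  by (simp add: qi_def distrib_left power_int_add)

lemma qi_minus: "qi d i (- m) = inverse (qi d i m)"
  by (simp add: qi_def power_int_minus)

lemma qi_diff: "qi d i (m - n) = qi d i m / qi d i n"
  using qi_add[of d i m "- n"] by (simp add: qi_minus divide_inverse)

subsection \<open>Lusztig's form on the free algebra\<close>

locale cartan =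
  fixes C :: "'i::finite \<Rightarrow> 'i \<Rightarrow> int" and d :: "'i \<Rightarrow> nat"
  assumes fin: "finite_cartan C d"
begin

lemma C_diag [simp]: "C i i = 2"
  and C_off: "i \<noteq> j \<Longrightarrow> C i j \<le> 0"
  and d_pos [simp]: "d i > 0"
  and dC_sym: "int (d i) * C i j = int (d j) * C j i"
  using fin by (auto simp: finite_cartan_def)

text \<open>Symmetry of d_i c_ij: a commutation factor may be read with respect to either of its two
  letters.\<close>

lemma qi_sym: "qi d i (m * C i j) = qi d j (m * C j i)"
proof -
  have "2 * int (d i) * (m * C i j) = 2 * int (d j) * (m * C j i)"
    using dC_sym[of i j] by (metis mult.assoc mult.left_commute)
  then show ?thesis by (simp only: qi_def)
qed

lemma qi_eq_1 [simp]: "qi d i m = 1 \<longleftrightarrow> m = 0"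
  using d_pos[of i] by (simp add: qi_def qh_powi_eq_1 del: d_pos)

lemma qi_eq_iff: "qi d i m = qi d i n \<longleftrightarrow> m = n"
  using qi_eq_1[of i "m - n"] by (auto simp: qi_diff)

text \<open>As f_j has weight -\<alpha>_j, this is minus the pairing of h_i with the weight of the
  word in U_q^-.\<close>

definition N :: "'i \<Rightarrow> 'i list \<Rightarrow> int" where "N i u = (\<Sum>j\<leftarrow>u. C i j)"

lemma N_simps [simp]: "N i [] = 0" "N i (j # u) = C i j + N i u" "N i (u @ v) = N i u + N i v"
  by (simp_all add: N_def)

lemma N_mset: "N i u = (\<Sum>j\<in>#mset u. C i j)"
  by (simp add: N_def sum_mset_sum_list flip: mset_map)

text \<open>The torus action: \<open>tw i (-1)\<close> multiplies a weight vector by q_i^{<h_i,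
  wt>}, the factor in both Leibniz rules, and \<open>tw i 1\<close> is its inverse.\<close>

definition tw :: "'i \<Rightarrow> int \<Rightarrow> 'i alg \<Rightarrow> 'i alg" where
  "tw i m = lin (\<lambda>u. qi d i (m * N i u) \<odot> wd u)"
definition ep :: "'i \<Rightarrow> 'i alg \<Rightarrow> 'i alg" where
  "ep i = lin (\<lambda>u. ev (ep_w C d i u))"
definition es :: "'i \<Rightarrow> 'i alg \<Rightarrow> 'i alg" where
  "es i = lin (\<lambda>u. ev (es_w C d i u))"

lemma tw_simps [simp]:
  "tw i m (wd u) = qi d i (m * N i u) \<odot> wd u"
  "tw i m (x + y) = tw i m x + tw i m y"
  "tw i m (x - y) = tw i m x - tw i m y"
  "tw i m (c \<odot> x) = c \<odot> tw i m x"
  "tw i m 0 = 0"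
  by (simp_all add: tw_def)

lemma ep_simps [simp]:
  "ep i (x + y) = ep i x + ep i y"
  "ep i (x - y) = ep i x - ep i y"
  "ep i (c \<odot> x) = c \<odot> ep i x"
  "ep i 0 = 0"
  by (simp_all add: ep_def)

lemma es_simps [simp]:
  "es i (x + y) = es i x + es i y"
  "es i (x - y) = es i x - es i y"
  "es i (c \<odot> x) = c \<odot> es i x"
  "es i 0 = 0"
  by (simp_all add: es_def)

lemma ep_Cons: "ep i (wd (j # u)) = (if j = i then wd u else 0) + qi d i (- C i j) \<odot> (wd [j] * ep i (wd u))"
  by (simp add: ep_def)

lemma es_Cons: "es i (wd (j # u)) = wd [j] * es i (wd u) + (if j = i then qi d i (- N i u) \<odot> wd u else 0)"
  by (simp add: es_def N_def)

lemma one_wd: "(1 :: 'a alg) = wd []" by simp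

lemma tw_1 [simp]: "tw i m 1 = 1" and ep_1 [simp]: "ep i 1 = 0" and es_1 [simp]: "es i 1 = 0"
  unfolding one_wd by (simp_all add: tw_def ep_def es_def del: wd_Nil)

lemma ep_letter [simp]: "ep i (wd [j]) = (if j = i then 1 else 0)"
  and es_letter [simp]: "es i (wd [j]) = (if j = i then 1 else 0)"
  using ep_Cons[of i j "[]"] es_Cons[of i j "[]"] by simp_all

lemma tw_mult: "tw i m (x * y) = tw i m x * tw i m y"
proof (induction x rule: alg_induct)
  case (mono u)
  show ?case
    by (induction y rule: alg_induct)
       (simp_all add: distrib_left alg.scale_right_distrib qi_add mult.commute)
qed (simp_all add: distrib_right)

lemma tw_tw [simp]: "tw i m (tw i n x) = tw i (m + n) x"
  by (induction x rule: alg_induct) (simp_all add: distrib_right qi_add mult.commute)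

lemma tw_0 [simp]: "tw i 0 x = x"
  by (induction x rule: alg_induct) simp_all

lemma ep_mult: "ep i (x * y) = ep i x * y + tw i (- 1) x * ep i y"
proof (induction x rule: alg_induct)
  case (mono u)
  have *: "ep i (wd u * wd v) = ep i (wd u) * wd v + tw i (- 1) (wd u) * ep i (wd v)" for v
  proof (induction u)
    case (Cons a u)
    then show ?case
      by (simp add: ep_Cons qi_diff qi_minus divide_inverse distrib_left distrib_right alg.scale_right_distrib mult.assoc)
  qed simp
  show ?case
    by (induction y rule: alg_induct) (simp_all add: * distrib_left alg.scale_right_distrib del: wd_mult)
qed (simp_all add: algebra_simps alg.scale_right_distrib)

lemma es_mult: "es i (x * y) = x * es i y + es i x * tw i (- 1) y"
proof (induction x rule: alg_induct)
  case (mono u)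
  have *: "es i (wd u * wd v) = wd u * es i (wd v) + es i (wd u) * tw i (- 1) (wd v)" for v
  proof (induction u)
    case (Cons a u)
    then show ?case
      by (simp add: es_Cons qi_diff qi_minus divide_inverse distrib_left distrib_right alg.scale_right_distrib mult.assoc mult.commute)
  qed simp
  show ?case
    by (induction y rule: alg_induct) (simp_all add: * distrib_left alg.scale_right_distrib del: wd_mult)
qed (simp_all add: algebra_simps alg.scale_right_distrib)

lemma ep_letter_mult: "ep i (wd [j] * x) = (if j = i then x else 0) + qi d i (- C i j) \<odot> (wd [j] * ep i x)"
  by (simp add: ep_mult)

lemma es_letter_mult: "es i (wd [j] * x) = wd [j] * es i x + (if j = i then tw i (- 1) x else 0)"
  by (simp add: es_mult)

lemma ep_Sp: "ep i (wd u) \<in> Sp (\<lambda>w. mset u = add_mset i (mset w))"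
proof (induction u)
  case (Cons a u)
  have "wd [a] * ep i (wd u) \<in> Sp (\<lambda>w. mset (a # u) = add_mset i (mset w))"
    by (rule Sp_mult[OF _ Cons, of _ "\<lambda>w. w = [a]"]) auto
  then show ?case unfolding ep_Cons by (auto intro!: Sp_add Sp_sc)
qed simp

lemma es_Sp: "es i (wd u) \<in> Sp (\<lambda>w. mset u = add_mset i (mset w))"
proof (induction u)
  case (Cons a u)
  have "wd [a] * es i (wd u) \<in> Sp (\<lambda>w. mset (a # u) = add_mset i (mset w))"
    by (rule Sp_mult[OF _ Cons, of _ "\<lambda>w. w = [a]"]) auto
  then show ?case unfolding es_Cons by (auto intro!: Sp_add Sp_sc)
qed simp

lemma tw_eigen: "x \<in> Sp (\<lambda>w. N i w = n) \<Longrightarrow> tw i m x = qi d i (m * n) \<odot> x"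
  by (induction rule: Sp_induct) (auto simp: alg.scale_right_distrib mult.commute)

lemma N_mset_eq: "mset u = add_mset j (mset w) \<Longrightarrow> N i w = N i u - C i j"
  by (simp add: N_mset)

text \<open>The delicate case is a word starting with i: removing a j first changes the twist picked
  up by e*_i by q_i^{c_ij}, which the factor q_j^{-c_ji} of e'_j undoes.\<close>

lemma ep_es: "ep j (es i x) = es i (ep j x)"
proof (induction x rule: alg_induct)
  case (mono u)
  show ?case
  proof (induction u)
    case (Cons a u)
    have "ep j (wd u) \<in> Sp (\<lambda>w. N i w = N i u - C i j)"
      using ep_Sp by (rule Sp_mono_pred) (rule N_mset_eq)
    then have tw: "tw i (- 1) (ep j (wd u)) = qi d i (- 1 * (N i u - C i j)) \<odot> ep j (wd u)"
      by (rule tw_eigen)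
    have "qi d j (- C j i) * qi d i (- 1 * (N i u - C i j)) = qi d i (- N i u)"
      using qi_sym[of j "-1" i] by (simp add: qi_diff qi_minus field_simps)
    with tw have tw': "qi d j (- C j i) \<odot> tw i (- 1) (ep j (wd u)) = qi d i (- N i u) \<odot> ep j (wd u)"
      by simp
    show ?case
      by (cases "a = i"; cases "a = j")
         (use tw' Cons in \<open>auto simp: ep_Cons es_Cons ep_letter_mult es_letter_mult alg.scale_right_distrib\<close>)
  qed simp
qed (auto simp: alg.scale_right_distrib)

lemma ep_tw: "ep i (tw l m x) = qi d l (m * C l i) \<odot> tw l m (ep i x)"
proof (induction x rule: alg_induct)
  case (mono u)
  have "ep i (wd u) \<in> Sp (\<lambda>w. N l w = N l u - C l i)"
    using ep_Sp by (rule Sp_mono_pred) (rule N_mset_eq)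
  from tw_eigen[OF this, of m] show ?case by (simp add: algebra_simps flip: qi_add)
qed (auto simp: alg.scale_right_distrib alg.scale_left_commute)

lemma es_tw: "es i (tw l m x) = qi d l (m * C l i) \<odot> tw l m (es i x)"
proof (induction x rule: alg_induct)
  case (mono u)
  have "es i (wd u) \<in> Sp (\<lambda>w. N l w = N l u - C l i)"
    using es_Sp by (rule Sp_mono_pred) (rule N_mset_eq)
  from tw_eigen[OF this, of m] show ?case by (simp add: algebra_simps flip: qi_add)
qed (auto simp: alg.scale_right_distrib alg.scale_left_commute)

text \<open>The norm (f_i, f_i)_L.\<close>

definition gam :: "'i \<Rightarrow> K" where "gam i = 1 / (1 - qi d i 2)"

lemma gam_nonzero [simp]: "gam i \<noteq> 0"
  by (simp add: gam_def)

fun Lus :: "'i list \<Rightarrow> 'i alg \<Rightarrow> K" where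
  "Lus [] y = Poly_Mapping.lookup y []"
| "Lus (i # u) y = gam i * Lus u (ep i y)"

lemma lus_w_eq: "lus_w C d u v = Lus u (ev v)"
  by (induction u arbitrary: v) (auto simp: lookup_ev ev_flin ep_def gam_def)

definition L :: "'i alg \<Rightarrow> 'i alg \<Rightarrow> K" where
  "L x y = linK (\<lambda>u. Lus u y) x"

lemma Lus_simps: "Lus u (x + y) = Lus u x + Lus u y" "Lus u (c \<odot> x) = c * Lus u x"
  by (induction u arbitrary: x y) (auto simp: lookup_add algebra_simps)

lemma L_simps [simp]:
  "L (x + x') y = L x y + L x' y" "L (x - x') y = L x y - L x' y" "L (c \<odot> x) y = c * L x y" "L 0 y = 0"
  by (simp_all add: L_def)

lemma L_simps_right [simp]:
  "L x (y + y') = L x y + L x y'" "L x (c \<odot> y) = c * L x y"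
  by (induction x rule: alg_induct; simp add: L_def Lus_simps algebra_simps)+

lemma L_0_right [simp]: "L x 0 = 0"
  using L_simps_right(2)[of x 0 0] by simp

lemma L_uminus [simp]: "L (- x) y = - L x y"
  using L_simps(3)[of "-1" x y] by simp

lemma L_1: "L 1 y = Poly_Mapping.lookup y []"
  unfolding one_wd by (simp add: L_def del: wd_Nil)

lemma L_letter_left: "L (wd [i] * x) y = gam i * L x (ep i y)"
  by (induction x rule: alg_induct) (simp_all add: L_def algebra_simps)

text \<open>Both sides are the coefficient of the word \<open>[i]\<close> in y.\<close>

lemma lookup_ep_es: "Poly_Mapping.lookup (ep i y) [] = Poly_Mapping.lookup (es i y) []"
proof (induction y rule: alg_induct)
  case (mono u)
  show ?case
  proof (cases "u = [i]")
    case False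
    then have "mset u \<noteq> add_mset i (mset [])" by (cases u) auto
    then show ?thesis using ep_Sp[of i u] es_Sp[of i u] unfolding Sp_iff by metis
  qed simp
qed (simp_all add: lookup_add)

text \<open>The form is defined by peeling letters off on the left. Peeling on the right is
  legitimate because e'_a and e*_i commute; the empty word is covered by
  \<open>lookup_ep_es\<close>.\<close>

lemma L_letter_right: "L (x * wd [i]) y = gam i * L x (es i y)"
proof (induction x rule: alg_induct)
  case (mono u)
  show ?case
  proof (induction u arbitrary: y)
    case Nil
    show ?case using L_letter_left[of i 1 y] by (simp add: L_1 lookup_ep_es)
  next
    case (Cons a u)
    show ?case using Cons[of "ep a y"] L_letter_left[of a "wd (u @ [i])" y] L_letter_left[of a "wd u" "es i y"]
      by (simp add: ep_es)
  qed
qed (simp_all add: distrib_right distrib_left)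

text \<open>The adjunction in the other argument, obtained by peeling x and using the Leibniz rule
  on f_i y. Symmetry of the form is deduced from it and is not yet available.\<close>

lemma L_letter_left2: "L x (wd [i] * y) = gam i * L (ep i x) y"
proof (induction x rule: alg_induct)
  case (mono u)
  show ?case
  proof (induction u arbitrary: y)
    case Nil
    have "wd [i] * y \<in> Sp (\<lambda>w. w \<noteq> [])"
      by (rule Sp_mult[of _ "\<lambda>w. w = [i]" _ "\<lambda>_. True"]) (auto simp: Sp_iff lookup_wd split: if_splits)
    then show ?case by (auto simp: L_1 Sp_iff)
  next
    case (Cons a u)
    have q: "qi d a (- C a i) = qi d i (- C i a)" using qi_sym[of a "-1" i] by simp
    have "L (wd (a # u)) (wd [i] * y) = gam a * L (wd u) (ep a (wd [i] * y))"
      using L_letter_left[of a "wd u"] by simp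
    also have "\<dots> = gam a * ((if a = i then L (wd u) y else 0) + qi d i (- C i a) * L (wd u) (wd [i] * ep a y))"
      by (auto simp: ep_letter_mult q)
    also have "\<dots> = gam i * ((if a = i then L (wd u) y else 0) + qi d i (- C i a) * (gam a * L (ep i (wd u)) (ep a y)))"
      using Cons[of "ep a y"] by (auto simp: algebra_simps)
    also have "gam a * L (ep i (wd u)) (ep a y) = L (wd [a] * ep i (wd u)) y"
      by (simp add: L_letter_left)
    finally show ?case by (auto simp: ep_Cons)
  qed
qed (simp_all add: distrib_left)

lemma L_sym: "L x y = L y x"
proof (induction x rule: alg_induct)
  case (mono u)
  show ?case
  proof (induction u arbitrary: y)
    case Nil
    have "Lus w 1 = (if w = [] then 1 else 0)" for w
      using Lus_simps(2)[of "tl w" 0 0] by (cases w) (auto simp: lookup_one zero_list_def)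
    then show ?case
      by (induction y rule: alg_induct) (auto simp: L_1 lookup_add lookup_wd L_def[of "wd _"])
  next
    case (Cons a u)
    show ?case
      using L_letter_left[of a "wd u" y] L_letter_left2[of y a "wd u"] Cons[of "ep a y"] by simp
  qed
qed simp_all

lemma L_letter_right2: "L x (y * wd [i]) = gam i * L (es i x) y"
  by (metis L_letter_right L_sym)

lemma L_mset: "L (wd u) (wd v) \<noteq> 0 \<Longrightarrow> mset u = mset v"
proof (induction u arbitrary: v)
  case Nil
  then show ?case by (auto simp: L_1 lookup_wd split: if_splits)
next
  case (Cons a u)
  have "L (wd u) x = 0" if "x \<in> Sp (\<lambda>w. mset w \<noteq> mset u)" for x
    using that by (induction rule: Sp_induct) (use Cons.IH in \<open>auto, metis\<close>)
  moreover have "L (wd u) (ep a (wd v)) \<noteq> 0"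
    using Cons.prems L_letter_left[of a "wd u" "wd v"] by simp
  ultimately have "ep a (wd v) \<notin> Sp (\<lambda>w. mset w \<noteq> mset u)" by blast
  then obtain w where "Poly_Mapping.lookup (ep a (wd v)) w \<noteq> 0" "mset w = mset u"
    unfolding Sp_iff by blast
  then show ?case using ep_Sp[of a v] by (auto simp: Sp_iff)
qed

section \<open>The radical of Lusztig's form\<close>

definition rad :: "'i alg set" where "rad = {x. \<forall>y. L x y = 0}"

text \<open>Multiplication by a letter and the matching derivation are adjoint up to the non-zero
  \<open>gam i\<close>, so the radical is stable under both.\<close>

lemma rad_ep: "x \<in> rad \<Longrightarrow> ep i x \<in> rad"
  unfolding rad_def using L_letter_left2[of x i] by auto

lemma rad_es: "x \<in> rad \<Longrightarrow> es i x \<in> rad"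
  unfolding rad_def using L_letter_right2[of x _ i] by auto

lemma rad_mult_left: "x \<in> rad \<Longrightarrow> y * x \<in> rad"
proof -
  assume x: "x \<in> rad"
  have "wd u * x \<in> rad" for u
  proof (induction u)
    case (Cons a u)
    then show ?case using L_letter_left[of a "wd u * x"] by (auto simp: rad_def)
  qed (use x in simp)
  then show ?thesis
    by (induction y rule: alg_induct) (auto simp: rad_def distrib_right)
qed

lemma rad_mult_right: "x \<in> rad \<Longrightarrow> x * y \<in> rad"
proof -
  assume x: "x \<in> rad"
  have "x * wd u \<in> rad" for u
  proof (induction u rule: rev_induct)
    case (snoc a u)
    then show ?case using L_letter_right[of "x * wd u" a] by (auto simp: rad_def mult.assoc)
  qed (use x in simp)
  then show ?thesis
    by (induction y rule: alg_induct) (auto simp: rad_def distrib_left)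
qed

lemma rad_wdI: "(\<And>v. L x (wd v) = 0) \<Longrightarrow> x \<in> rad"
proof -
  assume "\<And>v. L x (wd v) = 0"
  then have "L x y = 0" for y by (induction y rule: alg_induct) auto
  then show ?thesis by (simp add: rad_def)
qed

text \<open>Pairing with a non-empty word moves its first letter over as a derivation of x; pairing
  with 1 reads the constant term.\<close>

lemma rad_if_ep_0:
  assumes "Poly_Mapping.lookup x [] = 0" "\<And>i. ep i x = 0"
  shows "x \<in> rad"
proof (rule rad_wdI)
  fix v show "L x (wd v) = 0"
    using assms L_letter_left2[of x "hd v" "wd (tl v)"] L_sym[of x 1]
    by (cases v) (auto simp: L_1)
qed

subsection \<open>The radical is generated by the quantum Serre elements\<close>

text \<open>The adjoint action of f_i. The twist is chosen so that under e'_i the two copies of x,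
  coming from the leading and from the trailing f_i, cancel; hence ker e'_i is preserved
  (\<open>ep_Fi_0\<close>).\<close>

definition Fi :: "'i \<Rightarrow> 'i alg \<Rightarrow> 'i alg" where
  "Fi i x = wd [i] * x - tw i 1 x * wd [i]"

lemma Fi_simps [simp]:
  "Fi i (x + y) = Fi i x + Fi i y"
  "Fi i (x - y) = Fi i x - Fi i y"
  "Fi i (c \<odot> x) = c \<odot> Fi i x"
  "Fi i 0 = 0" "Fi i 1 = 0"
  by (simp_all add: Fi_def algebra_simps alg.scale_right_diff_distrib)

lemma Fi_pow_simps [simp]:
  "(Fi i ^^ n) (x + y) = (Fi i ^^ n) x + (Fi i ^^ n) y"
  "(Fi i ^^ n) (x - y) = (Fi i ^^ n) x - (Fi i ^^ n) y"
  "(Fi i ^^ n) (c \<odot> x) = c \<odot> (Fi i ^^ n) x"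
  "(Fi i ^^ n) 0 = 0"
  by (induction n) auto

lemma Fi_mult: "Fi i (x * y) = Fi i x * y + tw i 1 x * Fi i y"
  by (simp add: Fi_def tw_mult algebra_simps)

lemma Fi_tw: "Fi i (tw i m x) = qi d i (- 2 * m) \<odot> tw i m (Fi i x)"
  by (simp add: Fi_def tw_mult alg.scale_right_diff_distrib add.commute flip: qi_add)

lemma Fi_pow_tw: "(Fi i ^^ n) (tw i m x) = qi d i (- 2 * m * int n) \<odot> tw i m ((Fi i ^^ n) x)"
  by (induction n) (simp_all add: Fi_tw algebra_simps flip: qi_add)

lemma Fi_Sp: "x \<in> Sp (\<lambda>w. N l w = n) \<Longrightarrow> Fi i x \<in> Sp (\<lambda>w. N l w = n + C l i)"
proof -
  assume x: "x \<in> Sp (\<lambda>w. N l w = n)"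
  have "tw i 1 x \<in> Sp (\<lambda>w. N l w = n)" unfolding tw_def
    by (rule lin_Sp[OF x]) (auto intro: Sp_sc)
  then have "tw i 1 x * wd [i] \<in> Sp (\<lambda>w. N l w = n + C l i)"
    by (rule Sp_mult[of _ _ _ "\<lambda>w. w = [i]"]) auto
  moreover have "wd [i] * x \<in> Sp (\<lambda>w. N l w = n + C l i)"
    by (rule Sp_mult[of _ "\<lambda>w. w = [i]" _ "\<lambda>w. N l w = n"]) (use x in auto)
  ultimately show ?thesis unfolding Fi_def by (rule Sp_diff[rotated])
qed

lemma Fi_pow_Sp: "x \<in> Sp (\<lambda>w. N l w = k) \<Longrightarrow> (Fi i ^^ n) x \<in> Sp (\<lambda>w. N l w = k + int n * C l i)"
proof (induction n)
  case (Suc n)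
  from Fi_Sp[OF Suc.IH[OF Suc.prems], of i] show ?case by (simp add: algebra_simps)
qed simp

lemma ep_Fi_0: "ep i x = 0 \<Longrightarrow> ep i (Fi i x) = 0"
  by (simp add: Fi_def ep_mult ep_tw)

lemma ep_Fi_other: "l \<noteq> i \<Longrightarrow>
    ep l (Fi i x) = qi d i (- C i l) \<odot> (wd [i] * ep l x) - qi d i (C i l) \<odot> (tw i 1 (ep l x) * wd [i])"
  using qi_sym[of l "-1" i] by (simp add: Fi_def ep_mult ep_tw)

text \<open>The commutator relation of quantum sl_2: on a vector with \<open>N i\<close> equal to n
  the last two terms give q_i^{-n} - q_i^n.\<close>

lemma es_Fi: "es i (Fi i x) = Fi i (es i x) + tw i (- 1) x - tw i 1 x"
  by (simp add: Fi_def es_mult es_tw flip: qi_add)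

lemma es_Fi_other: "l \<noteq> i \<Longrightarrow> es l (Fi i x) = Fi i (es l x)"
  using qi_sym[of l "-1" i] by (simp add: Fi_def es_mult es_tw flip: qi_add)

text \<open>In quantum integers this is \<open>- (q\<^sub>i - q\<^sub>i\<^sup>-\<^sup>1) [n] [k + n - 1]\<close>.\<close>

definition sl2c :: "'i \<Rightarrow> int \<Rightarrow> nat \<Rightarrow> K" where
  "sl2c i k n = (\<Sum>m<n. qi d i (- (k + 2 * int m)) - qi d i (k + 2 * int m))"

lemma es_Fi_pow:
  assumes "x \<in> Sp (\<lambda>w. N i w = k)"
  shows "es i ((Fi i ^^ n) x) = (Fi i ^^ n) (es i x) + sl2c i k n \<odot> (Fi i ^^ (n - 1)) x"
proof (induction n)
  case (Suc n)
  have "(Fi i ^^ n) x \<in> Sp (\<lambda>w. N i w = k + 2 * int n)"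
    using Fi_pow_Sp[OF assms, where i=i and n=n] by (simp add: mult.commute)
  note t = tw_eigen[OF this]
  \<comment> \<open>At n = 0 the truncated exponent n - 1 does no harm, since
    \<open>sl2c i k 0\<close> is an empty sum.\<close>
  have "Fi i (sl2c i k n \<odot> (Fi i ^^ (n - 1)) x) = sl2c i k n \<odot> (Fi i ^^ n) x"
    by (cases n) (auto simp: sl2c_def)
  then show ?case
    by (simp add: es_Fi Suc t) (simp add: sl2c_def algebra_simps)
qed (simp add: sl2c_def)

lemma sl2c_nonzero:
  assumes "k > 0" "n > 0" shows "sl2c i k n \<noteq> 0"
proof -
  \<comment> \<open>The factorisation into quantum integers with denominators cleared; for k, n > 0
    both factors are non-zero because q is not a root of unity.\<close>
  have "sl2c i k n * (qi d i 1 - qi d i (- 1)) =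
      - ((qi d i (k + int n - 1) - qi d i (- (k + int n - 1))) * (qi d i (int n) - qi d i (- int n)))" for n
  proof (induction n)
    case (Suc n)
    have "sl2c i k (Suc n) = sl2c i k n + (qi d i (- (k + 2 * int n)) - qi d i (k + 2 * int n))"
      by (simp add: sl2c_def)
    then show ?case using Suc
      by (simp add: distrib_right) (simp add: algebra_simps flip: qi_add)
  qed (simp add: sl2c_def)
  moreover have nz: "qi d i m - qi d i (- m) \<noteq> 0" if "m > 0" for m
    using that by (simp add: qi_eq_iff)
  then have "qi d i (k + int n - 1) - qi d i (- (k + int n - 1)) \<noteq> 0" "qi d i (int n) - qi d i (- int n) \<noteq> 0"
    using assms nz[of "k + int n - 1"] nz[of "int n"] by simp_all
  ultimately show ?thesis by (metis mult_eq_0_iff neg_equal_0_iff_equal)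
qed

text \<open>The quantum Serre element as an iterated adjoint action, on which derivations are easy
  to compute; its q-binomial form is recovered in \<open>ev_serre_rel\<close>.\<close>

definition ser :: "'i \<Rightarrow> 'i \<Rightarrow> 'i alg" where
  "ser i j = (Fi i ^^ nat (1 - C i j)) (wd [j])"

lemma ep_Fi_pow_letter_same: "i \<noteq> j \<Longrightarrow> ep i ((Fi i ^^ n) (wd [j])) = 0"
  by (induction n) (auto intro: ep_Fi_0)

lemma ep_Fi_pow_letter: "i \<noteq> j \<Longrightarrow> ep j ((Fi i ^^ n) (wd [j])) =
    (\<Prod>m<n. qi d i (- C i j) - qi d i (C i j + 2 * int m)) \<odot> wd (replicate n i)"
proof (induction n)
  case (Suc n)
  have N: "N i (replicate n i) = 2 * int n" by (induction n) auto
  show ?case using Suc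
    by (simp add: ep_Fi_other N alg.scale_left_diff_distrib alg.scale_right_diff_distrib replicate_append_same
        qi_add algebra_simps)
qed simp

lemma ser_ep: assumes "i \<noteq> j" shows "ep l (ser i j) = 0"
proof -
  consider "l = i" | "l = j" | "l \<noteq> i" "l \<noteq> j" by blast
  then show ?thesis
  proof cases
    case 1 with assms show ?thesis by (simp add: ser_def ep_Fi_pow_letter_same)
  next
    case 2
    \<comment> \<open>The factor m = -c_ij vanishes: its two exponents are -c_ij and c_ij - 2
      c_ij.\<close>
    have "(\<Prod>m<nat (1 - C i j). qi d i (- C i j) - qi d i (C i j + 2 * int m)) = 0"
      by (rule prod_zero) (use C_off[OF assms] in \<open>auto intro!: bexI[of _ "nat (- C i j)"]\<close>)
    with 2 assms show ?thesis by (simp add: ser_def ep_Fi_pow_letter)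
  next
    case 3
    have "ep l ((Fi i ^^ n) (wd [j])) = 0" for n
      by (induction n) (use 3 in \<open>auto simp: ep_Fi_other\<close>)
    then show ?thesis by (simp add: ser_def)
  qed
qed

lemma Fi_pow_1: "n > 0 \<Longrightarrow> (Fi i ^^ n) 1 = 0"
  by (cases n) (auto simp: funpow_Suc_right simp del: funpow.simps)

lemma ser_es: assumes "i \<noteq> j" shows "es l (ser i j) = 0"
proof (cases "l = i")
  case True
  define n where "n = nat (1 - C i j)"
  have n: "int n = 1 - C i j" using C_off[OF assms] by (simp add: n_def)
  \<comment> \<open>For n = 1 - c_ij, reversing the order of summation negates every exponent, so
    the two halves of \<open>sl2c\<close> cancel.\<close>
  have "(\<Sum>m<n. qi d i (C i j + 2 * int (n - Suc m))) = (\<Sum>m<n. qi d i (- (C i j + 2 * int m)))"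
    by (rule sum.cong) (use n in \<open>auto simp: of_nat_diff algebra_simps qi_eq_iff\<close>)
  then have "sl2c i (C i j) n = 0"
    unfolding sl2c_def sum_subtractf
    by (simp add: sum.nat_diff_reindex[of "\<lambda>m. qi d i (C i j + 2 * int m)" n, symmetric])
  with True assms show ?thesis
    using es_Fi_pow[of "wd [j]" i "C i j" n] by (simp add: ser_def n_def)
next
  case False
  \<comment> \<open>e*_l passes through \<open>Fi i\<close> and reaches the letter j, leaving either
    0 or, for l = j, a positive power of \<open>Fi i\<close> applied to 1, which is 0.\<close>
  have "es l ((Fi i ^^ n) (wd [j])) = (Fi i ^^ n) (es l (wd [j]))" for n
    by (induction n) (use False in \<open>auto simp: es_Fi_other\<close>)
  then show ?thesis using C_off[OF assms] by (cases "j = l") (auto simp: ser_def Fi_pow_1)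
qed

lemma ser_Sp: "ser i j \<in> Sp (\<lambda>w. N l w = C l j + int (nat (1 - C i j)) * C l i)"
  unfolding ser_def by (rule Fi_pow_Sp) simp

section \<open>The Serre ideal and its stability\<close>

definition SR :: "'i alg set" where "SR = {ser i j | i j. i \<noteq> j}"

lemma tw_ser: "\<exists>c. tw l m (ser i j) = c \<odot> ser i j"
  using tw_eigen[OF ser_Sp] by blast

lemma tw_SR: "x \<in> ideal SR \<Longrightarrow> tw l m x \<in> ideal SR"
proof (induction rule: ideal.induct)
  case (gen r u v)
  then obtain i j where r: "r = ser i j" "r \<in> SR" by (auto simp: SR_def)
  obtain c where "tw l m r = c \<odot> r" using r(1) tw_ser by blast
  with gen show ?case by (auto simp: tw_mult intro!: ideal.sc ideal.gen)
qed (auto intro: ideal.intros)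

lemma tw_SR_iff: "tw l m x \<in> ideal SR \<longleftrightarrow> x \<in> ideal SR"
  using tw_SR[of x l m] tw_SR[of "tw l m x" l "- m"] by auto

text \<open>Derivations kill the Serre elements, so every term of the Leibniz rule still contains
  the Serre element, possibly rescaled by a twist.\<close>

lemma ep_SR: "x \<in> ideal SR \<Longrightarrow> ep l x \<in> ideal SR"
proof (induction rule: ideal.induct)
  case (gen r u v)
  then have r: "ep l r = 0" "r \<in> ideal SR" by (auto simp: SR_def ser_ep intro: ideal_base)
  have "ep l (wd u * r * wd v) = ep l (wd u) * r * wd v + tw l (- 1) (wd u) * tw l (- 1) r * ep l (wd v)"
    by (simp only: ep_mult tw_mult r(1) mult_zero_right add_0_right)
  then show ?case
    by (simp only: ideal.add[OF ideal_mult_right[OF ideal_mult_left[OF r(2)]]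
          ideal_mult_right[OF ideal_mult_left[OF tw_SR[OF r(2)]]]])
qed (auto intro: ideal.intros)

lemma es_SR: "x \<in> ideal SR \<Longrightarrow> es l x \<in> ideal SR"
proof (induction rule: ideal.induct)
  case (gen r u v)
  then have r: "es l r = 0" "r \<in> ideal SR" by (auto simp: SR_def ser_es intro: ideal_base)
  have "es l (wd u * r * wd v) = wd u * r * es l (wd v) + es l (wd u) * tw l (- 1) r * tw l (- 1) (wd v)"
    by (simp only: es_mult r(1) mult_zero_right add_0_left)
  then show ?case
    by (simp only: ideal.add[OF ideal_mult_right[OF ideal_mult_left[OF r(2)]]
          ideal_mult_right[OF ideal_mult_left[OF tw_SR[OF r(2)]]]])
qed (auto intro: ideal.intros)

lemma Fi_SR: "x \<in> ideal SR \<Longrightarrow> Fi i x \<in> ideal SR"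
  unfolding Fi_def by (intro ideal_diff ideal_mult_left ideal_mult_right tw_SR)

lemma Fi_pow_SR: "x \<in> ideal SR \<Longrightarrow> (Fi i ^^ n) x \<in> ideal SR"
  by (induction n) (auto intro: Fi_SR)

lemma sc_SR_iff: "c \<noteq> 0 \<Longrightarrow> c \<odot> x \<in> ideal R \<longleftrightarrow> x \<in> ideal R"
  using ideal.sc[of x R c] ideal.sc[of "c \<odot> x" R "inverse c"] by auto

text \<open>A Serre element has no constant term and is killed by all e'_l, so
  \<open>rad_if_ep_0\<close> applies; the radical is a two-sided ideal.\<close>

lemma SR_rad: "x \<in> ideal SR \<Longrightarrow> x \<in> rad"
proof (induction rule: ideal.induct)
  case (gen r u v)
  then obtain i j where r: "r = ser i j" "i \<noteq> j" by (auto simp: SR_def)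
  obtain n where n: "nat (1 - C i j) = Suc n" using C_off[OF r(2)] by (cases "nat (1 - C i j)") auto
  have "wd [i] * x \<in> Sp (\<lambda>w. w \<noteq> [])" "x * wd [i] \<in> Sp (\<lambda>w. w \<noteq> [])" for x
    by (rule Sp_mult[of _ "\<lambda>w. w = [i]" _ "\<lambda>_. True"] Sp_mult[of _ "\<lambda>_. True" _ "\<lambda>w. w = [i]"];
        simp add: Sp_iff lookup_wd)+
  then have "r \<in> Sp (\<lambda>w. w \<noteq> [])"
    unfolding r(1) ser_def n by (auto simp: Fi_def intro: Sp_diff)
  then have "r \<in> rad" using r ser_ep by (intro rad_if_ep_0) (auto simp: Sp_iff)
  then show ?case by (intro rad_mult_left rad_mult_right)
qed (auto simp: rad_def)

text \<open>The subalgebra of \<open>ker e'\<^sub>i\<close> on which the twisted commutator with \<open>f\<^sub>i\<close> is locally nilpotent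
  modulo the Serre ideal; together with the powers of \<open>f\<^sub>i\<close> it spans everything.\<close>

definition Ker :: "'i \<Rightarrow> 'i alg set" where
  "Ker i = {x. ep i x = 0 \<and> (\<exists>n. (Fi i ^^ n) x \<in> ideal SR)}"

lemma Fi_pow_SR_le: "(Fi i ^^ m) x \<in> ideal SR \<Longrightarrow> m \<le> n \<Longrightarrow> (Fi i ^^ n) x \<in> ideal SR"
  using Fi_pow_SR[where x="(Fi i ^^ m) x" and i=i and n="n - m"] by (simp flip: funpow_add[THEN fun_cong, unfolded o_def])

lemma Ker_0: "0 \<in> Ker i" and Ker_1: "1 \<in> Ker i"
  using Fi_pow_1[of 1 i] by (auto simp: Ker_def intro!: exI[of _ 1])

lemma Ker_add: "x \<in> Ker i \<Longrightarrow> y \<in> Ker i \<Longrightarrow> x + y \<in> Ker i"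
proof -
  assume a: "x \<in> Ker i" "y \<in> Ker i"
  then obtain m n where "(Fi i ^^ m) x \<in> ideal SR" "(Fi i ^^ n) y \<in> ideal SR" by (auto simp: Ker_def)
  then have "(Fi i ^^ max m n) (x + y) \<in> ideal SR"
    by (auto intro!: ideal.add intro: Fi_pow_SR_le)
  with a show ?thesis by (auto simp: Ker_def)
qed

lemma Ker_sc: "x \<in> Ker i \<Longrightarrow> c \<odot> x \<in> Ker i"
  by (auto simp: Ker_def intro: ideal.sc)

lemma Ker_Fi: "x \<in> Ker i \<Longrightarrow> Fi i x \<in> Ker i"
  unfolding Ker_def by (auto simp: ep_Fi_0 funpow_swap1[symmetric] intro: Fi_SR)

lemma Ker_tw: "x \<in> Ker i \<Longrightarrow> tw i m x \<in> Ker i"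
  unfolding Ker_def by (auto simp: ep_tw Fi_pow_tw intro!: ideal.sc tw_SR)

text \<open>\<open>Fi i\<close> is a twisted derivation and each application falls on one of the
  factors. Induction on a + b replaces a q-Leibniz formula for powers.\<close>

lemma Fi_pow_mult_SR:
  "(Fi i ^^ a) x \<in> ideal SR \<Longrightarrow> (Fi i ^^ b) y \<in> ideal SR \<Longrightarrow> (Fi i ^^ (a + b)) (x * y) \<in> ideal SR"
proof (induction "a + b" arbitrary: a b x y)
  case 0 then show ?case by (auto intro: ideal_mult_left)
next
  case (Suc n)
  consider "a = 0" | "b = 0" | a' b' where "a = Suc a'" "b = Suc b'" by (cases a; cases b) auto
  then show ?case
  proof cases
    case 1 with Suc.prems show ?thesis by (auto intro!: Fi_pow_SR ideal_mult_right)
  next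
    case 2 with Suc.prems show ?thesis by (auto intro!: Fi_pow_SR ideal_mult_left)
  next
    case 3
    have "(Fi i ^^ (a' + b)) (Fi i x * y) \<in> ideal SR"
      using Suc.prems Suc.hyps(2) 3 by (intro Suc.hyps(1)) (auto simp: funpow_swap1)
    moreover have "(Fi i ^^ (a + b')) (tw i 1 x * Fi i y) \<in> ideal SR"
    proof (rule Suc.hyps(1))
      show "n = a + b'" using Suc.hyps(2) 3 by simp
      show "(Fi i ^^ a) (tw i 1 x) \<in> ideal SR"
        using Suc.prems(1) unfolding Fi_pow_tw by (intro ideal.sc tw_SR)
      show "(Fi i ^^ b') (Fi i y) \<in> ideal SR"
        using Suc.prems(2) 3 by (simp add: funpow_swap1)
    qed
    ultimately show ?thesis using 3
      by (simp add: Fi_mult funpow_Suc_right del: funpow.simps) (auto intro: ideal.add)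
  qed
qed

lemma Ker_mult: "x \<in> Ker i \<Longrightarrow> y \<in> Ker i \<Longrightarrow> x * y \<in> Ker i"
  unfolding Ker_def using Fi_pow_mult_SR by (auto simp: ep_mult) blast

text \<open>The point at which the Serre relation enters: it states nilpotency of
  \<open>Fi i\<close> on a letter other than i.\<close>

lemma Ker_letter: "j \<noteq> i \<Longrightarrow> wd [j] \<in> Ker i"
  unfolding Ker_def using ideal_base[of "ser i j" SR] by (auto simp: ser_def SR_def)

abbreviation fp :: "'i \<Rightarrow> nat \<Rightarrow> 'i alg" where "fp i m \<equiv> wd (replicate m i)"

text \<open>The shape survives left multiplication by letters: a letter other than i lies in
  \<open>Ker i\<close>, and f_i passes a coefficient by f_i k = \<open>Fi i k\<close> +
  \<open>tw i 1 k\<close> f_i. Families vanishing from n on allow two sums to be brought to a common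
  bound.\<close>

lemma Ker_decomp:
  "\<exists>k n. (\<forall>m. k m \<in> Ker i) \<and> (\<forall>m\<ge>n. k m = 0) \<and> x = (\<Sum>m<n. k m * fp i m)" (is "?R x")
proof -
  have add: "?R (x + y)" if "?R x" "?R y" for x y
  proof -
    from that obtain k k' n n' where
      k: "\<forall>m. k m \<in> Ker i" "\<forall>m\<ge>n. k m = 0" "x = (\<Sum>m<n. k m * fp i m)" and
      k': "\<forall>m. k' m \<in> Ker i" "\<forall>m\<ge>n'. k' m = 0" "y = (\<Sum>m<n'. k' m * fp i m)" by blast
    have "x = (\<Sum>m<max n n'. k m * fp i m)" "y = (\<Sum>m<max n n'. k' m * fp i m)"
      unfolding k(3) k'(3) by (rule sum.mono_neutral_left; use k(2) k'(2) in auto)+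
    with k k' show ?thesis
      by (intro exI[of _ "\<lambda>m. k m + k' m"] exI[of _ "max n n'"])
         (auto simp: distrib_right sum.distrib intro: Ker_add)
  qed
  have single: "?R (k * fp i m)" if "k \<in> Ker i" for k m
    using that by (intro exI[of _ "\<lambda>t. if t = m then k else 0"] exI[of _ "Suc m"])
      (auto simp: Ker_0 if_distrib[of "\<lambda>t. t * _"] cong: if_cong)
  have sum: "?R (\<Sum>m\<in>A. f m)" if "\<And>m. m \<in> A \<Longrightarrow> ?R (f m)" for f :: "nat \<Rightarrow> 'i alg" and A
    using that
  proof (induction A rule: infinite_finite_induct)
    case (insert a A)
    have "?R (f a)" using insert.prems by blast
    moreover have "?R (sum f A)" using insert.IH insert.prems by blast
    ultimately have "?R (f a + sum f A)" by (rule add)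
    then show ?case using insert.hyps by simp
  qed (auto intro!: exI[of _ "\<lambda>_. 0"] Ker_0)
  show ?thesis
  proof (induction x rule: alg_induct)
    case (mono u)
    show ?case
    proof (induction u)
      case Nil show ?case using single[OF Ker_1, of 0] by simp
    next
      case (Cons a u)
      then obtain k n where k: "\<forall>m. k m \<in> Ker i" "wd u = (\<Sum>m<n. k m * fp i m)" by blast
      have "wd (a # u) = wd [a] * wd u" by simp
      also have "\<dots> = (\<Sum>m<n. wd [a] * (k m * fp i m))" by (simp only: k(2) sum_distrib_left)
      finally have *: "wd (a # u) = (\<Sum>m<n. wd [a] * (k m * fp i m))" .
      have "?R (wd [a] * (k m * fp i m))" for m
      proof (cases "a = i")
        case True
        have "wd [i] * (k m * fp i m) = Fi i (k m) * fp i m + tw i 1 (k m) * fp i (Suc m)"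
          by (simp add: Fi_def algebra_simps)
        then show ?thesis using True k(1)
            add[OF single[of "Fi i (k m)" m] single[of "tw i 1 (k m)" "Suc m"]] by (auto intro: Ker_Fi Ker_tw)
      next
        case False
        then show ?thesis using single[of "wd [a] * k m" m] k(1)
          by (simp add: Ker_mult Ker_letter mult.assoc)
      qed
      then show ?case unfolding * by (rule sum)
    qed
  next
    case (sc c x)
    then obtain k n where "\<forall>m. k m \<in> Ker i" "\<forall>m\<ge>n. k m = 0" "x = (\<Sum>m<n. k m * fp i m)" by blast
    then show ?case
      by (intro exI[of _ "\<lambda>m. c \<odot> k m"] exI[of _ n]) (auto simp: alg.scale_sum_right intro: Ker_sc)
  qed (rule add)
qed

section \<open>Uniqueness modulo the Serre ideal of coefficients over the kernel of e'_i\<close>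

definition ec :: "'i \<Rightarrow> nat \<Rightarrow> K" where "ec i m = (\<Sum>t<m. qi d i (- 2 * int t))"

lemma ep_fp: "ep i (fp i (Suc m)) = ec i (Suc m) \<odot> fp i m"
proof (induction m)
  case (Suc m)
  have "ec i (Suc n) = 1 + qi d i (- 2) * ec i n" for n
    by (simp only: ec_def sum.lessThan_Suc_shift) (simp add: sum_distrib_left algebra_simps flip: qi_add)
  then show ?case
    using Suc by (simp add: ep_Cons[of _ _ "_ # _"] alg.scale_left_distrib alg.scale_right_distrib distrib_left)
qed (simp add: ec_def)

lemma ec_nonzero: "m > 0 \<Longrightarrow> ec i m \<noteq> 0"
proof -
  assume m: "m > 0"
  have "ec i m * (1 - qi d i (- 2)) = 1 - qi d i (- 2 * int m)" for m
    by (induction m) (simp_all add: ec_def distrib_right, simp add: algebra_simps flip: qi_add)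
  moreover have "1 - qi d i (- 2 * int m) \<noteq> 0" using m by simp
  ultimately show ?thesis by (metis mult_zero_left)
qed

text \<open>As e'_i kills the coefficients, it acts as q-differentiation with respect to f_i, with
  unbalanced quantum integers \<open>ec\<close>.\<close>

lemma ep_Ker_sum:
  assumes "\<forall>m. k m \<in> Ker i"
  shows "ep i (\<Sum>m<Suc n. k m * fp i m) = (\<Sum>m<n. (ec i (Suc m) \<odot> tw i (- 1) (k (Suc m))) * fp i m)"
proof -
  have "ep i (k 0) = 0" using assms by (simp add: Ker_def)
  moreover have "ep i (k (Suc m) * fp i (Suc m)) = (ec i (Suc m) \<odot> tw i (- 1) (k (Suc m))) * fp i m" for m
    using assms unfolding Ker_def by (simp add: ep_mult ep_fp del: replicate.simps)
  ultimately show ?thesis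
    by (induction n) (auto simp del: replicate.simps(2))
qed

text \<open>Differentiating lowers the degree in f_i and, by induction, settles all coefficients but
  the constant one, which is then obtained by subtraction.\<close>

lemma Ker_sum_SR:
  "\<forall>m. k m \<in> Ker i \<Longrightarrow> (\<Sum>m<n. k m * fp i m) \<in> ideal SR \<Longrightarrow> m < n \<Longrightarrow> k m \<in> ideal SR"
proof (induction n arbitrary: k m)
  case (Suc n)
  have h1: "(\<Sum>m<n. (ec i (Suc m) \<odot> tw i (- 1) (k (Suc m))) * fp i m) \<in> ideal SR"
    using ep_SR[OF Suc.prems(2), of i] unfolding ep_Ker_sum[OF Suc.prems(1)] .
  have h2: "\<forall>m. ec i (Suc m) \<odot> tw i (- 1) (k (Suc m)) \<in> Ker i"
    using Suc.prems(1) by (auto intro!: Ker_sc Ker_tw)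
  have "ec i (Suc m) \<odot> tw i (- 1) (k (Suc m)) \<in> ideal SR" if "m < n" for m
    by (rule Suc.IH[where k="\<lambda>m. ec i (Suc m) \<odot> tw i (- 1) (k (Suc m))", OF h2 h1 that])
  then have *: "k (Suc m) \<in> ideal SR" if "m < n" for m
    using that by (simp add: sc_SR_iff ec_nonzero tw_SR_iff)
  have k0: "k 0 = (\<Sum>m<Suc n. k m * fp i m) - (\<Sum>m<n. k (Suc m) * fp i (Suc m))"
    by (subst sum.lessThan_Suc_shift) simp
  have "(\<Sum>m<n. k (Suc m) * fp i (Suc m)) \<in> ideal SR"
    using * by (intro ideal_sum ideal_mult_right) auto
  then have "k 0 \<in> ideal SR" by (subst k0) (rule ideal_diff[OF Suc.prems(2)])
  with * Suc.prems(3) show ?case by (cases m) auto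
qed simp

text \<open>Comparing coefficients in e'_i x shows that x agrees modulo the Serre ideal with its
  constant coefficient, which lies in \<open>Ker i\<close>. So nilpotency also holds when e'_i x
  vanishes only modulo the ideal.\<close>

lemma ep_SR_nilpotent:
  assumes "ep i x \<in> ideal SR" obtains n where "(Fi i ^^ n) x \<in> ideal SR"
proof -
  obtain k n where k: "\<forall>m. k m \<in> Ker i" "\<forall>m\<ge>n. k m = 0" "x = (\<Sum>m<n. k m * fp i m)"
    using Ker_decomp by blast
  \<comment> \<open>A zero top term is added because \<open>ep_Ker_sum\<close> expects a successor
    as the number of terms.\<close>
  have x: "x = (\<Sum>m<Suc n. k m * fp i m)" using k by simp
  have "\<forall>m. ec i (Suc m) \<odot> tw i (- 1) (k (Suc m)) \<in> Ker i"
    using k(1) by (auto intro!: Ker_sc Ker_tw)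
  moreover have "(\<Sum>m<n. (ec i (Suc m) \<odot> tw i (- 1) (k (Suc m))) * fp i m) \<in> ideal SR"
    using assms unfolding x ep_Ker_sum[OF k(1)] .
  ultimately have "ec i (Suc m) \<odot> tw i (- 1) (k (Suc m)) \<in> ideal SR" if "m < n" for m
    using that by (rule Ker_sum_SR[where k="\<lambda>m. ec i (Suc m) \<odot> tw i (- 1) (k (Suc m))"])
  then have *: "k (Suc m) \<in> ideal SR" if "m < n" for m
    using that by (simp add: sc_SR_iff ec_nonzero tw_SR_iff)
  have "x - k 0 = (\<Sum>m<n. k (Suc m) * fp i (Suc m))"
    unfolding x by (subst sum.lessThan_Suc_shift) simp
  moreover have "(\<Sum>m<n. k (Suc m) * fp i (Suc m)) \<in> ideal SR"
    using * by (intro ideal_sum ideal_mult_right) auto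
  ultimately have x0: "x - k 0 \<in> ideal SR" by simp
  obtain M where "(Fi i ^^ M) (k 0) \<in> ideal SR" using k(1) by (auto simp: Ker_def)
  with Fi_pow_SR[OF x0, where i=i and n=M] have "(Fi i ^^ M) x \<in> ideal SR"
    using ideal.add[of "(Fi i ^^ M) x - (Fi i ^^ M) (k 0)" SR "(Fi i ^^ M) (k 0)"] by simp
  then show ?thesis by (rule that)
qed

text \<open>Modulo the Serre ideal such an \<open>x\<close> is a highest weight vector of weight \<open>- k < 0\<close> in a locally
  nilpotent representation of quantum \<open>sl\<^sub>2\<close>, with \<open>es i\<close> raising and \<open>Fi i\<close> lowering.\<close>

lemma SR_if_primitive:
  assumes x: "x \<in> Sp (\<lambda>w. N i w = k)" and k: "k > 0" and e: "ep i x \<in> ideal SR" "es i x \<in> ideal SR"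
  shows "x \<in> ideal SR"
proof -
  have *: "(Fi i ^^ n) x \<in> ideal SR \<Longrightarrow> x \<in> ideal SR" for n
  proof (induction n)
    case (Suc n)
    have "es i ((Fi i ^^ Suc n) x) \<in> ideal SR" using es_SR[OF Suc.prems] .
    moreover have "(Fi i ^^ Suc n) (es i x) \<in> ideal SR" using Fi_pow_SR[OF e(2)] .
    ultimately have "sl2c i k (Suc n) \<odot> (Fi i ^^ n) x \<in> ideal SR"
      using ideal_diff[of "es i ((Fi i ^^ Suc n) x)" SR "(Fi i ^^ Suc n) (es i x)"]
      unfolding es_Fi_pow[OF x] by (simp del: funpow.simps)
    then show ?case using Suc.IH k by (simp add: sc_SR_iff sl2c_nonzero)
  qed simp
  from ep_SR_nilpotent[OF e(1)] * show ?thesis by blast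
qed

text \<open>If all pairings were at most 0, then (\<beta>, \<beta>), the sum of d_i \<beta>_i <h_i,
  \<beta>>, would be too. This is the one use of positive definiteness.\<close>

lemma exists_N_pos:
  assumes "\<beta> \<noteq> {#}" shows "\<exists>i. (\<Sum>j\<in>#\<beta>. C i j) > 0"
proof (rule ccontr)
  assume "\<not> ?thesis"
  then have le: "(\<Sum>j\<in>#\<beta>. C i j) \<le> 0" for i by (meson linorder_not_less)
  have cnt: "(\<Sum>j\<in>#\<beta>. C i j) = (\<Sum>j\<in>UNIV. C i j * int (count \<beta> j))" for i
  proof (induction \<beta>)
    case (add a \<beta>)
    have "(\<Sum>j\<in>UNIV. C i j * int (count (add_mset a \<beta>) j)) =
        (\<Sum>j\<in>UNIV. (if j = a then C i j else 0) + C i j * int (count \<beta> j))"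
      by (rule sum.cong) (auto simp: algebra_simps)
    then show ?case using add by (simp add: sum.distrib)
  qed simp
  define v where "v j = real (count \<beta> j)" for j
  have "v \<noteq> (\<lambda>_. 0)" using assms by (auto simp: v_def fun_eq_iff multiset_eq_iff)
  then have "(\<Sum>i\<in>UNIV. \<Sum>j\<in>UNIV. v i * real (d i) * real_of_int (C i j) * v j) > 0"
    using fin by (auto simp: finite_cartan_def)
  moreover have "(\<Sum>j\<in>UNIV. v i * real (d i) * real_of_int (C i j) * v j) =
      v i * real (d i) * real_of_int (\<Sum>j\<in>#\<beta>. C i j)" for i
    unfolding cnt by (simp add: v_def sum_distrib_left mult.assoc)
  ultimately have "(\<Sum>i\<in>UNIV. v i * real (d i) * real_of_int (\<Sum>j\<in>#\<beta>. C i j)) > 0" by simp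
  moreover have "(\<Sum>i\<in>UNIV. v i * real (d i) * real_of_int (\<Sum>j\<in>#\<beta>. C i j)) \<le> 0"
    by (rule sum_nonpos) (use le in \<open>auto simp: v_def intro!: mult_nonneg_nonpos\<close>)
  ultimately show False by simp
qed

lemma rad_hom_SR: "x \<in> rad \<Longrightarrow> x \<in> Sp (\<lambda>w. mset w = \<beta>) \<Longrightarrow> x \<in> ideal SR"
proof (induction "size \<beta>" arbitrary: x \<beta>)
  case 0
  then have "x \<in> Sp (\<lambda>w. w = [])" by (auto elim: Sp_mono_pred)
  moreover have "Poly_Mapping.lookup x [] = 0"
    using 0 L_sym[of x 1] by (simp add: rad_def L_1)
  ultimately have "x = 0" by (intro poly_mapping_eqI) (auto simp: Sp_iff)
  then show ?case by simp
next
  case (Suc n)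
  then have "\<beta> \<noteq> {#}" by auto
  then obtain i where i: "(\<Sum>j\<in>#\<beta>. C i j) > 0" using exists_N_pos by blast
  have x: "x \<in> Sp (\<lambda>w. N i w = (\<Sum>j\<in>#\<beta>. C i j))"
    using Suc.prems(2) by (rule Sp_mono_pred) (simp add: N_mset)
  have e: "ep i x \<in> Sp (\<lambda>w. \<beta> = add_mset i (mset w))" "es i x \<in> Sp (\<lambda>w. \<beta> = add_mset i (mset w))"
    unfolding ep_def es_def
    by (rule lin_Sp[OF Suc.prems(2)], use ep_Sp[of i] es_Sp[of i] in \<open>auto simp: ep_def es_def\<close>)+
  have "ep i x \<in> ideal SR \<and> es i x \<in> ideal SR"
  proof (cases "i \<in># \<beta>")
    case True
    then obtain \<beta>' where \<beta>': "\<beta> = add_mset i \<beta>'" by (metis multi_member_split)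
    with Suc.hyps(2) have "n = size \<beta>'" by simp
    moreover have "ep i x \<in> Sp (\<lambda>w. mset w = \<beta>')" "es i x \<in> Sp (\<lambda>w. mset w = \<beta>')"
      using e \<beta>' by (auto elim: Sp_mono_pred)
    ultimately show ?thesis using Suc.hyps(1) Suc.prems(1) rad_ep rad_es by blast
  next
    case False
    then have "ep i x \<in> Sp (\<lambda>w. False)" "es i x \<in> Sp (\<lambda>w. False)" using e by (auto elim!: Sp_mono_pred)
    then have "ep i x = 0" "es i x = 0" by (auto simp: Sp_iff intro!: poly_mapping_eqI)
    then show ?thesis by simp
  qed
  then show ?case using SR_if_primitive[OF x i] by blast
qed

theorem rad_SR: "rad = ideal SR"
proof (intro equalityI subsetI)
  fix x assume x: "x \<in> rad"
  \<comment> \<open>Components by multiset of letters. Words with different multisets are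
    orthogonal, so each component of a radical element is again radical and
    \<open>rad_hom_SR\<close> applies to it.\<close>
  define cp where "cp \<beta> = lin (\<lambda>w. if mset w = \<beta> then wd w else 0)" for \<beta> :: "'i multiset"
  have lk: "Poly_Mapping.lookup (cp \<beta> x) w = (if mset w = \<beta> then Poly_Mapping.lookup x w else 0)" for \<beta> x w
    by (induction x rule: alg_induct) (auto simp: cp_def lookup_wd lookup_add)
  have Lc: "L (cp \<beta> x) (wd v) = (if mset v = \<beta> then L x (wd v) else 0)" for \<beta> x v
  proof (induction x rule: alg_induct)
    case (mono w)
    show ?case by (cases "L (wd w) (wd v) = 0") (auto simp: cp_def dest: L_mset)
  qed (auto simp: cp_def)
  have "cp \<beta> x \<in> ideal SR" for \<beta>
  proof (rule rad_hom_SR)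
    show "cp \<beta> x \<in> rad" using x by (intro rad_wdI) (simp add: Lc rad_def)
    show "cp \<beta> x \<in> Sp (\<lambda>w. mset w = \<beta>)" by (auto simp: Sp_iff lk split: if_splits)
  qed
  moreover have "x = (\<Sum>\<beta>\<in>mset ` Poly_Mapping.keys x. cp \<beta> x)"
  proof (rule poly_mapping_eqI)
    fix w
    have "Poly_Mapping.lookup (\<Sum>\<beta>\<in>mset ` Poly_Mapping.keys x. cp \<beta> x) w =
        (if mset w \<in> mset ` Poly_Mapping.keys x then Poly_Mapping.lookup x w else 0)"
      by (simp add: lookup_sum lk)
    moreover have "mset w \<in> mset ` Poly_Mapping.keys x" if "Poly_Mapping.lookup x w \<noteq> 0"
      using that by (simp add: in_keys_iff)
    ultimately show "Poly_Mapping.lookup x w = Poly_Mapping.lookup (\<Sum>\<beta>\<in>mset ` Poly_Mapping.keys x. cp \<beta> x) w"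
      by auto
  qed
  ultimately show "x \<in> ideal SR" using ideal_sum[of "mset ` Poly_Mapping.keys x" "\<lambda>\<beta>. cp \<beta> x" SR] by simp
qed (rule SR_rad)

end

subsection \<open>Straightening in the bosonic extension\<close>

lemma sgnpow_simps [simp]: "sgnpow 0 = 1" "sgnpow (k + 1) = - sgnpow k" "sgnpow (k + 2) = sgnpow k"
  "sgnpow (1 + k) = - sgnpow k" "sgnpow k * sgnpow k = 1" "sgnpow k * (sgnpow k * m) = m"
  by (auto simp: sgnpow_def)

lemma ordered_Cons: "ordered (a # u) \<longleftrightarrow> (\<forall>l\<in>set u. snd l \<le> snd a) \<and> ordered u"
  by (auto simp: ordered_def)

lemma ordered_append: "ordered (u @ v) \<longleftrightarrow> ordered u \<and> ordered v \<and> (\<forall>a\<in>set u. \<forall>b\<in>set v. snd b \<le> snd a)"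
  by (induction u) (auto simp: ordered_Cons, simp add: ordered_def)

lemma ordered_Nil [simp]: "ordered []"
  by (simp add: ordered_def)

lemma wwt_simps: "wwt [] = (\<lambda>_. 0)" "wwt (a # u) = (\<lambda>l. lwt a l + wwt u l)" "wwt (u @ v) = (\<lambda>l. wwt u l + wwt v l)"
  by (simp_all add: wwt_def)

definition lf :: "int \<Rightarrow> 'i alg \<Rightarrow> ('i \<times> int) alg" where
  "lf k = lin (\<lambda>u. wd (map (\<lambda>j. (j, k)) u))"

lemma lf_simps [simp]:
  "lf k (wd u) = wd (map (\<lambda>j. (j, k)) u)"
  "lf k (x + y) = lf k x + lf k y"
  "lf k (x - y) = lf k x - lf k y"
  "lf k (c \<odot> x) = c \<odot> lf k x"
  "lf k 0 = 0"
  by (simp_all add: lf_def)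

lemma lf_1 [simp]: "lf k 1 = 1"
  using lf_simps(1)[of k "[]"] by (simp del: lf_simps(1))

lemma lf_mult: "lf k (x * y) = lf k x * lf k y"
proof (induction x rule: alg_induct)
  case (mono u)
  show ?case by (induction y rule: alg_induct) (simp_all add: distrib_left)
qed (simp_all add: distrib_right)

lemma lf_sum: "lf k (sum f A) = (\<Sum>t\<in>A. lf k (f t))"
  by (simp add: lf_def lin_sum)

lemma ev_lift: "ev (lift k s) = lf k (ev s)"
  by (induction s) (auto simp: lift_def)

lemma ev_unlift: "at_level k r \<Longrightarrow> lf k (ev (unlift r)) = ev r"
proof (induction r)
  case (Cons t r)
  obtain c u where t: "t = (c, u)" by (cases t)
  have "map (\<lambda>j. (j, k)) (map fst u) = u"
    using Cons.prems t by (intro map_idI[of u, simplified] nth_equalityI) (auto simp: at_level_def prod_eq_iff)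
  then show ?case using Cons t by (auto simp: unlift_def at_level_def o_def)
qed (simp add: unlift_def)

context cartan
begin

text \<open>For adjacent levels the sign is +1, so one formula covers both families of relations,
  with \<open>dl\<close> as the extra constant term.\<close>

definition chi :: "'i \<times> int \<Rightarrow> 'i \<times> int \<Rightarrow> K" where
  "chi a b = qi d (fst a) (sgnpow (snd b - snd a + 1) * C (fst a) (fst b))"

definition dl :: "'i \<times> int \<Rightarrow> 'i \<times> int \<Rightarrow> K" where
  "dl a b = (if fst a = fst b \<and> snd b = snd a + 1 then 1 - qi d (fst a) 2 else 0)"

text \<open>All relations except the Serre relations; modulo these alone \<open>nf\<close> below is an exact normal form.\<close>

definition R12 :: "('i \<times> int) alg set" where
  "R12 = {wd [a, b] - (chi a b \<odot> wd [b, a] + dl a b \<odot> 1) | a b. snd a < snd b}"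

definition RR :: "('i \<times> int) alg set" where
  "RR = R12 \<union> {lf p (ser i j) | i j p. i \<noteq> j}"

section \<open>The Serre elements in q-binomial form\<close>

lemma qint_rec: "n \<le> m \<Longrightarrow> qint d i (Suc m) = qi d i (- int n) * qint d i (Suc m - n) + qi d i (int (Suc m) - int n) * qint d i n"
  unfolding qint_def times_divide_eq_right add_divide_distrib[symmetric]
  by (simp add: of_nat_diff algebra_simps flip: qi_add)

lemma qint_nonzero: "n > 0 \<Longrightarrow> qint d i n \<noteq> 0"
  by (auto simp: qint_def qi_eq_iff)

lemma qfact_nonzero [simp]: "qfact d i n \<noteq> 0"
  by (auto simp: qfact_def qint_nonzero)

lemma qfact_Suc: "qfact d i (Suc n) = qfact d i n * qint d i (Suc n)"
  by (simp add: qfact_def)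

lemma qbinom_0 [simp]: "qbinom d i n 0 = 1" and qbinom_self [simp]: "qbinom d i n n = 1"
  by (simp_all add: qbinom_def, simp_all add: qfact_def)

lemma qbinom_pascal:
  assumes "m < n"
  shows "qbinom d i (Suc n) (Suc m) =
    qi d i (- int (Suc m)) * qbinom d i n (Suc m) + qi d i (int n - int m) * qbinom d i n m"
proof -
  obtain t where t: "n = Suc (m + t)" using assms less_iff_Suc_add by auto
  have n0: "qint d i (Suc m) \<noteq> 0" "qint d i (Suc t) \<noteq> 0" by (simp_all add: qint_nonzero)
  have "qint d i (Suc n) = qi d i (- int (Suc m)) * qint d i (Suc t) + qi d i (int n - int m) * qint d i (Suc m)"
    using qint_rec[of "Suc m" n] t by simp
  moreover have "Suc n - Suc m = Suc t" "n - Suc m = t" "n - m = Suc t" using t by auto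
  ultimately show ?thesis
    using n0 unfolding qbinom_def by (simp add: qfact_Suc) (simp add: field_simps)
qed

text \<open>Induction by the q-Pascal rule. At n = 1 - c_ij the factor c_ij + n - 1 of the exponent
  vanishes, leaving exactly the coefficients of the Serre relation.\<close>

lemma Fi_pow_letter_expand:
  "(Fi i ^^ n) (wd [j]) = (\<Sum>m\<le>n. ((-1) ^ m * qi d i (int m * (C i j + int n - 1)) * qbinom d i n m) \<odot>
     wd (replicate (n - m) i @ [j] @ replicate m i))"
proof (induction n)
  case (Suc n)
  let ?c = "\<lambda>n m. (-1) ^ m * qi d i (int m * (C i j + int n - 1)) * qbinom d i n m"
  let ?w = "\<lambda>n m. wd (replicate (n - m) i @ [j] @ replicate m i)"
  let ?e = "qi d i (C i j + int n * 2)"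
  have tw: "tw i 1 ((Fi i ^^ n) (wd [j])) = ?e \<odot> (Fi i ^^ n) (wd [j])"
    using tw_eigen[OF Fi_pow_Sp[where x="wd [j]" and l=i and k="C i j" and i=i and n=n], of 1]
    by (simp add: mult.commute)
  have l: "wd [i] * ?w n m = ?w (Suc n) m" if "m \<le> n" for m
    using that by (simp add: Suc_diff_le)
  have r: "?w n m * wd [i] = ?w (Suc n) (Suc m)" for m
    by (simp add: replicate_append_same)
  have "(Fi i ^^ Suc n) (wd [j]) = wd [i] * (Fi i ^^ n) (wd [j]) - ?e \<odot> ((Fi i ^^ n) (wd [j]) * wd [i])"
    unfolding funpow.simps o_def by (subst Fi_def) (simp only: tw sc_mult_left)
  also have "wd [i] * (Fi i ^^ n) (wd [j]) = (\<Sum>m\<le>n. ?c n m \<odot> ?w (Suc n) m)"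
    unfolding Suc sum_distrib_left sc_mult_right by (rule sum.cong) (simp_all only: l atMost_iff)
  also have "\<dots> = ?w (Suc n) 0 + (\<Sum>m<n. ?c n (Suc m) \<odot> ?w (Suc n) (Suc m))"
    by (simp only: lessThan_Suc_atMost[symmetric] sum.lessThan_Suc_shift) simp
  also have "?e \<odot> ((Fi i ^^ n) (wd [j]) * wd [i]) = (\<Sum>m\<le>n. (?e * ?c n m) \<odot> ?w (Suc n) (Suc m))"
    unfolding Suc sum_distrib_right sc_mult_left r by (simp only: alg.scale_sum_right alg.scale_scale)
  also have "\<dots> = (\<Sum>m<n. (?e * ?c n m) \<odot> ?w (Suc n) (Suc m)) + (?e * ?c n n) \<odot> ?w (Suc n) (Suc n)"
    by (simp only: lessThan_Suc_atMost[symmetric] sum.lessThan_Suc)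
  finally have "(Fi i ^^ Suc n) (wd [j]) = ?w (Suc n) 0
      + (\<Sum>m<n. (?c n (Suc m) - ?e * ?c n m) \<odot> ?w (Suc n) (Suc m)) - (?e * ?c n n) \<odot> ?w (Suc n) (Suc n)"
    by (simp only: alg.scale_left_diff_distrib sum_subtractf) simp
  also have "(\<Sum>m<n. (?c n (Suc m) - ?e * ?c n m) \<odot> ?w (Suc n) (Suc m)) =
      (\<Sum>m<n. ?c (Suc n) (Suc m) \<odot> ?w (Suc n) (Suc m))"
  proof (rule sum.cong[OF refl])
    fix m assume "m \<in> {..<n}"
    then have m: "m < n" by simp
    have e1: "qi d i (int (Suc m) * (C i j + int (Suc n) - 1)) * qi d i (- int (Suc m)) =
        qi d i (int (Suc m) * (C i j + int n - 1))"
      unfolding qi_add[symmetric] by (simp add: algebra_simps)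
    have e2: "qi d i (int (Suc m) * (C i j + int (Suc n) - 1)) * qi d i (int n - int m) =
        ?e * qi d i (int m * (C i j + int n - 1))"
      unfolding qi_add[symmetric] by (simp add: algebra_simps)
    have "?c (Suc n) (Suc m) = (-1) ^ Suc m *
        ((qi d i (int (Suc m) * (C i j + int (Suc n) - 1)) * qi d i (- int (Suc m))) * qbinom d i n (Suc m)
        + (qi d i (int (Suc m) * (C i j + int (Suc n) - 1)) * qi d i (int n - int m)) * qbinom d i n m)"
      unfolding qbinom_pascal[OF m] by (simp only: algebra_simps)
    also have "\<dots> = ?c n (Suc m) - ?e * ?c n m"
      unfolding e1 e2 by (simp add: algebra_simps)
    finally show "(?c n (Suc m) - ?e * ?c n m) \<odot> ?w (Suc n) (Suc m) = ?c (Suc n) (Suc m) \<odot> ?w (Suc n) (Suc m)"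
      by simp
  qed
  also have "(?e * ?c n n) \<odot> ?w (Suc n) (Suc n) = - (?c (Suc n) (Suc n) \<odot> ?w (Suc n) (Suc n))"
  proof -
    have "?e * qi d i (int n * (C i j + int n - 1)) = qi d i (int (Suc n) * (C i j + int (Suc n) - 1))"
      unfolding qi_add[symmetric] by (simp add: algebra_simps)
    then have "?e * ?c n n = - ?c (Suc n) (Suc n)" by simp
    then show ?thesis by (simp only: alg.scale_minus_left)
  qed
  finally show ?case
    by (simp only: lessThan_Suc_atMost[symmetric] sum.lessThan_Suc_shift[of _ "Suc n"] sum.lessThan_Suc[of _ n]) simp
qed simp

lemma ev_serre_rel: assumes "i \<noteq> j" shows "ev (serre_rel C d i j p) = lf p (ser i j)"
proof -
  define n where "n = nat (1 - C i j)"
  have "C i j + int n - 1 = 0" using C_off[OF assms] by (simp add: n_def)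
  then have "ser i j = (\<Sum>m\<le>n. ((-1) ^ m * qbinom d i n m) \<odot> wd (replicate (n - m) i @ [j] @ replicate m i))"
    unfolding ser_def n_def[symmetric] Fi_pow_letter_expand by simp
  then have "lf p (ser i j) = (\<Sum>m\<le>n. ((-1) ^ m * qbinom d i n m) \<odot>
      wd (replicate (n - m) (i, p) @ [(j, p)] @ replicate m (i, p)))"
    by (simp add: lf_sum)
  also have "\<dots> = ev (serre_rel C d i j p)"
    unfolding serre_rel_def Let_def n_def[symmetric] ev_def
    by (simp add: sum_list_distinct_conv_sum_set o_def atLeast0LessThan lessThan_Suc_atMost del: upt_Suc)
  finally show ?thesis by simp
qed

lemma ev_rels: "ev ` rels C d = RR"
proof (intro equalityI subsetI)
  fix x assume "x \<in> ev ` rels C d"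
  then obtain r where r: "r \<in> rels C d" and x: "x = ev r" by blast
  from r consider (1) i j p where "i \<noteq> j" "r = serre_rel C d i j p"
    | (2) i j m p where "p > m + 1" "r = [(1, [(i, m), (j, p)]), (- qi d i (sgnpow (p - m + 1) * C i j), [(j, p), (i, m)])]"
    | (3) i j p where "r = [(1, [(i, p), (j, p + 1)]), (- qi d i (C i j), [(j, p + 1), (i, p)])]
       @ (if i = j then [(- (1 - qi d i 2), [])] else [])"
    unfolding rels_def by (elim UnE CollectE exE conjE) blast+
  then show "x \<in> RR"
  proof cases
    case 1 then show ?thesis using x by (auto simp: RR_def ev_serre_rel)
  next
    case 2
    then have "x = wd [(i, m), (j, p)] - (chi (i, m) (j, p) \<odot> wd [(j, p), (i, m)] + dl (i, m) (j, p) \<odot> 1)"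
      using x by (simp add: chi_def dl_def)
    with 2(1) show ?thesis unfolding RR_def R12_def by fastforce
  next
    case 3
    then have "x = wd [(i, p), (j, p + 1)] - (chi (i, p) (j, p + 1) \<odot> wd [(j, p + 1), (i, p)] + dl (i, p) (j, p + 1) \<odot> 1)"
      using x by (auto simp: chi_def dl_def sgnpow_def alg.scale_left_diff_distrib)
    then show ?thesis unfolding RR_def R12_def by fastforce
  qed
next
  fix x assume "x \<in> RR"
  then consider (1) i j p where "i \<noteq> j" "x = lf p (ser i j)"
    | (2) a b where "snd a < snd b" "x = wd [a, b] - (chi a b \<odot> wd [b, a] + dl a b \<odot> 1)"
    unfolding RR_def R12_def by blast
  then show "x \<in> ev ` rels C d"
  proof cases
    case 1
    then have "x = ev (serre_rel C d i j p)" by (simp add: ev_serre_rel)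
    moreover have "serre_rel C d i j p \<in> rels C d" using 1 unfolding rels_def by blast
    ultimately show ?thesis by blast
  next
    case 2
    obtain i m j p where ab: "a = (i, m)" "b = (j, p)" by fastforce
    show ?thesis
    proof (cases "p = m + 1")
      case True
      have "x = ev ([(1, [(i, m), (j, m + 1)]), (- qi d i (C i j), [(j, m + 1), (i, m)])]
         @ (if i = j then [(- (1 - qi d i 2), [])] else []))"
        using 2 ab True by (auto simp: chi_def dl_def sgnpow_def alg.scale_left_diff_distrib)
      then show ?thesis unfolding rels_def by blast
    next
      case False
      then have "p > m + 1" using 2 ab by simp
      moreover have "x = ev [(1, [(i, m), (j, p)]), (- qi d i (sgnpow (p - m + 1) * C i j), [(j, p), (i, m)])]"
        using 2 ab False by (simp add: chi_def dl_def)
      ultimately show ?thesis unfolding rels_def by blast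
    qed
  qed
qed

lemma cong_eqm: "cong C d a b \<longleftrightarrow> eqm RR (ev a) (ev b)"
  by (simp add: cong_iff ev_rels)

lemma eqm_R12_RR: "eqm R12 x y \<Longrightarrow> eqm RR x y"
  unfolding eqm_def by (rule ideal_mono[of R12]) (auto simp: RR_def)

lemma lf_SR: "x \<in> ideal SR \<Longrightarrow> lf p x \<in> ideal RR"
proof (induction rule: ideal.induct)
  case (gen r u v)
  then have "lf p r \<in> RR" by (auto simp: SR_def RR_def)
  then show ?case unfolding lf_mult lf_simps(1) by (rule ideal.gen)
qed (auto intro: ideal.intros)

section \<open>Insertion operators and the normal form modulo the non-Serre relations\<close>

lemma swap: "snd a < snd b \<Longrightarrow> eqm R12 (wd [a, b]) (chi a b \<odot> wd [b, a] + dl a b \<odot> 1)"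
  unfolding eqm_def by (rule ideal_base) (unfold R12_def, blast)

text \<open>Letters of equal level are never exchanged: each level keeps a word of the free algebra,
  and the Serre relations are left to the form.\<close>

fun insw :: "'i \<times> int \<Rightarrow> ('i \<times> int) list \<Rightarrow> ('i \<times> int) alg" where
  "insw a [] = wd [a]"
| "insw a (b # u) = (if snd b \<le> snd a then wd (a # b # u)
     else chi a b \<odot> (wd [b] * insw a u) + dl a b \<odot> wd u)"

definition T :: "'i \<times> int \<Rightarrow> ('i \<times> int) alg \<Rightarrow> ('i \<times> int) alg" where "T a = lin (insw a)"

lemma T_simps [simp]: "T a (wd u) = insw a u" "T a (x + y) = T a x + T a y" "T a (x - y) = T a x - T a y"
  "T a (c \<odot> x) = c \<odot> T a x" "T a 0 = 0"
  by (simp_all add: T_def)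

lemma T_1 [simp]: "T a 1 = wd [a]"
  using T_simps(1)[of a "[]"] by (simp del: T_simps(1))

fun nfw :: "('i \<times> int) list \<Rightarrow> ('i \<times> int) alg" where
  "nfw [] = 1"
| "nfw (a # u) = T a (nfw u)"

definition nf :: "('i \<times> int) alg \<Rightarrow> ('i \<times> int) alg" where "nf = lin nfw"

lemma nf_simps [simp]: "nf (wd u) = nfw u" "nf (x + y) = nf x + nf y" "nf (x - y) = nf x - nf y"
  "nf (c \<odot> x) = c \<odot> nf x" "nf 0 = 0"
  by (simp_all add: nf_def)

lemma nf_1 [simp]: "nf 1 = 1"
  using nf_simps(1)[of "[]"] by (simp del: nf_simps(1))

lemma lwt_cancel: "dl a b \<noteq> 0 \<Longrightarrow> lwt a l + lwt b l = 0"
  by (auto simp: dl_def lwt_def sgnpow_def split: if_splits)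

text \<open>A contraction removes two letters of opposite weight (\<open>lwt_cancel\<close>), so
  straightening preserves weights and introduces no new level.\<close>

lemma insw_Sp: "insw a u \<in> Sp (\<lambda>w. snd ` set w \<subseteq> insert (snd a) (snd ` set u) \<and>
    wwt w = wwt (a # u) \<and> (ordered u \<longrightarrow> ordered w))"
proof (induction u)
  case Nil show ?case by (simp add: ordered_def)
next
  case (Cons b u)
  show ?case
  proof (cases "snd b \<le> snd a")
    case True then show ?thesis by (auto simp: ordered_Cons)
  next
    case False
    have "wd [b] * insw a u \<in> Sp (\<lambda>w. snd ` set w \<subseteq> insert (snd a) (snd ` set (b # u)) \<and>
       wwt w = wwt (a # b # u) \<and> (ordered (b # u) \<longrightarrow> ordered w))"
      by (rule Sp_mult[OF _ Cons, of _ "\<lambda>w. w = [b]"])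
         (use False in \<open>auto simp: wwt_simps ordered_Cons fun_eq_iff\<close>, fastforce)
    moreover have "dl a b \<odot> wd u \<in> Sp (\<lambda>w. snd ` set w \<subseteq> insert (snd a) (snd ` set (b # u)) \<and>
       wwt w = wwt (a # b # u) \<and> (ordered (b # u) \<longrightarrow> ordered w))"
    proof (cases "dl a b = 0")
      case False
      from lwt_cancel[OF this] have "wwt u = wwt (a # b # u)"
        by (simp add: wwt_simps fun_eq_iff flip: add.assoc)
      then show ?thesis by (intro Sp_sc) (auto simp: ordered_Cons)
    qed simp
    ultimately show ?thesis using False by (auto intro: Sp_add Sp_sc)
  qed
qed

lemma T_ordered: "x \<in> Sp ordered \<Longrightarrow> T a x \<in> Sp ordered"
  unfolding T_def by (erule lin_Sp) (rule Sp_mono_pred[OF insw_Sp], blast)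

lemma nfw_Sp: "nfw u \<in> Sp (\<lambda>w. ordered w \<and> snd ` set w \<subseteq> snd ` set u \<and> wwt w = wwt u)"
proof (induction u)
  case Nil show ?case by (simp flip: wd_Nil)
next
  case (Cons a u)
  show ?case unfolding nfw.simps T_def
    by (rule lin_Sp[OF Cons], rule Sp_mono_pred[OF insw_Sp]) (auto simp: wwt_simps)
qed

lemma nf_Sp: "x \<in> Sp (\<lambda>w. snd ` set w \<subseteq> A \<and> Q (wwt w)) \<Longrightarrow>
    nf x \<in> Sp (\<lambda>w. ordered w \<and> snd ` set w \<subseteq> A \<and> Q (wwt w))"
  unfolding nf_def by (erule lin_Sp, rule Sp_mono_pred[OF nfw_Sp]) (simp, blast)

lemma nf_Sp_ordered: "nf x \<in> Sp ordered"
  using nf_Sp[of x UNIV "\<lambda>_. True"] by (auto simp: Sp_def)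

lemma insw_top: "\<forall>l\<in>set u. snd l \<le> snd a \<Longrightarrow> insw a u = wd (a # u)"
  by (cases u) auto

lemma nfw_ordered: "ordered u \<Longrightarrow> nfw u = wd u"
  by (induction u) (auto simp: ordered_Cons insw_top)

lemma nf_ordered: "x \<in> Sp ordered \<Longrightarrow> nf x = x"
  by (induction rule: Sp_induct) (auto simp: nfw_ordered)

lemma T_Cons_le: "snd c \<le> snd b \<Longrightarrow> T b (wd [c] * x) = wd [b] * (wd [c] * x)"
  by (induction x rule: alg_induct) (simp_all add: distrib_left)

lemma T_Cons_gt: "snd b < snd c \<Longrightarrow> T b (wd [c] * x) = chi b c \<odot> (wd [c] * T b x) + dl b c \<odot> x"
  by (induction x rule: alg_induct)
     (simp_all add: distrib_left alg.scale_right_distrib alg.scale_left_commute mult.commute)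

text \<open>Two letters that can contract have total weight 0, so together they pass any third
  letter without a scalar.\<close>

lemma chi_dl: "dl a b \<noteq> 0 \<Longrightarrow> chi c a * chi c b = 1" "dl a b \<noteq> 0 \<Longrightarrow> chi a c * chi b c = 1"
  by (auto simp: dl_def chi_def sgnpow_def simp flip: qi_add split: if_splits)

text \<open>The overlap check of a diamond lemma in operator form. A first letter above both a and b
  is moved out in front and the induction hypothesis applied; the scalars then agree by
  \<open>chi_dl\<close>.\<close>

lemma T_rel:
  assumes "ordered u" "snd a < snd b"
  shows "T a (T b (wd u)) = chi a b \<odot> T b (T a (wd u)) + dl a b \<odot> wd u"
  using assms(1)
proof (induction u)
  case Nil
  show ?case using assms(2) by simp
next
  case (Cons c u)
  then have u: "ordered u" "\<forall>l\<in>set u. snd l \<le> snd c" by (auto simp: ordered_Cons)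
  have c: "wd (c # u) = wd [c] * wd u" by simp
  show ?case
  proof (cases "snd c \<le> snd b")
    case True
    have e: "T b (wd (c # u)) = wd [b] * wd (c # u)" using True by simp
    have 1: "T a (T b (wd (c # u))) = chi a b \<odot> (wd [b] * T a (wd (c # u))) + dl a b \<odot> wd (c # u)"
      unfolding e by (rule T_Cons_gt[OF assms(2)])
    have "T b (T a (wd (c # u))) = wd [b] * T a (wd (c # u))"
    proof (cases "snd c \<le> snd a")
      case False
      have "insw b u = wd (b # u)" using u True by (intro insw_top) auto
      then show ?thesis using False True T_Cons_le[OF True]
        by (simp add: distrib_left)
    qed (use assms(2) in simp)
    with 1 show ?thesis by simp
  next
    case False
    \<comment> \<open>Here a lies at least two levels below c, so a and c cannot contract.\<close>
    then have bc: "snd b < snd c" and ac: "snd a < snd c" and d0: "dl a c = 0"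
      using assms(2) by (auto simp: dl_def)
    have T1: "T b (wd (c # u)) = chi b c \<odot> (wd [c] * T b (wd u)) + dl b c \<odot> wd u"
      using T_Cons_gt[OF bc, of "wd u"] by simp
    have T2: "T a (wd (c # u)) = chi a c \<odot> (wd [c] * T a (wd u))"
      using T_Cons_gt[OF ac, of "wd u"] d0 by simp
    have A: "T a (T b (wd (c # u))) = (chi b c * chi a c) \<odot> (wd [c] * T a (T b (wd u))) + dl b c \<odot> T a (wd u)"
      unfolding T1 by (simp only: T_simps(2,4) T_Cons_gt[OF ac] d0) simp
    have B: "T b (T a (wd (c # u))) = (chi a c * chi b c) \<odot> (wd [c] * T b (T a (wd u))) + (chi a c * dl b c) \<odot> T a (wd u)"
      unfolding T2 by (simp only: T_simps(2,4) T_Cons_gt[OF bc] alg.scale_right_distrib alg.scale_scale)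
    have e1: "dl b c = chi a b * (chi a c * dl b c)" using chi_dl(1)[of b c a]
      by (cases "dl b c = 0") (auto simp flip: mult.assoc)
    have e2: "chi b c * chi a c * dl a b = dl a b" using chi_dl(2)[of a b c]
      by (cases "dl a b = 0") (auto simp: mult.commute)
    have "T a (T b (wd (c # u))) = (chi b c * chi a c * chi a b) \<odot> (wd [c] * T b (T a (wd u)))
        + (chi b c * chi a c * dl a b) \<odot> (wd [c] * wd u) + dl b c \<odot> T a (wd u)"
      unfolding A Cons.IH[OF u(1)]
      by (simp only: distrib_left alg.scale_right_distrib alg.scale_scale sc_mult_right mult.assoc add.assoc)
    also have "\<dots> = chi a b \<odot> T b (T a (wd (c # u))) + dl a b \<odot> wd (c # u)"
      unfolding B unfolding e2 c alg.scale_right_distrib alg.scale_scale e1[symmetric]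
      by (simp only: ac_simps)
    finally show ?thesis .
  qed
qed

lemma T_rel_Sp:
  assumes "snd a < snd b" "x \<in> Sp ordered"
  shows "T a (T b x) = chi a b \<odot> T b (T a x) + dl a b \<odot> x"
  using assms(2)
proof (induction rule: Sp_induct)
  case (mono u) from T_rel[OF this assms(1)] show ?case .
qed (simp_all add: alg.scale_right_distrib mult.commute)

lemma nf_letter: "nf (wd [a] * x) = T a (nf x)"
  by (induction x rule: alg_induct) (simp_all add: distrib_left)

lemma nf_left_cong: "nf x = nf y \<Longrightarrow> nf (wd u * x) = nf (wd u * y)"
proof (induction u)
  case (Cons a u)
  then show ?case using nf_letter[of a "wd u * x"] nf_letter[of a "wd u * y"] by simp
qed simp

text \<open>Straightening applies one operator \<open>T\<close> per letter, so a relation between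
  letters becomes the identity \<open>T_rel_Sp\<close> between operators on ordered
  elements.\<close>

lemma nf_R12: "x \<in> ideal R12 \<Longrightarrow> nf x = 0"
proof (induction rule: ideal.induct)
  case (gen r u v)
  then obtain a b where ab: "snd a < snd b" "r = wd [a, b] - (chi a b \<odot> wd [b, a] + dl a b \<odot> 1)"
    by (auto simp: R12_def)
  have "nf (r * wd v) = 0"
    using T_rel_Sp[OF ab(1) nf_Sp_ordered[of "wd v"]] by (simp add: ab(2) algebra_simps)
  then show ?case using nf_left_cong[of "r * wd v" 0 u] by (simp add: mult.assoc)
qed auto

lemma eqm_R12_nf: "eqm R12 x y \<Longrightarrow> nf x = nf y"
  using nf_R12[of "x - y"] by (simp add: eqm_def)

lemma eqm_T: "eqm R12 (wd [a] * x) (T a x)"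
proof (induction x rule: alg_induct)
  case (mono u)
  show ?case
  proof (induction u)
    case (Cons b u)
    show ?case
    proof (cases "snd b \<le> snd a")
      case False
      have "eqm R12 (wd [a] * wd (b # u)) (wd [a, b] * wd u)" by simp
      also have "eqm R12 \<dots> ((chi a b \<odot> wd [b, a] + dl a b \<odot> 1) * wd u)"
        using False by (intro eqm_multr swap) simp
      also have "\<dots> = chi a b \<odot> (wd [b] * (wd [a] * wd u)) + dl a b \<odot> wd u"
        by (simp add: distrib_right)
      also have "eqm R12 \<dots> (chi a b \<odot> (wd [b] * T a (wd u)) + dl a b \<odot> wd u)"
        by (intro eqm_add eqm_sc eqm_multl Cons.IH) simp
      also have "\<dots> = T a (wd (b # u))" using False by simp
      finally show ?thesis .
    qed simp
  qed simp
qed (simp_all add: distrib_left eqm_add eqm_sc)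

lemma eqm_nf: "eqm R12 x (nf x)"
proof (induction x rule: alg_induct)
  case (mono u)
  show ?case
  proof (induction u)
    case (Cons a u)
    have "wd (a # u) = wd [a] * wd u" by simp
    also have "eqm R12 \<dots> (wd [a] * nf (wd u))" using Cons by (rule eqm_multl)
    also have "eqm R12 \<dots> (T a (nf (wd u)))" by (rule eqm_T)
    finally show ?case by simp
  qed simp
qed (simp_all add: eqm_add eqm_sc)

subsection \<open>Commutation past the four blocks\<close>

definition Pw :: "'i \<Rightarrow> ('i \<times> int) list \<Rightarrow> int" where "Pw i u = pair C i (wwt u)"

lemma pair_add: "pair C i (\<lambda>l. f l + g l) = pair C i f + pair C i g"
  by (simp add: pair_def distrib_left sum.distrib)

lemma pair_lwt: "pair C i (lwt b) = sgnpow (snd b + 1) * C i (fst b)"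
  by (simp add: pair_def lwt_def if_distrib cong: if_cong)

lemma Pw_simps [simp]: "Pw i [] = 0" "Pw i (b # u) = sgnpow (snd b + 1) * C i (fst b) + Pw i u"
  "Pw i (u @ v) = Pw i u + Pw i v"
  unfolding Pw_def wwt_simps pair_add pair_lwt by (simp_all add: pair_def)

lemma Pw_lift: "Pw i (map (\<lambda>j. (j, k)) u) = sgnpow (k + 1) * N i u"
  by (induction u) (auto simp: algebra_simps)

lemma Pw_mset: "mset u = mset v \<Longrightarrow> Pw i u = Pw i v"
proof -
  have "Pw i u = (\<Sum>b\<in>#mset u. sgnpow (snd b + 1) * C i (fst b))" for u
    by (induction u) auto
  then show "mset u = mset v \<Longrightarrow> Pw i u = Pw i v" by simp
qed

text \<open>Splitting the sign as (-1)^k times the sign of the weight of b turns the scalar into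
  q_i^{(-1)^k <h_i, wt(b)>}, the source of the exponents in (i) and (ii).\<close>

lemma chi_left: "chi (i, k) b = qi d i (sgnpow k * (sgnpow (snd b + 1) * C i (fst b)))"
proof -
  have "sgnpow (snd b - k + 1) = sgnpow k * sgnpow (snd b + 1)" by (auto simp: sgnpow_def)
  then show ?thesis by (simp add: chi_def mult.assoc)
qed

lemma chi_right: "chi b (i, k + 1) = qi d i (sgnpow (k + 1) * (sgnpow (snd b + 1) * C i (fst b)))"
proof -
  have "sgnpow (k + 1 - snd b + 1) = sgnpow (k + 1) * sgnpow (snd b + 1)" by (auto simp: sgnpow_def)
  then show ?thesis by (simp add: chi_def qi_sym[of "fst b" _ i] flip: mult.assoc)
qed

lemma swap_eq: "snd a + 1 < snd b \<Longrightarrow> eqm R12 (wd [a, b]) (chi a b \<odot> wd [b, a])"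
  using swap[of a b] by (simp add: dl_def)

lemma comm_left_high:
  assumes "x \<in> Sp (\<lambda>u. (\<forall>l\<in>set u. k + 1 < snd l) \<and> Pw i u = p)"
  shows "eqm R12 (wd [(i, k)] * x) (qi d i (sgnpow k * p) \<odot> (x * wd [(i, k)]))"
  using assms
proof (induction rule: Sp_induct)
  case (mono u)
  then have "\<forall>l\<in>set u. k + 1 < snd l" "p = Pw i u" by auto
  then show ?case
  proof (induction u arbitrary: p)
    case (Cons b u)
    have IH: "eqm R12 (wd [(i, k)] * wd u) (qi d i (sgnpow k * Pw i u) \<odot> (wd u * wd [(i, k)]))"
      using Cons by auto
    have "wd [(i, k)] * wd (b # u) = wd [(i, k), b] * wd u" by simp
    also have "eqm R12 \<dots> ((chi (i, k) b \<odot> wd [b, (i, k)]) * wd u)"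
      using Cons.prems by (intro eqm_multr swap_eq) auto
    also have "\<dots> = chi (i, k) b \<odot> (wd [b] * (wd [(i, k)] * wd u))" by simp
    also have "eqm R12 \<dots> (chi (i, k) b \<odot> (wd [b] * (qi d i (sgnpow k * Pw i u) \<odot> (wd u * wd [(i, k)]))))"
      by (intro eqm_sc eqm_multl IH)
    also have "\<dots> = qi d i (sgnpow k * p) \<odot> (wd (b # u) * wd [(i, k)])"
      unfolding Cons.prems(2) chi_left Pw_simps distrib_left qi_add by simp
    finally show ?case .
  qed simp
next
  case (sc c x)
  from eqm_sc[OF sc, of c] show ?case by (simp add: mult.commute)
qed (simp_all add: distrib_left distrib_right alg.scale_right_distrib eqm_add)

lemma comm_right_low:
  assumes "x \<in> Sp (\<lambda>u. (\<forall>l\<in>set u. snd l < k) \<and> Pw i u = p)"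
  shows "eqm R12 (x * wd [(i, k + 1)]) (qi d i (sgnpow (k + 1) * p) \<odot> (wd [(i, k + 1)] * x))"
  using assms
proof (induction rule: Sp_induct)
  case (mono u)
  then have "\<forall>l\<in>set u. snd l < k" "p = Pw i u" by auto
  then show ?case
  proof (induction u arbitrary: p)
    case (Cons b u)
    let ?f = "wd [(i, k + 1)]"
    have IH: "eqm R12 (wd u * ?f) (qi d i (sgnpow (k + 1) * Pw i u) \<odot> (?f * wd u))"
      using Cons by auto
    have "wd (b # u) * ?f = wd [b] * (wd u * ?f)" by simp
    also have "eqm R12 \<dots> (wd [b] * (qi d i (sgnpow (k + 1) * Pw i u) \<odot> (?f * wd u)))"
      by (intro eqm_multl IH)
    also have "\<dots> = qi d i (sgnpow (k + 1) * Pw i u) \<odot> (wd [b, (i, k + 1)] * wd u)" by simp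
    also have "eqm R12 \<dots> (qi d i (sgnpow (k + 1) * Pw i u) \<odot> ((chi b (i, k + 1) \<odot> wd [(i, k + 1), b]) * wd u))"
      using Cons.prems by (intro eqm_sc eqm_multr swap_eq) auto
    also have "\<dots> = qi d i (sgnpow (k + 1) * p) \<odot> (?f * wd (b # u))"
      using Cons.prems by (simp only: chi_right Cons.prems(2) Pw_simps distrib_left qi_add) (simp add: mult.commute)
    finally show ?case .
  qed simp
next
  case (sc c x)
  from eqm_sc[OF sc, of c] show ?case by (simp add: mult.commute)
qed (simp_all add: distrib_left distrib_right alg.scale_right_distrib eqm_add)

text \<open>For inhomogeneous x the scalar varies from word to word; \<open>tw\<close> collects
  it.\<close>

lemma comm_level_high:
  assumes "p + 1 < q"
  shows "eqm R12 (lf p x * wd [(l, q)]) (wd [(l, q)] * lf p (tw l (sgnpow (q - p + 1)) x))"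
proof (induction x rule: alg_induct)
  case (mono u)
  let ?s = "sgnpow (q - p + 1)" and ?f = "wd [(l, q)]"
  show ?case
  proof (induction u)
    case (Cons j u)
    have c: "chi (j, p) (l, q) = qi d l (?s * C l j)" unfolding chi_def by (simp only: fst_conv snd_conv qi_sym[of j _ l])
    have "lf p (wd (j # u)) * ?f = wd [(j, p)] * (lf p (wd u) * ?f)" by simp
    also have "eqm R12 \<dots> (wd [(j, p)] * (?f * lf p (tw l ?s (wd u))))"
      by (intro eqm_multl Cons.IH)
    also have "\<dots> = wd [(j, p), (l, q)] * lf p (tw l ?s (wd u))" by simp
    also have "eqm R12 \<dots> ((chi (j, p) (l, q) \<odot> wd [(l, q), (j, p)]) * lf p (tw l ?s (wd u)))"
      using assms by (intro eqm_multr swap_eq) auto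
    also have "\<dots> = ?f * lf p (tw l ?s (wd (j # u)))"
      unfolding c tw_simps N_simps distrib_left qi_add by (simp add: mult.commute)
    finally show ?case .
  qed simp
qed (simp_all add: distrib_left distrib_right eqm_add eqm_sc)

definition Q :: "'i \<Rightarrow> K" where "Q i = qi d i (- 1) - qi d i 1"

lemma Q_eqs: "qi d i (- 1) * Q i * qi d i 2 = 1 - qi d i 2" "qi d i 1 * Q i = 1 - qi d i 2"
  by (simp_all add: Q_def algebra_simps flip: qi_add)

text \<open>Contracting f_{i,k} with a letter i of y costs 1 - q_i^2 and q_i^{c_ij} for each letter
  j passed before. In e*_i after the full twist, the factors of the later letters cancel, leaving
  the same product with q_i^2 in place of 1 - q_i^2; hence the constant q_i^{-2} - 1.\<close>

lemma comm_left_next: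
  "eqm R12 (wd [(i, k)] * lf (k + 1) y)
     (lf (k + 1) (tw i 1 y) * wd [(i, k)] + (qi d i (- 1) * Q i) \<odot> lf (k + 1) (es i (tw i 1 y)))"
proof (induction y rule: alg_induct)
  case (mono u)
  let ?l = "lf (k + 1)" and ?f = "wd [(i, k)]" and ?q = "qi d i (- 1) * Q i"
  show ?case
  proof (induction u)
    case (Cons j u)
    let ?a = "wd [(j, k + 1)]"
    have c: "chi (i, k) (j, k + 1) = qi d i (C i j)" by (simp add: chi_def sgnpow_def)
    have d: "dl (i, k) (j, k + 1) \<odot> ?l (wd u) = (if j = i then (1 - qi d i 2) \<odot> ?l (wd u) else 0)"
      by (simp add: dl_def)
    have qs: "?q * (qi d i (C i j + N i u) * qi d i (- N i u)) = 1 - qi d i 2" if "j = i"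
      using that Q_eqs(1)[of i] by (simp flip: qi_add)
    have "?f * ?l (wd (j # u)) = wd [(i, k), (j, k + 1)] * ?l (wd u)" by simp
    also have "eqm R12 \<dots> ((chi (i, k) (j, k + 1) \<odot> wd [(j, k + 1), (i, k)] + dl (i, k) (j, k + 1) \<odot> 1) * ?l (wd u))"
      by (intro eqm_multr swap) auto
    also have "\<dots> = qi d i (C i j) \<odot> (?a * (?f * ?l (wd u))) + dl (i, k) (j, k + 1) \<odot> ?l (wd u)"
      by (simp add: c distrib_right)
    also have "eqm R12 \<dots> (qi d i (C i j) \<odot> (?a * (?l (tw i 1 (wd u)) * ?f + ?q \<odot> ?l (es i (tw i 1 (wd u)))))
        + dl (i, k) (j, k + 1) \<odot> ?l (wd u))"
      by (intro eqm_add eqm_sc eqm_multl Cons.IH eqm_refl)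
    also have "\<dots> = ?l (tw i 1 (wd (j # u))) * ?f + ?q \<odot> ?l (es i (tw i 1 (wd (j # u))))"
      unfolding d tw_simps es_simps es_Cons using qs
      by (auto simp: distrib_left lf_mult alg.scale_right_distrib qi_add mult.commute mult.left_commute mult.assoc)
    finally show ?case .
  qed simp
next
  case (add x y)
  from eqm_add[OF add] show ?case by (simp add: distrib_left distrib_right alg.scale_right_distrib algebra_simps)
next
  case (sc c x)
  from eqm_sc[OF sc, of c] show ?case by (simp add: alg.scale_right_distrib mult.commute)
qed

text \<open>The mirror image: f_{i,k+1} passes the letters on the right of the contracted one, while
  e'_i cancels the twist of those on its left.\<close>

lemma comm_right_next:
  "eqm R12 (lf k z * wd [(i, k + 1)])
     (wd [(i, k + 1)] * lf k (tw i 1 z) + (qi d i (- 1) * Q i) \<odot> lf k (ep i (tw i 1 z)))"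
proof (induction z rule: alg_induct)
  case (mono u)
  let ?l = "lf k" and ?f = "wd [(i, k + 1)]" and ?q = "qi d i (- 1) * Q i"
  show ?case
  proof (induction u)
    case (Cons j u)
    let ?a = "wd [(j, k)]"
    have c: "chi (j, k) (i, k + 1) = qi d i (C i j)"
      using qi_sym[of j 1 i] by (simp add: chi_def sgnpow_def)
    have d: "dl (j, k) (i, k + 1) \<odot> ?l (tw i 1 (wd u)) = (if j = i then (1 - qi d i 2) \<odot> ?l (tw i 1 (wd u)) else 0)"
      by (simp add: dl_def)
    have qs: "?q * qi d i (C i j + N i u) = (1 - qi d i 2) * qi d i (N i u)" if "j = i"
      unfolding Q_eqs(1)[symmetric] using that by (simp add: qi_add)
    have qe: "?q * (qi d i (C i j + N i u) * qi d i (- C i j)) = ?q * qi d i (N i u)"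
      by (simp flip: qi_add)
    have "?l (wd (j # u)) * ?f = ?a * (?l (wd u) * ?f)" by simp
    also have "eqm R12 \<dots> (?a * (?f * ?l (tw i 1 (wd u)) + ?q \<odot> ?l (ep i (tw i 1 (wd u)))))"
      by (intro eqm_multl Cons.IH)
    also have "\<dots> = wd [(j, k), (i, k + 1)] * ?l (tw i 1 (wd u)) + ?q \<odot> (?a * ?l (ep i (tw i 1 (wd u))))"
      by (simp add: distrib_left)
    also have "eqm R12 \<dots> ((chi (j, k) (i, k + 1) \<odot> wd [(i, k + 1), (j, k)] + dl (j, k) (i, k + 1) \<odot> 1) * ?l (tw i 1 (wd u))
        + ?q \<odot> (?a * ?l (ep i (tw i 1 (wd u)))))"
      by (intro eqm_add eqm_multr swap eqm_refl) auto
    also have "\<dots> = ?f * ?l (tw i 1 (wd (j # u))) + ?q \<odot> ?l (ep i (tw i 1 (wd (j # u))))"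
    proof -
      have 1: "(chi (j, k) (i, k + 1) \<odot> wd [(i, k + 1), (j, k)]) * ?l (tw i 1 (wd u)) = ?f * ?l (tw i 1 (wd (j # u)))"
        by (simp add: c qi_add mult.commute)
      have 2: "?q \<odot> ?l (ep i (tw i 1 (wd (j # u)))) =
          (?q * qi d i (C i j + N i u)) \<odot> (if j = i then ?l (wd u) else 0)
          + (?q * (qi d i (C i j + N i u) * qi d i (- C i j))) \<odot> (?a * ?l (ep i (wd u)))"
        by (simp add: ep_Cons lf_mult alg.scale_right_distrib mult.assoc)
      have 3: "?q \<odot> (?a * ?l (ep i (tw i 1 (wd u)))) = (?q * qi d i (N i u)) \<odot> (?a * ?l (ep i (wd u)))"
        by simp
      have 4: "(?q * qi d i (C i j + N i u)) \<odot> (if j = i then ?l (wd u) else 0) = dl (j, k) (i, k + 1) \<odot> ?l (tw i 1 (wd u))"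
        unfolding d using qs by simp
      show ?thesis unfolding 2 3 4 qe distrib_right 1 by (simp only: sc_mult_left mult_1_left ac_simps)
    qed
    finally show ?case .
  qed simp
next
  case (add x y)
  from eqm_add[OF add] show ?case by (simp add: distrib_left distrib_right alg.scale_right_distrib algebra_simps)
next
  case (sc c x)
  from eqm_sc[OF sc, of c] show ?case by (simp add: alg.scale_right_distrib mult.commute)
qed

abbreviation X4 :: "int \<Rightarrow> ('i \<times> int) alg \<Rightarrow> 'i alg \<Rightarrow> 'i alg \<Rightarrow> ('i \<times> int) alg \<Rightarrow> ('i \<times> int) alg" where
  "X4 k x y z w \<equiv> x * lf (k + 1) y * lf k z * w"

text \<open>The brackets on the right-hand sides of (i), (iv) and of (ii), (iii), respectively.\<close>

definition G1 where "G1 i k x y z w = Q i \<odot> X4 k x (es i y) z w + qi d i 1 \<odot> X4 k x y (wd [i] * z) w"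
definition G2 where "G2 i k x y z w = Q i \<odot> X4 k x y (ep i z) w + qi d i 1 \<odot> X4 k x (y * wd [i]) z w"

text \<open>Formula (i), already modulo the non-Serre relations; therefore it also computes the
  insertion operator on ordered elements (\<open>T_blocks\<close>).\<close>

lemma left_mult_blocks:
  assumes x: "x \<in> Sp (\<lambda>u. (\<forall>l\<in>set u. k + 1 < snd l) \<and> Pw i u = p)" and y: "y \<in> Sp (\<lambda>u. N i u = n)"
  shows "eqm R12 (wd [(i, k)] * X4 k x y z w) (qi d i (sgnpow k * p + n - 1) \<odot> G1 i k x y z w)"
proof -
  let ?f = "wd [(i, k)]" and ?e = "qi d i (sgnpow k * p)"
  have tw: "tw i 1 y = qi d i n \<odot> y" using tw_eigen[OF y, of 1] by simp
  have "?f * X4 k x y z w = (?f * x) * (lf (k + 1) y * (lf k z * w))" by (simp only: mult.assoc)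
  also have "eqm R12 \<dots> ((?e \<odot> (x * ?f)) * (lf (k + 1) y * (lf k z * w)))"
    by (intro eqm_multr comm_left_high x)
  also have "\<dots> = ?e \<odot> (x * ((?f * lf (k + 1) y) * (lf k z * w)))" by (simp add: mult.assoc)
  also have "eqm R12 \<dots> (?e \<odot> (x * ((lf (k + 1) (tw i 1 y) * ?f + (qi d i (- 1) * Q i) \<odot> lf (k + 1) (es i (tw i 1 y)))
      * (lf k z * w))))"
    by (intro eqm_sc eqm_multl eqm_multr comm_left_next)
  also have "\<dots> = qi d i (sgnpow k * p + n - 1) \<odot> G1 i k x y z w"
  proof -
    have 1: "qi d i (sgnpow k * p + n - 1) = ?e * qi d i n * qi d i (- 1)" by (simp flip: qi_add)
    have 2: "qi d i (- 1) * qi d i 1 = 1" by (simp flip: qi_add)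
    have 3: "?e * qi d i n * qi d i (- 1) * qi d i 1 = ?e * qi d i n" using 2 by (simp add: mult.assoc)
    show ?thesis unfolding G1_def 1 tw
      by (simp add: lf_mult distrib_left distrib_right alg.scale_right_distrib 3 mult.assoc add.commute 2)
  qed
  finally show ?thesis .
qed

text \<open>Formula (iii), likewise modulo the non-Serre relations only.\<close>

lemma right_mult_blocks:
  assumes w: "w \<in> Sp (\<lambda>u. (\<forall>l\<in>set u. snd l < k) \<and> Pw i u = p)" and z: "z \<in> Sp (\<lambda>u. N i u = n)"
  shows "eqm R12 (X4 k x y z w * wd [(i, k + 1)]) (qi d i (n + sgnpow (k + 1) * p - 1) \<odot> G2 i k x y z w)"
proof -
  let ?f = "wd [(i, k + 1)]" and ?e = "qi d i (sgnpow (k + 1) * p)"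
  have tw: "tw i 1 z = qi d i n \<odot> z" using tw_eigen[OF z, of 1] by simp
  have "X4 k x y z w * ?f = x * lf (k + 1) y * (lf k z * (w * ?f))" by (simp only: mult.assoc)
  also have "eqm R12 \<dots> (x * lf (k + 1) y * (lf k z * (?e \<odot> (?f * w))))"
    by (intro eqm_multl comm_right_low w)
  also have "\<dots> = ?e \<odot> (x * lf (k + 1) y * ((lf k z * ?f) * w))" by (simp add: mult.assoc)
  also have "eqm R12 \<dots> (?e \<odot> (x * lf (k + 1) y * ((?f * lf k (tw i 1 z) + (qi d i (- 1) * Q i) \<odot> lf k (ep i (tw i 1 z))) * w)))"
    by (intro eqm_sc eqm_multl eqm_multr comm_right_next)
  also have "\<dots> = qi d i (n + sgnpow (k + 1) * p - 1) \<odot> G2 i k x y z w"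
  proof -
    have 1: "qi d i (n + sgnpow (k + 1) * p - 1) = ?e * qi d i n * qi d i (- 1)" by (simp flip: qi_add)
    have 2: "qi d i (- 1) * qi d i 1 = 1" by (simp flip: qi_add)
    have 3: "?e * qi d i n * qi d i (- 1) * qi d i 1 = ?e * qi d i n" using 2 by (simp add: mult.assoc)
    show ?thesis unfolding G2_def 1 tw
      by (simp add: lf_mult distrib_left distrib_right alg.scale_right_distrib 3 mult.assoc add.commute 2)
  qed
  finally show ?thesis .
qed

end

subsection \<open>The bilinear form on the bosonic extension\<close>

lemma lookup_1_Nil [simp]: "Poly_Mapping.lookup (1 :: 'a alg) [] = 1"
  by (simp add: lookup_one zero_list_def)

lemma blk_simps: "blk k [] = []" "blk k (a # u) = (if snd a = k then fst a # blk k u else blk k u)"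
  "blk k (u @ v) = blk k u @ blk k v"
  by (simp_all add: blk_def)

lemma blk_empty: "k \<notin> snd ` set u \<Longrightarrow> blk k u = []"
  by (auto simp: blk_def filter_empty_conv)

lemma blk_lift: "blk k (map (\<lambda>j. (j, l)) u) = (if k = l then u else [])"
  by (induction u) (auto simp: blk_simps)

lemma count_blk: "count (mset u) (j, k) = count (mset (blk k u)) j"
  by (induction u) (auto simp: blk_simps)

context cartan
begin

lemma kap_nonzero [simp]: "kap d i \<noteq> 0"
  by (simp add: kap_def qi_eq_iff)

lemma Q_nonzero [simp]: "Q i \<noteq> 0"
  by (simp add: Q_def qi_eq_iff)

text \<open>The reason for the normalisation of kappa_i: moving f_i across the form yields the
  coefficient found when straightening.\<close>

lemma kap_gam: "kap d i * kap d i * gam i = Q i"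
proof -
  have "qh ^ d i * qh ^ d i = qi d i 1"
  proof -
    have "2 * int (d i) * 1 = int (d i + d i)" by simp
    then show ?thesis unfolding qi_def by (simp only: power_int_of_nat power_add)
  qed
  moreover have "kap d i * kap d i = (qh ^ d i * qh ^ d i) * Q i * Q i"
    unfolding kap_def Q_def by (simp only: ac_simps)
  ultimately have "kap d i * kap d i = qi d i 1 * Q i * Q i" by simp
  then show ?thesis using Q_eqs(2)[of i] by (simp add: gam_def)
qed

definition kw :: "('i \<times> int) list \<Rightarrow> K" where "kw u = (\<Prod>l\<leftarrow>u. kap d (fst l))"

definition Lv :: "('i \<times> int) list \<Rightarrow> ('i \<times> int) list \<Rightarrow> K" where
  "Lv u v = (\<Prod>k\<in>snd ` set (u @ v). L (wd (blk k u)) (wd (blk k v)))"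

lemma kw_simps [simp]: "kw [] = 1" "kw (a # u) = kap d (fst a) * kw u" "kw (u @ v) = kw u * kw v"
  by (simp_all add: kw_def)

lemma bw_eq: "bw C d u v = kw u * kw v * Lv u v"
  by (simp add: bw_def kw_def Lv_def lus_w_eq L_def)

lemma Lv_superset:
  assumes "finite A" "snd ` set (u @ v) \<subseteq> A"
  shows "Lv u v = (\<Prod>k\<in>A. L (wd (blk k u)) (wd (blk k v)))"
  unfolding Lv_def
proof (rule prod.mono_neutral_left[OF assms], rule ballI)
  fix k assume "k \<in> A - snd ` set (u @ v)"
  then have "blk k u = []" "blk k v = []" by (auto intro!: blk_empty)
  then show "L (wd (blk k u)) (wd (blk k v)) = 1" by (simp add: L_1)
qed

lemma Lv_append:
  assumes "snd ` set (u @ v) \<inter> snd ` set (u' @ v') = {}"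
  shows "Lv (u @ u') (v @ v') = Lv u v * Lv u' v'"
proof -
  let ?A = "snd ` set (u @ v)" and ?B = "snd ` set (u' @ v')"
  have "Lv (u @ u') (v @ v') = (\<Prod>k\<in>?A \<union> ?B. L (wd (blk k (u @ u'))) (wd (blk k (v @ v'))))"
    by (rule Lv_superset) auto
  also have "\<dots> = (\<Prod>k\<in>?A. L (wd (blk k (u @ u'))) (wd (blk k (v @ v')))) *
      (\<Prod>k\<in>?B. L (wd (blk k (u @ u'))) (wd (blk k (v @ v'))))"
    by (rule prod.union_disjoint) (use assms in auto)
  also have "(\<Prod>k\<in>?A. L (wd (blk k (u @ u'))) (wd (blk k (v @ v')))) = Lv u v"
    unfolding Lv_def
  proof (rule prod.cong[OF refl])
    fix k assume "k \<in> ?A"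
    then have "k \<notin> ?B" using assms by blast
    then have "blk k u' = []" "blk k v' = []" by (auto intro!: blk_empty)
    then show "L (wd (blk k (u @ u'))) (wd (blk k (v @ v'))) = L (wd (blk k u)) (wd (blk k v))"
      by (simp add: blk_simps)
  qed
  also have "(\<Prod>k\<in>?B. L (wd (blk k (u @ u'))) (wd (blk k (v @ v')))) = Lv u' v'"
    unfolding Lv_def
  proof (rule prod.cong[OF refl])
    fix k assume "k \<in> ?B"
    then have "k \<notin> ?A" using assms by blast
    then have "blk k u = []" "blk k v = []" by (auto intro!: blk_empty)
    then show "L (wd (blk k (u @ u'))) (wd (blk k (v @ v'))) = L (wd (blk k u')) (wd (blk k v'))"
      by (simp add: blk_simps)
  qed
  finally show ?thesis .
qed

text \<open>The blockwise formula on all words, without straightening. It represents the form on the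
  bosonic extension only for ordered arguments, hence is applied there after
  \<open>nf\<close>.\<close>

definition B :: "('i \<times> int) alg \<Rightarrow> ('i \<times> int) alg \<Rightarrow> K" where
  "B x y = linK (\<lambda>u. linK (\<lambda>v. bw C d u v) y) x"

lemma B_wd: "B (wd u) (wd v) = kw u * kw v * Lv u v"
  by (simp add: B_def bw_eq)

lemma B_simps [simp]:
  "B (x + x') y = B x y + B x' y" "B (x - x') y = B x y - B x' y" "B (c \<odot> x) y = c * B x y" "B 0 y = 0"
  by (simp_all add: B_def)

lemma B_sym: "B x y = B y x"
proof (induction x rule: alg_induct)
  case (mono u)
  show ?case
    by (induction y rule: alg_induct)
       (simp_all add: B_def bw_eq Lv_def L_sym[of "wd (blk _ u)"] Un_commute mult.commute mult.left_commute)
next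
  case (add x x')
  have "B y (x + x') = B y x + B y x'" by (induction y rule: alg_induct) (simp_all add: B_def algebra_simps)
  with add show ?case by simp
next
  case (sc c x)
  have "B y (c \<odot> x) = c * B y x" by (induction y rule: alg_induct) (simp_all add: B_def algebra_simps)
  with sc show ?case by simp
qed

lemma B_simps_right [simp]:
  "B x (y + y') = B x y + B x y'" "B x (y - y') = B x y - B x y'" "B x (c \<odot> y) = c * B x y" "B x 0 = 0"
  by (simp_all add: B_sym[of x])

lemma B_sum: "B (sum f A) y = (\<Sum>t\<in>A. B (f t) y)"
  by (induction A rule: infinite_finite_induct) auto

lemma bform_rep_eq: "bform_rep C d a b = B (ev a) (ev b)"
proof -
  have "(\<Sum>(c', v)\<leftarrow>b. c * c' * bw C d u v) = c * B (wd u) (ev b)" for c u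
    by (induction b) (auto simp: B_def algebra_simps)
  then show ?thesis
    unfolding bform_rep_def by (induction a) auto
qed

lemma B_mset: "B (wd u) (wd v) \<noteq> 0 \<Longrightarrow> mset u = mset v"
proof (rule multiset_eqI)
  fix a :: "'i \<times> int" assume "B (wd u) (wd v) \<noteq> 0"
  then have *: "L (wd (blk k u)) (wd (blk k v)) \<noteq> 0" if "k \<in> snd ` set (u @ v)" for k
    using that by (auto simp: B_wd Lv_def)
  obtain j k where a: "a = (j, k)" by fastforce
  show "count (mset u) a = count (mset v) a"
  proof (cases "k \<in> snd ` set (u @ v)")
    case True
    from L_mset[OF *[OF this]] show ?thesis by (simp add: a count_blk)
  next
    case False
    then have "blk k u = []" "blk k v = []" by (auto intro!: blk_empty)
    then show ?thesis by (simp add: a count_blk)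
  qed
qed

lemma B_Pw:
  assumes "x \<in> Sp (\<lambda>u. Pw i u = p)" "y \<in> Sp (\<lambda>u. Pw i u = p')" "p \<noteq> p'"
  shows "B x y = 0"
  using assms(1)
proof (induction rule: Sp_induct)
  case (mono u)
  from assms(2) show ?case
  proof (induction rule: Sp_induct)
    case (mono v)
    show ?case
    proof (rule ccontr)
      assume "B (wd u) (wd v) \<noteq> 0"
      from Pw_mset[OF B_mset[OF this], of i] show False using mono \<open>Pw i u = p\<close> assms(3) by simp
    qed
  qed simp_all
qed auto

abbreviation "lev A \<equiv> \<lambda>u :: ('i \<times> int) list. snd ` set u \<subseteq> A"

lemma B_mult:
  assumes "x \<in> Sp (lev A)" "y \<in> Sp (lev A)" "x' \<in> Sp (lev A')" "y' \<in> Sp (lev A')" "A \<inter> A' = {}"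
  shows "B (x * x') (y * y') = B x y * B x' y'"
proof -
  have 1: "B (wd u * wd u') (wd v * wd v') = B (wd u) (wd v) * B (wd u') (wd v')"
    if "lev A u" "lev A v" "lev A' u'" "lev A' v'" for u v u' v'
  proof -
    have "snd ` set (u @ v) \<subseteq> A" "snd ` set (u' @ v') \<subseteq> A'" using that by (simp_all add: image_Un)
    with assms(5) have "snd ` set (u @ v) \<inter> snd ` set (u' @ v') = {}" by blast
    then show ?thesis by (simp add: B_wd Lv_append)
  qed
  have 2: "B (wd u * wd u') (wd v * y') = B (wd u) (wd v) * B (wd u') y'"
    if "lev A u" "lev A v" "lev A' u'" for u v u'
    using assms(4)
  proof (induction rule: Sp_induct)
    case (mono v') from 1[OF that mono] show ?case .
  qed (simp_all add: distrib_left)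
  have 3: "B (wd u * x') (wd v * y') = B (wd u) (wd v) * B x' y'" if "lev A u" "lev A v" for u v
    using assms(3)
  proof (induction rule: Sp_induct)
    case (mono u') from 2[OF that mono] show ?case .
  qed (simp_all add: distrib_left)
  have 4: "B (wd u * x') (y * y') = B (wd u) y * B x' y'" if "lev A u" for u
    using assms(2)
  proof (induction rule: Sp_induct)
    case (mono v) from 3[OF that mono] show ?case .
  qed (simp_all add: distrib_left distrib_right)
  show ?thesis using assms(1)
  proof (induction rule: Sp_induct)
    case (mono u) from 4[OF mono] show ?case .
  qed (simp_all add: distrib_left distrib_right)
qed

lemma lf_lev: "lf k y \<in> Sp (lev {k})"
  unfolding lf_def by (rule lin_Sp[of _ "\<lambda>_. True"]) (auto simp: Sp_def)

lemma B_blocks: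
  assumes "x \<in> Sp (lev {k + 1<..})" "x' \<in> Sp (lev {k + 1<..})" "w \<in> Sp (lev {..<k})" "w' \<in> Sp (lev {..<k})"
  shows "B (X4 k x y z w) (X4 k x' y' z' w') =
    B x x' * B (lf (k + 1) y) (lf (k + 1) y') * B (lf k z) (lf k z') * B w w'"
proof -
  have 1: "x * lf (k + 1) y \<in> Sp (lev {k<..})" if "x \<in> Sp (lev {k + 1<..})" for x y
    by (rule Sp_mult[OF that lf_lev]) auto
  have 2: "x * lf (k + 1) y * lf k z \<in> Sp (lev {k..})" if "x \<in> Sp (lev {k + 1<..})" for x y z
    by (rule Sp_mult[OF 1[OF that] lf_lev]) auto
  have "B (X4 k x y z w) (X4 k x' y' z' w') =
      B (x * lf (k + 1) y * lf k z) (x' * lf (k + 1) y' * lf k z') * B w w'"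
    by (rule B_mult[OF 2[OF assms(1)] 2[OF assms(2)] assms(3,4)]) auto
  also have "B (x * lf (k + 1) y * lf k z) (x' * lf (k + 1) y' * lf k z') =
      B (x * lf (k + 1) y) (x' * lf (k + 1) y') * B (lf k z) (lf k z')"
    by (rule B_mult[OF 1[OF assms(1)] 1[OF assms(2)] lf_lev lf_lev]) auto
  also have "B (x * lf (k + 1) y) (x' * lf (k + 1) y') = B x x' * B (lf (k + 1) y) (lf (k + 1) y')"
    by (rule B_mult[OF assms(1,2) lf_lev lf_lev]) auto
  finally show ?thesis by (simp add: mult.assoc)
qed

text \<open>Defined through the multiset, so that words with non-zero pairing have equal factors by
  \<open>L_mset\<close>.\<close>

definition kwi :: "'i list \<Rightarrow> K" where "kwi u = prod_mset (image_mset (kap d) (mset u))"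

lemma kwi_nonzero [simp]: "kwi u \<noteq> 0"
  by (induction u) (auto simp: kwi_def)

lemma kw_lift: "kw (map (\<lambda>j. (j, k)) u) = kwi u"
  by (induction u) (auto simp: kwi_def)

lemma Lv_lift: "Lv (map (\<lambda>j. (j, k)) u) (map (\<lambda>j. (j, k)) v) = L (wd u) (wd v)"
  by (subst Lv_superset[of "{k}"]) (auto simp: blk_lift)

lemma B_lf_wd: "B (lf k y) (lf k (wd v)) = kwi v * kwi v * L y (wd v)"
proof (induction y rule: alg_induct)
  case (mono u)
  show ?case
  proof (cases "L (wd u) (wd v) = 0")
    case True then show ?thesis by (simp add: B_wd Lv_lift)
  next
    case False
    then have "kwi u = kwi v" using L_mset by (simp add: kwi_def)
    then show ?thesis by (simp add: B_wd kw_lift Lv_lift)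
  qed
qed (simp_all add: algebra_simps)

lemma B_lf: "y' \<in> Sp (\<lambda>w. kwi w = c) \<Longrightarrow> B (lf k y) (lf k y') = c * c * L y y'"
  by (induction rule: Sp_induct) (auto simp: B_lf_wd algebra_simps simp del: lf_simps(1))

lemma kwi_add: "mset v = add_mset i (mset w) \<Longrightarrow> kwi w = kwi v / kap d i"
  by (simp add: kwi_def)

text \<open>The letter moved across takes one kappa_i from each argument; with \<open>gam i\<close>
  from Lusztig's form they make up \<open>Q i\<close>.\<close>

lemma B_adj_ep: "B (lf k (wd [i] * z)) (lf k z') = Q i * B (lf k z) (lf k (ep i z'))"
proof (induction z' rule: alg_induct)
  case (mono v)
  have "ep i (wd v) \<in> Sp (\<lambda>w. kwi w = kwi v / kap d i)"
    by (rule Sp_mono_pred[OF ep_Sp]) (rule kwi_add)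
  then have "B (lf k z) (lf k (ep i (wd v))) = (kwi v / kap d i) * (kwi v / kap d i) * L z (ep i (wd v))"
    by (rule B_lf)
  moreover have "B (lf k (wd [i] * z)) (lf k (wd v)) = kwi v * kwi v * (gam i * L z (ep i (wd v)))"
    by (simp only: B_lf_wd L_letter_left)
  ultimately show ?case unfolding kap_gam[of i, symmetric] by (simp del: lf_simps(1))
qed (simp_all add: algebra_simps)

lemma B_adj_es: "B (lf k y) (lf k (y' * wd [i])) = Q i * B (lf k (es i y)) (lf k y')"
proof -
  have "B (lf k (y' * wd [i])) (lf k y) = Q i * B (lf k y') (lf k (es i y))"
  proof (induction y rule: alg_induct)
    case (mono v)
    have "es i (wd v) \<in> Sp (\<lambda>w. kwi w = kwi v / kap d i)"
      by (rule Sp_mono_pred[OF es_Sp]) (rule kwi_add)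
    then have "B (lf k y') (lf k (es i (wd v))) = (kwi v / kap d i) * (kwi v / kap d i) * L y' (es i (wd v))"
      by (rule B_lf)
    moreover have "B (lf k (y' * wd [i])) (lf k (wd v)) = kwi v * kwi v * (gam i * L y' (es i (wd v)))"
      by (simp only: B_lf_wd L_letter_right)
    ultimately show ?case unfolding kap_gam[of i, symmetric] by (simp del: lf_simps(1))
  qed (simp_all add: algebra_simps)
  then show ?thesis by (simp only: B_sym)
qed

text \<open>\<open>hb i k x y z w p n m r\<close> collects the homogeneity of the four blocks; only the pairings of their
  weights with \<open>h\<^sub>i\<close> matter.\<close>

definition hb where
  "hb i k x y z w p n m r \<longleftrightarrow>
    x \<in> Sp (\<lambda>u. lev {k + 1<..} u \<and> Pw i u = p) \<and> y \<in> Sp (\<lambda>u. N i u = n) \<and>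
    z \<in> Sp (\<lambda>u. N i u = m) \<and> w \<in> Sp (\<lambda>u. lev {..<k} u \<and> Pw i u = r)"

lemma hb_D:
  assumes "hb i k x y z w p n m r"
  shows "x \<in> Sp (lev {k + 1<..})" "x \<in> Sp (\<lambda>u. Pw i u = p)" "y \<in> Sp (\<lambda>u. N i u = n)"
    "z \<in> Sp (\<lambda>u. N i u = m)" "w \<in> Sp (lev {..<k})" "w \<in> Sp (\<lambda>u. Pw i u = r)"
  using assms unfolding hb_def by (blast intro: Sp_mono_pred)+

lemma Sp_lf_Pw: "y \<in> Sp (\<lambda>u. N i u = n) \<Longrightarrow> lf k y \<in> Sp (\<lambda>u. Pw i u = sgnpow (k + 1) * n)"
  unfolding lf_def by (erule lin_Sp) (simp add: Pw_lift)

lemma B_lf_N: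
  assumes "y \<in> Sp (\<lambda>u. N i u = n)" "y' \<in> Sp (\<lambda>u. N i u = n')" "n \<noteq> n'"
  shows "B (lf k y) (lf k y') = 0"
proof (rule B_Pw[OF Sp_lf_Pw Sp_lf_Pw])
  show "sgnpow (k + 1) * n \<noteq> sgnpow (k + 1) * n'" using assms(3) by (simp add: sgnpow_def)
qed (use assms in auto)

lemma ep_N: "z \<in> Sp (\<lambda>u. N i u = n) \<Longrightarrow> ep i z \<in> Sp (\<lambda>u. N i u = n - 2)"
proof (induction rule: Sp_induct)
  case (mono u)
  show ?case by (rule Sp_mono_pred[OF ep_Sp]) (use mono N_mset_eq[of u i _ i] in auto)
qed (auto intro: Sp_add Sp_sc)

text \<open>By adjunction both brackets expand into the same two pairings \<open>t1\<close> and
  \<open>t2\<close>, and the two expansions differ by a factor q_i on one of them. Each pairing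
  vanishes unless the weights of the blocks match, and the match turns the prefactors into each
  other.\<close>

lemma B_adjoint:
  assumes X: "hb i k x y z w p n m r" and X': "hb i k x' y' z' w' p' n' m' r'"
  shows "qi d i (sgnpow k * p + n - 1) * B (G1 i k x y z w) (X4 k x' y' z' w') =
      qi d i (sgnpow k * p' + n') * B (X4 k x y z w) (G2 i k x' y' z' w')" (is ?A)
    and "qi d i (m + sgnpow (k + 1) * r) * B (G1 i k x y z w) (X4 k x' y' z' w') =
      qi d i (m' + sgnpow (k + 1) * r' - 1) * B (X4 k x y z w) (G2 i k x' y' z' w')" (is ?B)
proof -
  note lv = hb_D(1)[OF X] hb_D(1)[OF X'] hb_D(5)[OF X] hb_D(5)[OF X']
  define t1 where "t1 = B (X4 k x y z w) (X4 k x' (y' * wd [i]) z' w')"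
  define t2 where "t2 = B (X4 k x y z w) (X4 k x' y' (ep i z') w')"
  have G1: "B (G1 i k x y z w) (X4 k x' y' z' w') = t1 + qi d i 1 * Q i * t2"
    unfolding G1_def t1_def t2_def B_simps
    by (simp only: B_blocks[OF lv] B_adj_ep B_adj_es) (simp add: algebra_simps)
  have G2: "B (X4 k x y z w) (G2 i k x' y' z' w') = Q i * t2 + qi d i 1 * t1"
    unfolding G2_def t1_def t2_def by simp
  have px: "B x x' = 0" if "p \<noteq> p'"
    by (rule B_Pw[OF hb_D(2)[OF X] hb_D(2)[OF X'] that])
  have pw: "B w w' = 0" if "r \<noteq> r'"
    by (rule B_Pw[OF hb_D(6)[OF X] hb_D(6)[OF X'] that])
  have "y' * wd [i] \<in> Sp (\<lambda>u. N i u = n' + 2)"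
    by (rule Sp_mult[OF hb_D(3)[OF X'], of _ "\<lambda>u. u = [i]"]) auto
  then have py: "B (lf (k + 1) y) (lf (k + 1) (y' * wd [i])) = 0" if "n \<noteq> n' + 2"
    using that by (rule B_lf_N[OF hb_D(3)[OF X]])
  have py': "B (lf (k + 1) y) (lf (k + 1) y') = 0" if "n \<noteq> n'"
    using that by (rule B_lf_N[OF hb_D(3)[OF X] hb_D(3)[OF X']])
  have pz: "B (lf k z) (lf k (ep i z')) = 0" if "m \<noteq> m' - 2"
    using that by (rule B_lf_N[OF hb_D(4)[OF X] ep_N[OF hb_D(4)[OF X']]])
  have pz': "B (lf k z) (lf k z') = 0" if "m \<noteq> m'"
    using that by (rule B_lf_N[OF hb_D(4)[OF X] hb_D(4)[OF X']])
  \<comment> \<open>A letter i changes \<open>N i\<close> by c_ii = 2. This shift absorbs the stray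
    q_i together with the -1 in the exponent.\<close>
  have t1: "t1 = 0 \<or> (p = p' \<and> n = n' + 2 \<and> m = m' \<and> r = r')"
    unfolding t1_def B_blocks[OF lv] using px pw py pz' by auto
  have t2: "t2 = 0 \<or> (p = p' \<and> n = n' \<and> m = m' - 2 \<and> r = r')"
    unfolding t2_def B_blocks[OF lv] using px pw py' pz by auto
  have q1: "qi d i (e - 1) * qi d i 1 = qi d i e" for e by (simp flip: qi_add)
  have a1: "qi d i (sgnpow k * p + n - 1) * t1 = qi d i (sgnpow k * p' + n') * (qi d i 1 * t1)"
    using t1 by (auto simp: add.commute simp flip: mult.assoc qi_add)
  have a2: "qi d i (sgnpow k * p + n - 1) * (qi d i 1 * Q i * t2) = qi d i (sgnpow k * p' + n') * (Q i * t2)"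
    using t2 by (auto simp add: q1 simp flip: mult.assoc)
  show ?A unfolding G1 G2 distrib_left a1 a2 by simp
  have b1: "qi d i (m + sgnpow (k + 1) * r) * t1 = qi d i (m' + sgnpow (k + 1) * r' - 1) * (qi d i 1 * t1)"
    using t1 by (auto simp add: q1 simp flip: mult.assoc)
  have b2: "qi d i (m + sgnpow (k + 1) * r) * (qi d i 1 * Q i * t2) = qi d i (m' + sgnpow (k + 1) * r' - 1) * (Q i * t2)"
    using t2 by (auto simp: add.commute simp flip: mult.assoc qi_add)
  show ?B unfolding G1 G2 distrib_left b1 b2 by simp
qed

lemma ordered_blocks:
  assumes "ordered u"
  obtains x y z w where "u = x @ map (\<lambda>j. (j, k + 1)) y @ map (\<lambda>j. (j, k)) z @ w"
    "lev {k + 1<..} x" "lev {..<k} w" "ordered x" "ordered w"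
proof -
  have "\<exists>x y z w. u = x @ map (\<lambda>j. (j, k + 1)) y @ map (\<lambda>j. (j, k)) z @ w \<and>
    lev {k + 1<..} x \<and> lev {..<k} w \<and> ordered x \<and> ordered w"
    using assms
  proof (induction u)
    case Nil show ?case by (intro exI[of _ "[]"]) simp
  next
    case (Cons a u)
    then obtain x y z w where u: "u = x @ map (\<lambda>j. (j, k + 1)) y @ map (\<lambda>j. (j, k)) z @ w"
      "lev {k + 1<..} x" "lev {..<k} w" "ordered x" "ordered w" by (auto simp: ordered_Cons)
    have le: "\<forall>l\<in>set u. snd l \<le> snd a" using Cons.prems by (simp add: ordered_Cons)
    consider "snd a > k + 1" | "snd a = k + 1" | "snd a = k" | "snd a < k" by linarith
    then show ?case
    proof cases
      case 1
      then show ?thesis using u le by (intro exI[of _ "a # x"] exI[of _ y] exI[of _ z] exI[of _ w]) (auto simp: ordered_Cons)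
    next
      case 2
      then have "x = []" using u le by (cases x) auto
      then show ?thesis using u 2
        by (intro exI[of _ "[]"] exI[of _ "fst a # y"] exI[of _ z] exI[of _ w]) (auto simp: prod_eq_iff)
    next
      case 3
      then have "x = []" "y = []" using u le by (cases x; cases y; auto)+
      then show ?thesis using u 3
        by (intro exI[of _ "[]"] exI[of _ "fst a # z"] exI[of _ w]) (auto simp: prod_eq_iff)
    next
      case 4
      then have "x = []" "y = []" "z = []" using u le by (cases x; cases y; cases z; auto)+
      then show ?thesis using u 4 Cons.prems
        by (intro exI[of _ "[]"] exI[of _ "a # w"]) auto
    qed
  qed
  then show ?thesis by (elim exE conjE) (rule that; assumption)
qed

lemma X4_ordered:
  assumes "x \<in> Sp (\<lambda>u. ordered u \<and> lev {k + 1<..} u)" "w \<in> Sp (\<lambda>u. ordered u \<and> lev {..<k} u)"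
  shows "X4 k x y z w \<in> Sp ordered"
proof -
  have o: "ordered (map (\<lambda>j. (j, l)) u)" for u :: "'i list" and l
    by (induction u) (auto simp: ordered_Cons)
  have l: "lf l y \<in> Sp (\<lambda>u. ordered u \<and> lev {l} u)" for l y
    unfolding lf_def by (rule lin_Sp[of _ "\<lambda>_. True"]) (auto simp: o, simp add: Sp_def)
  have 1: "x * lf (k + 1) y \<in> Sp (\<lambda>u. ordered u \<and> lev {k + 1..} u)"
    by (rule Sp_mult[OF assms(1) l]) (force simp: ordered_append)
  have 2: "x * lf (k + 1) y * lf k z \<in> Sp (\<lambda>u. ordered u \<and> lev {k..} u)"
    by (rule Sp_mult[OF 1 l]) (force simp: ordered_append)
  show ?thesis
    by (rule Sp_mult[OF 2 assms(2)]) (force simp: ordered_append)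
qed

lemma G_ordered:
  assumes "x \<in> Sp (\<lambda>u. ordered u \<and> lev {k + 1<..} u)" "w \<in> Sp (\<lambda>u. ordered u \<and> lev {..<k} u)"
  shows "G1 i k x y z w \<in> Sp ordered" "G2 i k x y z w \<in> Sp ordered"
  unfolding G1_def G2_def by (intro Sp_add Sp_sc X4_ordered assms)+

lemma T_blocks:
  assumes "hb i k x y z w p n m r"
    and "x \<in> Sp (\<lambda>u. ordered u \<and> lev {k + 1<..} u)" "w \<in> Sp (\<lambda>u. ordered u \<and> lev {..<k} u)"
  shows "T (i, k) (X4 k x y z w) = qi d i (sgnpow k * p + n - 1) \<odot> G1 i k x y z w"
proof -
  have "eqm R12 (wd [(i, k)] * X4 k x y z w) (qi d i (sgnpow k * p + n - 1) \<odot> G1 i k x y z w)"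
    by (rule left_mult_blocks) (use assms(1) in \<open>auto simp: hb_def elim!: Sp_mono_pred\<close>)
  from eqm_R12_nf[OF this] show ?thesis
    using assms(2,3) by (simp add: nf_letter nf_ordered X4_ordered G_ordered)
qed

lemma nf_right_blocks:
  assumes "hb i k x y z w p n m r"
    and "x \<in> Sp (\<lambda>u. ordered u \<and> lev {k + 1<..} u)" "w \<in> Sp (\<lambda>u. ordered u \<and> lev {..<k} u)"
  shows "nf (X4 k x y z w * wd [(i, k + 1)]) = qi d i (m + sgnpow (k + 1) * r - 1) \<odot> G2 i k x y z w"
proof -
  have "eqm R12 (X4 k x y z w * wd [(i, k + 1)]) (qi d i (m + sgnpow (k + 1) * r - 1) \<odot> G2 i k x y z w)"
    by (rule right_mult_blocks) (use assms(1) in \<open>auto simp: hb_def elim!: Sp_mono_pred\<close>)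
  from eqm_R12_nf[OF this] show ?thesis
    using assms(2,3) by (simp add: nf_ordered G_ordered)
qed

lemma ordered_blocks_hb:
  assumes "ordered u"
  obtains x y z w p n m r where "wd u = X4 k x y z w" "hb i k x y z w p n m r"
    "x \<in> Sp (\<lambda>u. ordered u \<and> lev {k + 1<..} u)" "w \<in> Sp (\<lambda>u. ordered u \<and> lev {..<k} u)"
proof -
  obtain x y z w where "u = x @ map (\<lambda>j. (j, k + 1)) y @ map (\<lambda>j. (j, k)) z @ w"
    "lev {k + 1<..} x" "lev {..<k} w" "ordered x" "ordered w"
    using ordered_blocks[OF assms] by metis
  then show ?thesis
    by (intro that[of "wd x" "wd y" "wd z" "wd w" "Pw i x" "N i y" "N i z" "Pw i w"]) (auto simp: hb_def)
qed

section \<open>The radical on ordered words and its comparison with the full ideal\<close>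

definition RadB :: "('i \<times> int) alg set" where
  "RadB = {x \<in> Sp ordered. \<forall>v. ordered v \<longrightarrow> B x (wd v) = 0}"

lemma RadB_right: "x \<in> RadB \<Longrightarrow> y \<in> Sp ordered \<Longrightarrow> B x y = 0"
proof -
  assume x: "x \<in> RadB"
  show "y \<in> Sp ordered \<Longrightarrow> B x y = 0"
    by (induction rule: Sp_induct) (use x in \<open>auto simp: RadB_def\<close>)
qed

lemma RadB_intros: "0 \<in> RadB" "x \<in> RadB \<Longrightarrow> y \<in> RadB \<Longrightarrow> x + y \<in> RadB" "x \<in> RadB \<Longrightarrow> c \<odot> x \<in> RadB"
  by (auto simp: RadB_def intro: Sp_add Sp_sc)

text \<open>On ordered words \<open>T (i, k)\<close> has an adjoint, a multiple of the bracket
  \<open>G2\<close>, whose values are again ordered.\<close>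

lemma T_RadB: assumes x: "x \<in> RadB" shows "T a x \<in> RadB"
proof -
  obtain i k where a: "a = (i, k)" by fastforce
  have "B (T a x) (wd v) = 0" if v: "ordered v" for v
  proof -
    obtain x' y' z' w' p' n' m' r' where X': "wd v = X4 k x' y' z' w'" "hb i k x' y' z' w' p' n' m' r'"
      "x' \<in> Sp (\<lambda>u. ordered u \<and> lev {k + 1<..} u)" "w' \<in> Sp (\<lambda>u. ordered u \<and> lev {..<k} u)"
      by (rule ordered_blocks_hb[OF v])
    let ?G = "qi d i (sgnpow k * p' + n') \<odot> G2 i k x' y' z' w'"
    have "B (T a u) (wd v) = B u ?G" if "u \<in> Sp ordered" for u
      using that
    proof (induction rule: Sp_induct)
      case (mono u)
      obtain x y z w p n m r where X: "wd u = X4 k x y z w" "hb i k x y z w p n m r"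
        "x \<in> Sp (\<lambda>u. ordered u \<and> lev {k + 1<..} u)" "w \<in> Sp (\<lambda>u. ordered u \<and> lev {..<k} u)"
        by (rule ordered_blocks_hb[OF mono])
      show ?case unfolding X(1) X'(1) a T_blocks[OF X(2-4)] B_simps B_simps_right
        by (rule B_adjoint(1)[OF X(2) X'(2)])
    qed (simp_all add: distrib_left)
    then have "B (T a x) (wd v) = B x ?G" using x by (simp add: RadB_def)
    also have "\<dots> = 0" by (intro RadB_right[OF x] Sp_sc G_ordered X')
    finally show ?thesis .
  qed
  then show ?thesis using x T_ordered by (auto simp: RadB_def)
qed

lemma nf_left_RadB: "nf x \<in> RadB \<Longrightarrow> nf (wd u * x) \<in> RadB"
proof (induction u)
  case (Cons a u)
  have "nf (wd (a # u) * x) = T a (nf (wd u * x))" using nf_letter[of a "wd u * x"] by simp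
  with Cons show ?case by (simp add: T_RadB)
qed simp

text \<open>A Serre element is a weight vector, so it q-commutes with distant levels; at the next
  level the correction term is e'_l of it, which is 0.\<close>

lemma ser_comm:
  assumes "i \<noteq> j" "lev {p<..} h"
  shows "\<exists>c. eqm R12 (lf p (ser i j) * wd h) (c \<odot> (wd h * lf p (ser i j)))"
  using assms(2)
proof (induction h)
  case Nil show ?case by (intro exI[of _ 1]) simp
next
  case (Cons b h)
  let ?s = "lf p (ser i j)"
  obtain c where IH: "eqm R12 (?s * wd h) (c \<odot> (wd h * ?s))" using Cons by auto
  obtain l q where b: "b = (l, q)" by fastforce
  have "\<exists>e. eqm R12 (?s * wd [b]) (e \<odot> (wd [b] * ?s))"
  proof (cases "q = p + 1")
    case True
    obtain e where "tw l 1 (ser i j) = e \<odot> ser i j" using tw_ser by blast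
    then show ?thesis using comm_right_next[of p "ser i j" l] True b ser_ep[OF assms(1), of l] by auto
  next
    case False
    then have "p + 1 < q" using Cons.prems b by auto
    moreover obtain e where "tw l (sgnpow (q - p + 1)) (ser i j) = e \<odot> ser i j" using tw_ser by blast
    ultimately show ?thesis using comm_level_high[of p q "ser i j" l] b by auto
  qed
  then obtain e where e: "eqm R12 (?s * wd [b]) (e \<odot> (wd [b] * ?s))" by blast
  have "?s * wd (b # h) = (?s * wd [b]) * wd h" by (simp add: mult.assoc)
  also have "eqm R12 \<dots> ((e \<odot> (wd [b] * ?s)) * wd h)" by (rule eqm_multr[OF e])
  also have "\<dots> = e \<odot> (wd [b] * (?s * wd h))" by (simp add: mult.assoc)
  also have "eqm R12 \<dots> (e \<odot> (wd [b] * (c \<odot> (wd h * ?s))))" by (intro eqm_sc eqm_multl IH)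
  also have "\<dots> = (e * c) \<odot> (wd (b # h) * ?s)" by simp
  finally show ?case by blast
qed

text \<open>The Serre element is moved to the right past all higher letters until it joins the block
  of its own level. There it makes the block radical, and the letters on its left are harmless by
  \<open>nf_left_RadB\<close>.\<close>

lemma nf_ser_RadB: assumes "i \<noteq> j" shows "nf (lf p (ser i j) * wd v) \<in> RadB"
proof -
  let ?s = "lf p (ser i j)"
  have ord: "nf (?s * wd v) \<in> RadB" if v: "ordered v" for v
  proof -
    obtain x y z w where u: "v = x @ map (\<lambda>j. (j, p + 1)) y @ map (\<lambda>j. (j, p)) z @ w"
      "lev {p + 1<..} x" "lev {..<p} w" "ordered x" "ordered w"
      by (rule ordered_blocks[OF v])
    let ?h = "x @ map (\<lambda>j. (j, p + 1)) y" and ?t = "lf p (wd z) * wd w"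
    have "lev {p<..} ?h" using u(2) by auto
    then obtain c where c: "eqm R12 (?s * wd ?h) (c \<odot> (wd ?h * ?s))"
      using ser_comm[OF assms] by blast
    have "?s * wd v = (?s * wd ?h) * ?t" by (simp add: u(1) mult.assoc)
    also have "eqm R12 \<dots> ((c \<odot> (wd ?h * ?s)) * ?t)" by (rule eqm_multr[OF c])
    also have "\<dots> = c \<odot> (wd ?h * (?s * ?t))" by (simp add: mult.assoc)
    finally have e: "nf (?s * wd v) = c \<odot> nf (wd ?h * (?s * ?t))"
      using eqm_R12_nf by fastforce
    have st: "?s * ?t = X4 p 1 1 (ser i j * wd z) (wd w)" by (simp add: lf_mult mult.assoc)
    have o: "X4 p 1 1 (ser i j * wd z) (wd w) \<in> Sp ordered"
      by (rule X4_ordered) (use u in \<open>auto simp flip: wd_Nil\<close>)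
    have rad: "ser i j * wd z \<in> rad"
      unfolding rad_SR using assms by (intro ideal_mult_right ideal_base) (auto simp: SR_def)
    have "B (X4 p 1 1 (ser i j * wd z) (wd w)) (wd v') = 0" if v': "ordered v'" for v'
    proof -
      obtain x' y' z' w' where u': "v' = x' @ map (\<lambda>j. (j, p + 1)) y' @ map (\<lambda>j. (j, p)) z' @ w'"
        "lev {p + 1<..} x'" "lev {..<p} w'" by (rule ordered_blocks[OF v'])
      then have "wd v' = X4 p (wd x') (wd y') (wd z') (wd w')" by simp
      moreover have "B (lf p (ser i j * wd z)) (lf p (wd z')) = 0"
        unfolding B_lf_wd using rad by (simp add: rad_def)
      moreover have "B (X4 p 1 1 (ser i j * wd z) (wd w)) (X4 p (wd x') (wd y') (wd z') (wd w')) =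
          B 1 (wd x') * B (lf (p + 1) 1) (lf (p + 1) (wd y')) * B (lf p (ser i j * wd z)) (lf p (wd z')) * B (wd w) (wd w')"
        by (rule B_blocks) (use u u' in \<open>auto simp flip: wd_Nil\<close>)
      ultimately show ?thesis by simp
    qed
    with o have "?s * ?t \<in> RadB" unfolding st RadB_def by blast
    then have "nf (?s * ?t) \<in> RadB" using nf_ordered by (auto simp: RadB_def)
    then show ?thesis unfolding e by (intro RadB_intros(3) nf_left_RadB)
  qed
  have "nf (?s * x) \<in> RadB" if "x \<in> Sp ordered" for x
    using that by (induction rule: Sp_induct) (auto simp: distrib_left intro: RadB_intros ord)
  \<comment> \<open>An arbitrary right factor is straightened first, reducing to the ordered
    case.\<close>
  moreover have "nf (?s * wd v) = nf (?s * nf (wd v))"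
    by (intro eqm_R12_nf eqm_multl eqm_nf)
  ultimately show ?thesis using nf_Sp_ordered by metis
qed

theorem nf_RR: "x \<in> ideal RR \<Longrightarrow> nf x \<in> RadB"
proof (induction rule: ideal.induct)
  case (gen r u v)
  then consider "r \<in> R12" | p i j where "i \<noteq> j" "r = lf p (ser i j)" by (auto simp: RR_def)
  then show ?case
  proof cases
    case 1
    then have "nf (wd u * r * wd v) = 0" by (intro nf_R12 ideal.gen)
    then show ?thesis by (simp add: RadB_intros)
  next
    case 2
    then show ?thesis using nf_left_RadB[OF nf_ser_RadB[OF 2(1)]] by (simp add: mult.assoc)
  qed
qed (auto intro: RadB_intros)

text \<open>The induction on the number of summands replaces the choice of linearly independent \<open>U t\<close>: if some
  \<open>V s\<close> is not orthogonal to everything, pairing with it makes \<open>U s\<close> dependent on the other \<open>U t\<close>.\<close>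

lemma tensor_nondegenerate:
  assumes "finite A"
    and low: "\<And>x. x \<in> Sp (\<lambda>w. ordered w \<and> lev A w) \<Longrightarrow> (\<And>v. ordered v \<Longrightarrow> lev A v \<Longrightarrow> B x (wd v) = 0) \<Longrightarrow> x \<in> ideal RR"
    and "finite S"
    and "\<And>t. t \<in> S \<Longrightarrow> V t \<in> Sp (\<lambda>w. ordered w \<and> lev A w)"
    and "\<And>u v. ordered v \<Longrightarrow> lev A v \<Longrightarrow> (\<Sum>t\<in>S. B (lf l (U t)) (lf l (wd u)) * B (V t) (wd v)) = 0"
  shows "(\<Sum>t\<in>S. lf l (U t) * V t) \<in> ideal RR"
  using assms(3-)
proof (induction "card S" arbitrary: S V)
  case 0 then show ?case by simp
next
  case (Suc n)
  show ?case
  proof (cases "\<forall>t\<in>S. \<forall>v. ordered v \<longrightarrow> lev A v \<longrightarrow> B (V t) (wd v) = 0")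
    case True
    then show ?thesis using Suc.prems(2) by (intro ideal_sum ideal_mult_left low) auto
  next
    case False
    then obtain s v0 where s: "s \<in> S" "ordered v0" "lev A v0" "B (V s) (wd v0) \<noteq> 0" by blast
    define b where "b t = B (V t) (wd v0) / B (V s) (wd v0)" for t
    have b1: "b s = 1" using s by (simp add: b_def)
    define U0 where "U0 = (\<Sum>t\<in>S. b t \<odot> U t)"
    have BU0: "(\<Sum>t\<in>S. b t * B (lf l (U t)) (lf l (wd u))) = 0" for u
    proof -
      have "(\<Sum>t\<in>S. b t * B (lf l (U t)) (lf l (wd u))) =
          (\<Sum>t\<in>S. B (lf l (U t)) (lf l (wd u)) * B (V t) (wd v0)) / B (V s) (wd v0)"
        by (simp add: b_def sum_divide_distrib mult.commute)
      then show ?thesis using Suc.prems(3)[OF s(2,3)] by simp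
    qed
    have "U0 \<in> rad"
    proof (rule rad_wdI)
      fix u
      have "B (lf l U0) (lf l (wd u)) = 0"
        using BU0[of u] by (simp add: U0_def lf_sum B_sum del: lf_simps(1))
      then show "L U0 (wd u) = 0" unfolding B_lf_wd by simp
    qed
    then have U0: "lf l U0 \<in> ideal RR" by (simp add: rad_SR lf_SR)
    let ?S = "S - {s}" and ?V = "\<lambda>t. V t - b t \<odot> V s"
    have fin: "finite S" "S = insert s ?S" "s \<notin> ?S" using Suc.prems(1) s(1) by auto
    note sum = sum.remove[OF fin(1) s(1)]
    have "(\<Sum>t\<in>?S. lf l (U t) * ?V t) \<in> ideal RR"
    proof (rule Suc.hyps(1))
      show "n = card ?S" using Suc.hyps(2) s(1) by simp
      show "finite ?S" using fin by simp
      show "?V t \<in> Sp (\<lambda>w. ordered w \<and> lev A w)" if "t \<in> ?S" for t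
        using that s(1) by (intro Sp_diff Sp_sc Suc.prems(2)) auto
      fix u v assume v: "ordered v" "lev A v"
      have "(\<Sum>t\<in>?S. B (lf l (U t)) (lf l (wd u)) * B (?V t) (wd v)) =
          (\<Sum>t\<in>?S. B (lf l (U t)) (lf l (wd u)) * B (V t) (wd v)) -
          (\<Sum>t\<in>?S. b t * B (lf l (U t)) (lf l (wd u))) * B (V s) (wd v)"
        unfolding sum_distrib_right sum_subtractf[symmetric] by (rule sum.cong) (simp_all add: algebra_simps)
      also have "(\<Sum>t\<in>?S. B (lf l (U t)) (lf l (wd u)) * B (V t) (wd v)) = - (B (lf l (U s)) (lf l (wd u)) * B (V s) (wd v))"
        using Suc.prems(3)[OF v, of u] unfolding sum[of "\<lambda>t. B (lf l (U t)) (lf l (wd u)) * B (V t) (wd v)"]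
        by (rule minus_unique[symmetric])
      also have "(\<Sum>t\<in>?S. b t * B (lf l (U t)) (lf l (wd u))) = - B (lf l (U s)) (lf l (wd u))"
        using BU0[of u] unfolding sum[of "\<lambda>t. b t * B (lf l (U t)) (lf l (wd u))"] b1 mult_1_left
        by (rule minus_unique[symmetric])
      finally show "(\<Sum>t\<in>?S. B (lf l (U t)) (lf l (wd u)) * B (?V t) (wd v)) = 0" by simp
    qed
    moreover have "(\<Sum>t\<in>S. lf l (U t) * V t) = lf l U0 * V s + (\<Sum>t\<in>?S. lf l (U t) * ?V t)"
    proof -
      have "lf l U0 = lf l (U s) + (\<Sum>t\<in>?S. b t \<odot> lf l (U t))"
        unfolding U0_def sum[of "\<lambda>t. b t \<odot> U t"] by (simp add: b1 lf_sum)
      then show ?thesis unfolding sum[of "\<lambda>t. lf l (U t) * V t"]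
        by (simp add: distrib_right sum_distrib_right right_diff_distrib sum_subtractf)
    qed
    ultimately show ?thesis using ideal_mult_right[OF U0] by (auto intro: ideal.add)
  qed
qed

text \<open>Induction on the set of levels, splitting off the highest level l: an ordered word is
  its l-block followed by an ordered word on lower levels, and the form factors accordingly.\<close>

lemma nondegenerate_levels:
  assumes "finite A"
  shows "x \<in> Sp (\<lambda>w. ordered w \<and> lev A w) \<Longrightarrow> (\<And>v. ordered v \<Longrightarrow> lev A v \<Longrightarrow> B x (wd v) = 0) \<Longrightarrow> x \<in> ideal RR"
  using assms
proof (induction A arbitrary: x rule: finite_linorder_max_induct)
  case empty
  then have x: "x \<in> Sp (\<lambda>w. w = [])" by (auto elim: Sp_mono_pred)
  then have "x = Poly_Mapping.lookup x [] \<odot> 1"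
    by (intro poly_mapping_eqI) (auto simp: Sp_iff lookup_one zero_list_def when_def)
  moreover have "B 1 1 = 1" using B_wd[of "[]" "[]"] by (simp add: Lv_def)
  ultimately have "Poly_Mapping.lookup x [] = 0"
    using empty.prems(2)[of "[]"] B_simps(3)[of "Poly_Mapping.lookup x []" 1 1] by simp
  with x have "x = 0" by (intro poly_mapping_eqI) (auto simp: Sp_iff)
  then show ?case by simp
next
  case (insert l A)
  define V where "V w = filter (\<lambda>b. snd b \<noteq> l) w" for w :: "('i \<times> int) list"
  have split: "w = map (\<lambda>j. (j, l)) (blk l w) @ V w \<and> ordered (V w) \<and> lev A (V w)"
    if "ordered w" "lev (insert l A) w" for w
    using that
  proof (induction w)
    case (Cons b w)
    have IH: "w = map (\<lambda>j. (j, l)) (blk l w) @ V w" "ordered (V w)" "lev A (V w)"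
      using Cons by (auto simp: ordered_Cons)
    show ?case
    proof (cases "snd b = l")
      case True
      then show ?thesis using IH by (simp add: V_def blk_simps prod_eq_iff)
    next
      case False
      then have "snd b \<in> A" "snd b < l" using Cons.prems insert.hyps by auto
      then have "l \<notin> snd ` set w" using Cons.prems by (auto simp: ordered_Cons)
      then have "blk l w = []" by (rule blk_empty)
      moreover from this have "V w = w" using IH(1) by simp
      ultimately show ?thesis using False Cons.prems \<open>snd b \<in> A\<close> IH by (auto simp: V_def blk_simps)
    qed
  qed (simp add: V_def blk_simps)
  let ?S = "Poly_Mapping.keys x"
  let ?U = "\<lambda>t. Poly_Mapping.lookup x t \<odot> wd (blk l t)"
  have S: "ordered t \<and> lev (insert l A) t" if "t \<in> ?S" for t
    using that insert.prems(1) by (simp add: Sp_def)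
  have "x = (\<Sum>t\<in>?S. lf l (?U t) * wd (V t))"
  proof -
    have "wd t = lf l (wd (blk l t)) * wd (V t)" if "t \<in> ?S" for t
      using split[of t] S[OF that] by simp
    then have "(\<Sum>t\<in>?S. Poly_Mapping.lookup x t \<odot> wd t) = (\<Sum>t\<in>?S. lf l (?U t) * wd (V t))"
      by (intro sum.cong) (simp_all del: lf_simps(1) wd_mult)
    then show ?thesis using alg_expand[of x] by simp
  qed
  moreover have "(\<Sum>t\<in>?S. lf l (?U t) * wd (V t)) \<in> ideal RR"
  proof (rule tensor_nondegenerate[OF insert.hyps(1)])
    show "y \<in> ideal RR" if "y \<in> Sp (\<lambda>w. ordered w \<and> lev A w)" "\<And>v. ordered v \<Longrightarrow> lev A v \<Longrightarrow> B y (wd v) = 0" for y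
      using insert.IH that by blast
    show "finite ?S" by simp
    show "wd (V t) \<in> Sp (\<lambda>w. ordered w \<and> lev A w)" if "t \<in> ?S" for t using split[of t] S[OF that] by simp
    fix u v assume v: "ordered v" "lev A v"
    have o: "ordered (map (\<lambda>j. (j, l)) u @ v)"
    proof (induction u)
      case Nil show ?case using v by simp
    next
      case (Cons a u)
      have "\<forall>b\<in>set v. snd b \<le> l" using v insert.hyps(2) by (auto intro: less_imp_le)
      with Cons show ?case by (auto simp: ordered_Cons)
    qed
    have dis: "{l} \<inter> A = {}" using insert.hyps by auto
    have "B (lf l (?U t)) (lf l (wd u)) * B (wd (V t)) (wd v) = B (lf l (?U t) * wd (V t)) (lf l (wd u) * wd v)"
      if "t \<in> ?S" for t
      by (rule B_mult[OF lf_lev lf_lev _ _ dis, symmetric]) (use split[of t] S[OF that] v in auto)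
    then have "(\<Sum>t\<in>?S. B (lf l (?U t)) (lf l (wd u)) * B (wd (V t)) (wd v)) =
        B (\<Sum>t\<in>?S. lf l (?U t) * wd (V t)) (lf l (wd u) * wd v)"
      unfolding B_sum by (rule sum.cong[OF refl])
    also have "\<dots> = B x (wd (map (\<lambda>j. (j, l)) u @ v))"
      using \<open>x = (\<Sum>t\<in>?S. lf l (?U t) * wd (V t))\<close> by simp
    also have "\<dots> = 0" by (rule insert.prems(2)[OF o]) (use v in auto)
    finally show "(\<Sum>t\<in>?S. B (lf l (?U t)) (lf l (wd u)) * B (wd (V t)) (wd v)) = 0" .
  qed
  ultimately show ?case by metis
qed

theorem RadB_RR: assumes "x \<in> RadB" shows "x \<in> ideal RR"
proof (rule nondegenerate_levels)
  let ?A = "\<Union>w\<in>Poly_Mapping.keys x. snd ` set w"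
  show "finite ?A" by simp
  show "x \<in> Sp (\<lambda>w. ordered w \<and> lev ?A w)" using assms by (auto simp: RadB_def Sp_def)
  show "B x (wd v) = 0" if "ordered v" for v using that assms by (simp add: RadB_def)
qed

subsection \<open>Homogeneous representatives and the adjoint operators\<close>

definition pr :: "('i \<Rightarrow> int) \<Rightarrow> ('i \<times> int) alg \<Rightarrow> ('i \<times> int) alg" where
  "pr \<beta> = lin (\<lambda>u. if wwt u = \<beta> then wd u else 0)"

lemma pr_Sp: "x \<in> Sp (\<lambda>w. wwt w = \<gamma>) \<Longrightarrow> pr \<beta> x = (if \<gamma> = \<beta> then x else 0)"
  by (induction rule: Sp_induct) (auto simp: pr_def)

lemma Fi_mset: "x \<in> Sp (\<lambda>w. mset w = \<beta>) \<Longrightarrow> Fi i x \<in> Sp (\<lambda>w. mset w = add_mset i \<beta>)"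
  by (induction rule: Sp_induct) (auto simp: Fi_def[of i "wd _"] intro!: Sp_add Sp_sc Sp_diff)

lemma ser_mset: "\<exists>\<beta>. ser i j \<in> Sp (\<lambda>w. mset w = \<beta>)"
proof -
  have "\<exists>\<beta>. (Fi i ^^ n) (wd [j]) \<in> Sp (\<lambda>w. mset w = \<beta>)" for n
  proof (induction n)
    case 0 show ?case by (auto intro!: exI[of _ "{#j#}"])
  next
    case (Suc n)
    then show ?case using Fi_mset by fastforce
  qed
  then show ?thesis by (simp add: ser_def)
qed

lemma wwt_lift: "wwt (map (\<lambda>j. (j, k)) u) = (\<lambda>l. sgnpow (k + 1) * int (count (mset u) l))"
  by (induction u) (auto simp: wwt_simps lwt_def fun_eq_iff algebra_simps)

lemma RR_homogeneous: "r \<in> RR \<Longrightarrow> \<exists>\<gamma>. r \<in> Sp (\<lambda>w. wwt w = \<gamma>)"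
proof -
  assume "r \<in> RR"
  then consider a b where "r = wd [a, b] - (chi a b \<odot> wd [b, a] + dl a b \<odot> 1)"
    | p i j where "r = lf p (ser i j)" by (auto simp: RR_def R12_def)
  then show ?thesis
  proof cases
    case 1
    have d: "dl a b \<odot> wd [] \<in> Sp (\<lambda>w. wwt w = wwt [a, b])"
    proof (cases "dl a b = 0")
      case False
      then show ?thesis using lwt_cancel[OF False]
        by (intro Sp_sc) (simp add: wwt_simps fun_eq_iff del: wd_Nil)
    qed simp
    then have "r \<in> Sp (\<lambda>w. wwt w = wwt [a, b])"
      using Sp_sc[of "wd [b, a]" "\<lambda>w. wwt w = wwt [a, b]" "chi a b"] d unfolding 1
      by (auto intro!: Sp_diff Sp_add simp: wwt_simps add.commute)
    then show ?thesis by blast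
  next
    case 2
    obtain \<beta> where "ser i j \<in> Sp (\<lambda>w. mset w = \<beta>)" using ser_mset by blast
    then have "r \<in> Sp (\<lambda>w. wwt w = (\<lambda>l. sgnpow (p + 1) * int (count \<beta> l)))"
      unfolding 2 lf_def by (rule lin_Sp) (simp add: wwt_lift)
    then show ?thesis by blast
  qed
qed

lemma pr_RR: "x \<in> ideal RR \<Longrightarrow> pr \<beta> x \<in> ideal RR"
proof (induction rule: ideal.induct)
  case (gen r u v)
  obtain \<gamma> where \<gamma>: "r \<in> Sp (\<lambda>w. wwt w = \<gamma>)" using RR_homogeneous[OF gen] by blast
  have "wd u * r \<in> Sp (\<lambda>w. wwt w = (\<lambda>l. wwt u l + \<gamma> l))"
    by (rule Sp_mult[OF _ \<gamma>, of _ "\<lambda>w. w = u"]) (auto simp: wwt_simps)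
  then have "wd u * r * wd v \<in> Sp (\<lambda>w. wwt w = (\<lambda>l. wwt u l + \<gamma> l + wwt v l))"
    by (rule Sp_mult[of _ _ _ "\<lambda>w. w = v"]) (auto simp: wwt_simps)
  from pr_Sp[OF this, of \<beta>] show ?case using ideal.gen[OF gen, of u v] by auto
qed (auto simp: pr_def intro: ideal.intros)

text \<open>The hypotheses provide two unrelated representatives, one on the levels J and one of
  weight \<beta>. Since the relations are homogeneous, the weight-\<beta> component of the first has
  both properties.\<close>

lemma homogeneous_rep:
  assumes "in_sub C d J x" "homog C d \<beta> x"
  obtains r where "eqm RR (ev x) r" "r \<in> Sp (\<lambda>w. lev J w \<and> wwt w = \<beta>)"
proof -
  obtain s where s: "cong C d x s" "\<forall>(c, u)\<in>set s. \<forall>l\<in>set u. snd l \<in> J"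
    using assms(1) unfolding in_sub_def by blast
  obtain t where t: "cong C d x t" "\<forall>(c, u)\<in>set t. wwt u = \<beta>"
    using assms(2) unfolding homog_def by blast
  have s': "ev s \<in> Sp (lev J)" by (rule ev_Sp) (use s(2) in auto)
  have t': "ev t \<in> Sp (\<lambda>w. wwt w = \<beta>)" by (rule ev_Sp) (use t(2) in auto)
  have "ev t - ev s \<in> ideal RR"
    using eqm_trans[OF eqm_sym] s(1) t(1) unfolding cong_eqm eqm_def[symmetric] by blast
  from pr_RR[OF this, of \<beta>] have "eqm RR (ev t) (pr \<beta> (ev s))"
    using pr_Sp[OF t', of \<beta>] by (simp add: pr_def eqm_def)
  then have "eqm RR (ev x) (pr \<beta> (ev s))" using t(1) eqm_trans cong_eqm by blast
  moreover have "pr \<beta> (ev s) \<in> Sp (\<lambda>w. lev J w \<and> wwt w = \<beta>)"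
    unfolding pr_def by (rule lin_Sp[OF s']) auto
  ultimately show ?thesis by (rule that)
qed

lemma homogeneous_rep_ordered:
  assumes "in_sub C d J x" "homog C d \<beta> x"
  obtains r where "eqm RR (ev x) r" "r \<in> Sp (\<lambda>w. ordered w \<and> lev J w \<and> wwt w = \<beta>)"
proof -
  obtain r where r: "eqm RR (ev x) r" "r \<in> Sp (\<lambda>w. lev J w \<and> wwt w = \<beta>)"
    by (rule homogeneous_rep[OF assms])
  have "eqm RR (ev x) (nf r)" using eqm_trans[OF r(1) eqm_R12_RR[OF eqm_nf]] .
  moreover have "nf r \<in> Sp (\<lambda>w. ordered w \<and> lev J w \<and> wwt w = \<beta>)"
    using nf_Sp[of r J "\<lambda>\<gamma>. \<gamma> = \<beta>"] r(2) by simp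
  ultimately show ?thesis by (rule that)
qed

lemma level_rep:
  assumes "in_sub C d {k} x" "homog C d \<beta> x"
  obtains y where "eqm RR (ev x) (lf k y)" "\<forall>i. y \<in> Sp (\<lambda>u. N i u = sgnpow (k + 1) * pair C i \<beta>)"
proof -
  obtain r where r: "eqm RR (ev x) r" "r \<in> Sp (\<lambda>w. lev {k} w \<and> wwt w = \<beta>)"
    by (rule homogeneous_rep[OF assms])
  define y where "y = lin (\<lambda>w. wd (blk k w)) r"
  have w: "map (\<lambda>j. (j, k)) (blk k w) = w" if "lev {k} w" for w :: "('i \<times> int) list"
    using that by (induction w) (auto simp: blk_simps)
  have "lf k y = r"
    unfolding y_def using r(2) by (induction rule: Sp_induct) (auto simp: w)
  moreover have "y \<in> Sp (\<lambda>u. N i u = sgnpow (k + 1) * pair C i \<beta>)" for i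
    unfolding y_def
  proof (rule lin_Sp[OF r(2)])
    fix u assume u: "lev {k} u \<and> wwt u = \<beta>"
    \<comment> \<open>f_{j,k} has weight (-1)^{k+1} \<alpha>_j whereas \<open>N\<close> counts
      \<alpha>_j; the sign squares to 1.\<close>
    have "Pw i u = sgnpow (k + 1) * N i (blk k u)" using Pw_lift[of i k "blk k u"] w u by simp
    then have "N i (blk k u) = sgnpow (k + 1) * Pw i u" by simp
    then show "wd (blk k u) \<in> Sp (\<lambda>u. N i u = sgnpow (k + 1) * pair C i \<beta>)"
      using u by (simp add: Pw_def)
  qed
  ultimately show ?thesis using that r(1) by blast
qed

text \<open>Injectivity of U_q^- on level k: single-level words are already ordered, so an element
  of the ideal lies in \<open>RadB\<close>, hence in the radical of Lusztig's form.\<close>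

lemma lf_RR: assumes "lf k y \<in> ideal RR" shows "y \<in> ideal SR"
proof -
  have o: "ordered (map (\<lambda>j. (j, k)) u)" for u :: "'i list"
    by (induction u) (auto simp: ordered_Cons)
  have "lf k y \<in> Sp ordered" unfolding lf_def by (rule lin_Sp[of _ "\<lambda>_. True"]) (auto simp: o, simp add: Sp_def)
  then have "lf k y \<in> RadB" using nf_RR[OF assms] by (simp add: nf_ordered)
  then have "B (lf k y) (lf k (wd v)) = 0" for v by (simp add: RadB_def o)
  then have "y \<in> rad" unfolding B_lf_wd by (intro rad_wdI) auto
  then show ?thesis by (simp add: rad_SR)
qed

text \<open>The value chosen in \<open>ep_hat\<close> or \<open>es_hat\<close> comes from an unknown
  representative. Any two differ by the Serre ideal (\<open>lf_RR\<close>), which the derivations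
  preserve.\<close>

lemma hat_rep:
  assumes "in_sub C d {k} z" "eqm RR (ev z) (lf k y)"
  shows "eqm RR (ev (ep_hat C d i k z)) (lf k (ep i y))" "eqm RR (ev (es_hat C d i k z)) (lf k (es i y))"
proof -
  have ex: "\<exists>r. cong C d z r \<and> at_level k r"
    using assms(1) unfolding in_sub_def at_level_def by simp
  have uniq: "y - ev (unlift r) \<in> ideal SR" if "cong C d z r" "at_level k r" for r
  proof -
    have "eqm RR (lf k y) (ev r)" using that(1) assms(2) eqm_sym eqm_trans unfolding cong_eqm by blast
    then have "lf k (y - ev (unlift r)) \<in> ideal RR" by (simp add: eqm_def ev_unlift[OF that(2)])
    then show ?thesis by (rule lf_RR)
  qed
  have "\<exists>r. cong C d z r \<and> at_level k r \<and> ep_hat C d i k z = lift k (flin (ep_w C d i) (unlift r))"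
    unfolding ep_hat_def by (rule someI_ex) (use ex in blast)
  then obtain r where r: "cong C d z r" "at_level k r" "ep_hat C d i k z = lift k (flin (ep_w C d i) (unlift r))" by blast
  then have "ev (ep_hat C d i k z) = lf k (ep i (ev (unlift r)))" by (simp add: ev_lift ev_flin ep_def)
  then show "eqm RR (ev (ep_hat C d i k z)) (lf k (ep i y))"
    using lf_SR[OF ep_SR[OF uniq[OF r(1,2)], of i], of k] by - (rule eqm_sym, simp add: eqm_def)
  have "\<exists>r. cong C d z r \<and> at_level k r \<and> es_hat C d i k z = lift k (flin (es_w C d i) (unlift r))"
    unfolding es_hat_def by (rule someI_ex) (use ex in blast)
  then obtain r where r: "cong C d z r" "at_level k r" "es_hat C d i k z = lift k (flin (es_w C d i) (unlift r))" by blast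
  then have "ev (es_hat C d i k z) = lf k (es i (ev (unlift r)))" by (simp add: ev_lift ev_flin es_def)
  then show "eqm RR (ev (es_hat C d i k z)) (lf k (es i y))"
    using lf_SR[OF es_SR[OF uniq[OF r(1,2)], of i], of k] by - (rule eqm_sym, simp add: eqm_def)
qed

section \<open>The form on the quotient and the operators defined by adjunction\<close>

lemma RadB_cong: "eqm RR x y \<Longrightarrow> v \<in> Sp ordered \<Longrightarrow> B (nf x) v = B (nf y) v"
  using RadB_right[OF nf_RR, of "x - y" v] by (simp add: eqm_def)

lemma ordered_rep:
  obtains a where "cong C d X a" "\<forall>(c, u)\<in>set a. ordered u" "ev a = nf (ev X)"
proof -
  obtain a where a: "ev a = nf (ev X)" "\<And>c u. (c, u) \<in> set a \<Longrightarrow> ordered u"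
    using ev_Sp_surj[OF nf_Sp_ordered] by metis
  then show ?thesis using eqm_R12_RR[OF eqm_nf, of "ev X"] by (intro that[of a]) (auto simp: cong_eqm)
qed

text \<open>Normal forms supply ordered representatives, so the described value exists; by
  \<open>RadB_cong\<close> all ordered representatives give the same one.\<close>

lemma bform_eq: "bform C d X Y = B (nf (ev X)) (nf (ev Y))"
  unfolding bform_def
proof (rule the_equality)
  show *: "\<forall>a b. cong C d X a \<longrightarrow> cong C d Y b \<longrightarrow> (\<forall>(c0, u)\<in>set a. ordered u) \<longrightarrow> (\<forall>(c0, v)\<in>set b. ordered v) \<longrightarrow>
      bform_rep C d a b = B (nf (ev X)) (nf (ev Y))"
  proof (intro allI impI)
    fix a b assume a: "cong C d X a" "\<forall>(c0, u)\<in>set a. ordered u" and b: "cong C d Y b" "\<forall>(c0, v)\<in>set b. ordered v"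
    have o: "ev a \<in> Sp ordered" "ev b \<in> Sp ordered" by (rule ev_Sp, use a(2) b(2) in auto)+
    have "bform_rep C d a b = B (nf (ev a)) (nf (ev b))" using o by (simp add: bform_rep_eq nf_ordered)
    also have "\<dots> = B (nf (ev X)) (nf (ev b))"
      using a(1) by (intro RadB_cong[symmetric] nf_Sp_ordered) (simp add: cong_eqm)
    also have "\<dots> = B (nf (ev X)) (nf (ev Y))"
      unfolding B_sym[of "nf (ev X)"]
      using b(1) by (intro RadB_cong[symmetric] nf_Sp_ordered) (simp add: cong_eqm)
    finally show "bform_rep C d a b = B (nf (ev X)) (nf (ev Y))" .
  qed
  fix c assume c: "\<forall>a b. cong C d X a \<longrightarrow> cong C d Y b \<longrightarrow> (\<forall>(c0, u)\<in>set a. ordered u) \<longrightarrow> (\<forall>(c0, v)\<in>set b. ordered v) \<longrightarrow>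
      bform_rep C d a b = c"
  obtain a where a: "cong C d X a" "\<forall>(c, u)\<in>set a. ordered u" "ev a = nf (ev X)" by (rule ordered_rep)
  obtain b where b: "cong C d Y b" "\<forall>(c, u)\<in>set b. ordered u" "ev b = nf (ev Y)" by (rule ordered_rep)
  have "bform_rep C d a b = c" using c a(1,2) b(1,2) by blast
  then show "c = B (nf (ev X)) (nf (ev Y))" using a(3) b(3) by (simp add: bform_rep_eq)
qed

lemma bform_nondegenerate:
  assumes "\<And>Y. bform C d E Y = bform C d E' Y" shows "cong C d E E'"
proof -
  have "B (nf (ev E) - nf (ev E')) (wd v) = 0" if "ordered v" for v
    using assms[of "[(1, v)]"] that by (simp add: bform_eq nfw_ordered)
  then have "nf (ev E) - nf (ev E') \<in> RadB" by (simp add: RadB_def Sp_diff nf_Sp_ordered)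
  then have "eqm RR (nf (ev E)) (nf (ev E'))" unfolding eqm_def by (rule RadB_RR)
  then show ?thesis unfolding cong_eqm
    using eqm_R12_RR[OF eqm_nf] eqm_sym eqm_trans by meson
qed

text \<open>One element with the adjoint property makes the choice in \<open>Ep\<close> meaningful,
  and non-degeneracy identifies the chosen value with it.\<close>

lemma Ep_cong:
  assumes "\<And>Y. bform C d E Y = bform C d X (fmul (gen (i, k)) Y)" shows "cong C d (Ep C d i k X) E"
proof (rule bform_nondegenerate)
  have "\<forall>Y. bform C d (Ep C d i k X) Y = bform C d X (fmul (gen (i, k)) Y)"
    unfolding Ep_def by (rule someI_ex) (use assms in blast)
  then show "bform C d (Ep C d i k X) Y = bform C d E Y" for Y using assms by simp
qed

lemma Es_cong:
  assumes "\<And>Y. bform C d E Y = bform C d X (fmul Y (gen (i, k)))" shows "cong C d (Es C d i k X) E"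
proof (rule bform_nondegenerate)
  have "\<forall>Y. bform C d (Es C d i k X) Y = bform C d X (fmul Y (gen (i, k)))"
    unfolding Es_def by (rule someI_ex) (use assms in blast)
  then show "bform C d (Es C d i k X) Y = bform C d E Y" for Y using assms by simp
qed

lemma B_T_adjoint:
  assumes X: "hb i k x y z w p n m r" and v: "v \<in> Sp ordered"
  shows "B (X4 k x y z w) (T (i, k) v) = qi d i (sgnpow k * p + n) * B (G2 i k x y z w) v"
  using v
proof (induction rule: Sp_induct)
  case (mono u)
  obtain x' y' z' w' p' n' m' r' where X': "wd u = X4 k x' y' z' w'" "hb i k x' y' z' w' p' n' m' r'"
    "x' \<in> Sp (\<lambda>u. ordered u \<and> lev {k + 1<..} u)" "w' \<in> Sp (\<lambda>u. ordered u \<and> lev {..<k} u)"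
    by (rule ordered_blocks_hb[OF mono])
  \<comment> \<open>\<open>B_adjoint\<close> is used with the arguments exchanged, since f_{i,k}
    multiplies the second one here.\<close>
  show ?case unfolding X'(1) T_blocks[OF X'(2-4)] B_simps_right B_sym[of "X4 k x y z w"] B_sym[of "G2 i k x y z w"]
    by (rule B_adjoint(1)[OF X'(2) X])
qed (simp_all add: distrib_left)

lemma B_right_adjoint:
  assumes X: "hb i k x y z w p n m r" and v: "v \<in> Sp ordered"
  shows "B (X4 k x y z w) (nf (v * wd [(i, k + 1)])) = qi d i (m + sgnpow (k + 1) * r) * B (G1 i k x y z w) v"
  using v
proof (induction rule: Sp_induct)
  case (mono u)
  obtain x' y' z' w' p' n' m' r' where X': "wd u = X4 k x' y' z' w'" "hb i k x' y' z' w' p' n' m' r'"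
    "x' \<in> Sp (\<lambda>u. ordered u \<and> lev {k + 1<..} u)" "w' \<in> Sp (\<lambda>u. ordered u \<and> lev {..<k} u)"
    by (rule ordered_blocks_hb[OF mono])
  show ?case unfolding X'(1) nf_right_blocks[OF X'(2-4)] B_simps_right
    by (rule B_adjoint(2)[OF X X'(2), symmetric])
qed (simp_all add: distrib_left distrib_right)

lemma bform_rep_cong: "eqm RR (ev X) x \<Longrightarrow> x \<in> Sp ordered \<Longrightarrow> bform C d X Y = B x (nf (ev Y))"
  unfolding bform_eq using RadB_cong[of "ev X" x "nf (ev Y)"] by (simp add: nf_ordered nf_Sp_ordered)

lemma block_formulas:
  fixes i :: 'i and k :: int
  assumes x: "in_sub C d {k + 1<..} x" "homog C d wx x" and y: "in_sub C d {k + 1} y" "homog C d wy y"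
    and z: "in_sub C d {k} z" "homog C d wz z" and w: "in_sub C d {..<k} w" "homog C d ww w"
  defines "e \<equiv> sgnpow k * pair C i (\<lambda>j. wx j + wy j)" and "f \<equiv> sgnpow (k + 1) * pair C i (\<lambda>j. wz j + ww j)"
    and "g1 \<equiv> fadd (fsmul (qi d i (-1) - qi d i 1) (m4 x (es_hat C d i (k + 1) y) z w))
              (fsmul (qi d i 1) (m4 x y (fmul (gen (i, k)) z) w))"
    and "g2 \<equiv> fadd (fsmul (qi d i (-1) - qi d i 1) (m4 x y (ep_hat C d i k z) w))
              (fsmul (qi d i 1) (m4 x (fmul y (gen (i, k + 1))) z w))"
  shows "cong C d (fmul (gen (i, k)) (m4 x y z w)) (fsmul (qi d i (e - 1)) g1)"
    and "cong C d (Ep C d i k (m4 x y z w)) (fsmul (qi d i e) g2)"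
    and "cong C d (fmul (m4 x y z w) (gen (i, k + 1))) (fsmul (qi d i (f - 1)) g2)"
    and "cong C d (Es C d i (k + 1) (m4 x y z w)) (fsmul (qi d i f) g1)"
proof -
  obtain x0 where x0: "eqm RR (ev x) x0" "x0 \<in> Sp (\<lambda>u. ordered u \<and> lev {k + 1<..} u \<and> wwt u = wx)"
    by (rule homogeneous_rep_ordered[OF x])
  obtain w0 where w0: "eqm RR (ev w) w0" "w0 \<in> Sp (\<lambda>u. ordered u \<and> lev {..<k} u \<and> wwt u = ww)"
    by (rule homogeneous_rep_ordered[OF w])
  obtain y0 where y0: "eqm RR (ev y) (lf (k + 1) y0)" "\<forall>i. y0 \<in> Sp (\<lambda>u. N i u = sgnpow (k + 1 + 1) * pair C i wy)"
    by (rule level_rep[OF y])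
  obtain z0 where z0: "eqm RR (ev z) (lf k z0)" "\<forall>i. z0 \<in> Sp (\<lambda>u. N i u = sgnpow (k + 1) * pair C i wz)"
    by (rule level_rep[OF z])
  define p n m r where "p = pair C i wx" and "n = sgnpow k * pair C i wy"
    and "m = sgnpow (k + 1) * pair C i wz" and "r = pair C i ww"
  have hb: "hb i k x0 y0 z0 w0 p n m r"
    unfolding hb_def
  proof (intro conjI)
    show "x0 \<in> Sp (\<lambda>u. lev {k + 1<..} u \<and> Pw i u = p)"
      by (rule Sp_mono_pred[OF x0(2)]) (auto simp: p_def Pw_def)
    show "w0 \<in> Sp (\<lambda>u. lev {..<k} u \<and> Pw i u = r)"
      by (rule Sp_mono_pred[OF w0(2)]) (auto simp: r_def Pw_def)
    \<comment> \<open>Level k + 1 contributes (-1)^{k+2}, so the pairings of x and y merge into a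
      single exponent.\<close>
    have "sgnpow (k + 1 + 1) = sgnpow k" by (simp add: sgnpow_def)
    then show "y0 \<in> Sp (\<lambda>u. N i u = n)" "z0 \<in> Sp (\<lambda>u. N i u = m)"
      using spec[OF y0(2), of i] spec[OF z0(2), of i] by (simp_all only: n_def m_def)
  qed
  have ox: "x0 \<in> Sp (\<lambda>u. ordered u \<and> lev {k + 1<..} u)" and ow: "w0 \<in> Sp (\<lambda>u. ordered u \<and> lev {..<k} u)"
    by (rule Sp_mono_pred[OF x0(2)], simp, rule Sp_mono_pred[OF w0(2)], simp)
  have e: "e = sgnpow k * p + n" and f: "f = m + sgnpow (k + 1) * r"
    unfolding e_def f_def p_def n_def m_def r_def pair_add by (simp_all only: distrib_left)
  have X: "eqm RR (ev (m4 x y z w)) (X4 k x0 y0 z0 w0)"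
    unfolding ev_m4 by (intro eqm_mult x0 y0 z0 w0)
  have g1: "eqm RR (ev g1) (G1 i k x0 y0 z0 w0)"
  proof -
    have "lf k (wd [i] * z0) = wd [(i, k)] * lf k z0" by (simp add: lf_mult)
    then show ?thesis unfolding g1_def G1_def Q_def ev_fadd ev_fsmul ev_m4 ev_fmul ev_gen
      by (auto intro!: eqm_add eqm_sc eqm_mult x0 y0 z0 w0 hat_rep y eqm_refl)
  qed
  have g2: "eqm RR (ev g2) (G2 i k x0 y0 z0 w0)"
  proof -
    have "lf (k + 1) (y0 * wd [i]) = lf (k + 1) y0 * wd [(i, k + 1)]" by (simp add: lf_mult)
    then show ?thesis unfolding g2_def G2_def Q_def ev_fadd ev_fsmul ev_m4 ev_fmul ev_gen
      by (auto intro!: eqm_add eqm_sc eqm_mult x0 y0 z0 w0 hat_rep z eqm_refl)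
  qed
  have "eqm RR (wd [(i, k)] * X4 k x0 y0 z0 w0) (qi d i (e - 1) \<odot> G1 i k x0 y0 z0 w0)"
    unfolding e using hb by (intro eqm_R12_RR left_mult_blocks) (auto simp: hb_def elim!: Sp_mono_pred)
  then have "eqm RR (wd [(i, k)] * ev (m4 x y z w)) (qi d i (e - 1) \<odot> ev g1)"
    using eqm_trans[OF eqm_trans[OF eqm_multl[OF X]] eqm_sc[OF eqm_sym[OF g1]]] by blast
  then show "cong C d (fmul (gen (i, k)) (m4 x y z w)) (fsmul (qi d i (e - 1)) g1)"
    by (simp add: cong_eqm)
  have "eqm RR (X4 k x0 y0 z0 w0 * wd [(i, k + 1)]) (qi d i (f - 1) \<odot> G2 i k x0 y0 z0 w0)"
    unfolding f using hb by (intro eqm_R12_RR right_mult_blocks) (auto simp: hb_def elim!: Sp_mono_pred)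
  then have "eqm RR (ev (m4 x y z w) * wd [(i, k + 1)]) (qi d i (f - 1) \<odot> ev g2)"
    using eqm_trans[OF eqm_trans[OF eqm_multr[OF X]] eqm_sc[OF eqm_sym[OF g2]]] by blast
  then show "cong C d (fmul (m4 x y z w) (gen (i, k + 1))) (fsmul (qi d i (f - 1)) g2)"
    by (simp add: cong_eqm)
  have XB: "bform C d (m4 x y z w) Y = B (X4 k x0 y0 z0 w0) (nf (ev Y))" for Y
    by (rule bform_rep_cong[OF X X4_ordered[OF ox ow]])
  show "cong C d (Ep C d i k (m4 x y z w)) (fsmul (qi d i e) g2)"
  proof (rule Ep_cong)
    fix Y
    have "bform C d (fsmul (qi d i e) g2) Y = B (qi d i e \<odot> G2 i k x0 y0 z0 w0) (nf (ev Y))"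
      by (rule bform_rep_cong) (use g2 ox ow in \<open>auto intro: eqm_sc Sp_sc G_ordered\<close>)
    then show "bform C d (fsmul (qi d i e) g2) Y = bform C d (m4 x y z w) (fmul (gen (i, k)) Y)"
      unfolding XB ev_fmul ev_gen nf_letter B_T_adjoint[OF hb nf_Sp_ordered] e by simp
  qed
  show "cong C d (Es C d i (k + 1) (m4 x y z w)) (fsmul (qi d i f) g1)"
  proof (rule Es_cong)
    fix Y
    have "bform C d (fsmul (qi d i f) g1) Y = B (qi d i f \<odot> G1 i k x0 y0 z0 w0) (nf (ev Y))"
      by (rule bform_rep_cong) (use g1 ox ow in \<open>auto intro: eqm_sc Sp_sc G_ordered\<close>)
    \<comment> \<open>\<open>B_right_adjoint\<close> expects an ordered factor, so Y is straightened
      before being multiplied on the right.\<close>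
    moreover have "nf (ev Y * wd [(i, k + 1)]) = nf (nf (ev Y) * wd [(i, k + 1)])"
      by (intro eqm_R12_nf eqm_multr eqm_nf)
    ultimately show "bform C d (fsmul (qi d i f) g1) Y = bform C d (m4 x y z w) (fmul Y (gen (i, k + 1)))"
      unfolding XB ev_fmul ev_gen using B_right_adjoint[OF hb nf_Sp_ordered, of "ev Y"] by (simp add: f)
  qed
qed

end

theorem theorem6p4:
  fixes C :: "'i::finite \<Rightarrow> 'i \<Rightarrow> int" and d :: "'i \<Rightarrow> nat" and i :: 'i and k :: int
    and x y z w :: "('i \<times> int) fsum" and wx wy wz ww :: "'i \<Rightarrow> int"
  assumes "finite_cartan C d"
    and "in_sub C d {k + 1<..} x" and "in_sub C d {k + 1} y"
    and "in_sub C d {k} z" and "in_sub C d {..<k} w"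
    and "homog C d wx x" and "homog C d wy y" and "homog C d wz z" and "homog C d ww w"
  shows
   "cong C d (fmul (gen (i, k)) (m4 x y z w))
      (fsmul (qi d i (sgnpow k * pair C i (\<lambda>j. wx j + wy j) - 1))
        (fadd (fsmul (qi d i (-1) - qi d i 1) (m4 x (es_hat C d i (k + 1) y) z w))
              (fsmul (qi d i 1) (m4 x y (fmul (gen (i, k)) z) w))))
  \<and> cong C d (Ep C d i k (m4 x y z w))
      (fsmul (qi d i (sgnpow k * pair C i (\<lambda>j. wx j + wy j)))
        (fadd (fsmul (qi d i (-1) - qi d i 1) (m4 x y (ep_hat C d i k z) w))
              (fsmul (qi d i 1) (m4 x (fmul y (gen (i, k + 1))) z w))))
  \<and> cong C d (fmul (m4 x y z w) (gen (i, k + 1)))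
      (fsmul (qi d i (sgnpow (k + 1) * pair C i (\<lambda>j. wz j + ww j) - 1))
        (fadd (fsmul (qi d i (-1) - qi d i 1) (m4 x y (ep_hat C d i k z) w))
              (fsmul (qi d i 1) (m4 x (fmul y (gen (i, k + 1))) z w))))
  \<and> cong C d (Es C d i (k + 1) (m4 x y z w))
      (fsmul (qi d i (sgnpow (k + 1) * pair C i (\<lambda>j. wz j + ww j)))
        (fadd (fsmul (qi d i (-1) - qi d i 1) (m4 x (es_hat C d i (k + 1) y) z w))
              (fsmul (qi d i 1) (m4 x y (fmul (gen (i, k)) z) w))))"
proof -
  interpret cartan C d using assms(1) by (rule cartan.intro)
  show ?thesis
    by (intro conjI block_formulas[OF assms(2,6,3,7,4,8,5,9)])
qed

end
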